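(* Let $F\in\mathfrak F$, let $u\in W_1^1(-1,1)$ be non-negative, and let $\mathfrak a:[-1,1]\times\mathbb R_+\to\mathbb R_+$ be a continuous function such that: (i) $\mathfrak a(s,v)+\mathfrak a(t,v)\ge\mathfrak a(1-t+s,v)$ for all $-1\le s\le t\le1$ and $v\in\mathbb R_+$; (ii) $\mathfrak a(x,v)=\mathfrak a(-x,v)$ for all $x\in[-1,1]$, $v\in\mathbb R_+$; (iii) $I(\mathfrak a,u)<\infty$. Then $I(\mathfrak a,u^* )\le I(\mathfrak a,u)$.
   Context: $\mathbb R_+=[0,\infty)$. $\mathfrak F$ is the set of continuous functions $F:\mathbb R_+\times\mathbb R_+\to\mathbb R_+$ that are convex and strictly increasing with respect to the second argument. For $F\in\mathfrak F$, a continuous weight $\mathfrak a:[-1,1]\times\mathbb R_+\to\mathbb R_+$ and a non-negative $u\in W_1^1(-1,1)$ (absolutely continuous functions on $[-1,1]$), $$I(\mathfrak a,u)=\int_{-1}^1 F\big(u(x),\mathfrak a(x,u(x))\,|u'(x)|\big)\,dx\in[0,\infty].$$ The monotone rearrangement of a measurable set $E\subset[-1,1]$ is $E^*=[1-|E|,1]$, with $|E|$ the Lebesgue measure and $\emptyset^*=\emptyset$. For non-negative $u\in W_1^1(-1,1)$, with $\mathcal A_t=\{x\in[-1,1]:u(x)>t\}$, the monotone rearrangement of $u$ is $u^*(x)=\int_0^\infty\chi_{\mathcal A_t^*}(x)\,dt$; it is a non-decreasing function in $W_1^1(-1,1)$. *)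

theory Defs
  imports "HOL-Analysis.Analysis"
begin

text \<open>
  Functions on a subset of the reals are modelled as total functions; all conditions below are
  relativised to the mathematical domain, and values outside it are unconstrained.
\<close>

definition class_F :: "(real \<Rightarrow> real \<Rightarrow> real) set" where
  "class_F = {F.
     continuous_on ({0..} \<times> {0..}) (\<lambda>(v, p). F v p) \<and>
     (\<forall>v\<ge>0. \<forall>p\<ge>0. 0 \<le> F v p) \<and>
     (\<forall>v\<ge>0. convex_on {0..} (F v) \<and> strict_mono_on {0..} (F v))}"

definition absolutely_continuous_on :: "real set \<Rightarrow> (real \<Rightarrow> real) \<Rightarrow> bool" where
  "absolutely_continuous_on S f \<longleftrightarrow>
     (\<forall>\<epsilon>>0. \<exists>\<delta>>0. \<forall>n l r.
        (\<forall>i<n. l i \<le> r i \<and> {l i..r i} \<subseteq> S) \<longrightarrow>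
        disjoint_family_on (\<lambda>i::nat. {l i<..<r i}) {..<n} \<longrightarrow>
        (\<Sum>i<n. r i - l i) < \<delta> \<longrightarrow>
        (\<Sum>i<n. \<bar>f (r i) - f (l i)\<bar>) < \<epsilon>)"

text \<open>
  An absolutely continuous \<open>u\<close> is differentiable almost everywhere, so \<open>deriv u\<close> is a version of
  \<open>u'\<close>: it is unspecified only on a null set (which includes the end points, where it may depend
  on values of \<open>u\<close> outside the interval). The integral is taken with respect to the completed
  measure, and \<open>\<integral>\<^sup>+\<close> may take the value \<open>\<infinity>\<close>.
\<close>

definition energy ::
  "(real \<Rightarrow> real \<Rightarrow> real) \<Rightarrow> (real \<Rightarrow> real \<Rightarrow> real) \<Rightarrow> (real \<Rightarrow> real) \<Rightarrow> ennreal" where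
  "energy F a u =
     (\<integral>\<^sup>+ x\<in>{-1..1}. ennreal (F (u x) (a x (u x) * \<bar>deriv u x\<bar>)) \<partial>lebesgue)"

definition rearr_set :: "real set \<Rightarrow> real set" where
  "rearr_set E = (if E = {} then {} else {1 - measure lebesgue E..1})"

definition rearr :: "(real \<Rightarrow> real) \<Rightarrow> real \<Rightarrow> real" where
  "rearr u x = (LBINT t:{0..}. indicator (rearr_set {y \<in> {-1..1}. u y > t}) x)"

end

theory Submission
  imports Defs
begin

text \<open>
  Write \<open>S = [-1,1]\<close>, let \<open>g\<close> be the rearrangement of \<open>u\<close> and let
  \<open>X t = 1 - |{u > t}|\<close> be the point at which \<open>g\<close> passes the level \<open>t\<close>. For convex \<open>F\<close> the energy
  can be compared level by level, through two facts.

  The first concerns one level \<open>t\<close>. The set \<open>{u > t}\<close> is, up to a small modification, a finite union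
  of disjoint intervals of total length \<open>1 - X t\<close>. A single interval \<open>[x, y]\<close> satisfies
  \<open>a x t + a y t \<ge> a (1 - (y - x)) t\<close> by hypothesis (i). Two intervals of lengths \<open>L\<close> and \<open>M\<close> can be
  merged into one of length \<open>L + M\<close>, because (i) applied to \<open>L - 1 \<le> 1 - M\<close> and evenness give
  \<open>a (1 - L) t + a (1 - M) t \<ge> a (1 - (L + M)) t\<close>. An interval that ends at a boundary point of \<open>S\<close>
  contributes just one end point, and evenness makes that enough. So for a level between the minimum
  and the maximum of \<open>u\<close> the sum of \<open>a(\<cdot>, t)\<close> over the end points of these intervals inside \<open>S\<close> is
  at least \<open>a (X t) t\<close>. Integrated over the levels this is
  the inequality of measures
  \<open>\<integral> h(g) a(x, g) g' dx \<le> \<integral> h(u) a(x, u) |u'| dx\<close> for bounded Borel \<open>h \<ge> 0\<close>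
  (\<open>transport_comparison\<close>). It is proved without an area formula: \<open>slab_lower_bound\<close> treats a slab
  \<open>s < u \<le> t\<close> with the weight frozen at one level, \<open>slab_comparison\<close> bounds the error of freezing, and
  \<open>emeasure_le_of_short_intervals\<close> passes from short slabs to all Borel sets of levels.

  The second is that \<open>a(x, g) g'\<close> is almost everywhere a function of the level alone, say \<open>q(g)\<close>
  (\<open>AE_level_slope_g\<close>): where \<open>g\<close> is not locally constant, the level determines the point.
  If \<open>c v\<close> is a slope supporting the convex function \<open>F v\<close> at \<open>q v\<close>, then
  \<open>F(u, a|u'|) \<ge> F(u, q(u)) - c(u) q(u) + c(u) a |u'|\<close>. The first two terms on the right depend on \<open>u\<close> only
  through its distribution, which \<open>g\<close> shares (\<open>equimeasurable\<close>); the last term decreases under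
  rearrangement by the first fact. Hence the integral of the right-hand side is at least
  \<open>\<integral> F(g, q(g)) = \<integral> F(g, a g')\<close>. To have finite integrals throughout, \<open>q\<close> is first truncated at height
  \<open>n\<close>, and then \<open>n\<close> tends to infinity by monotone convergence.

  Both facts rest on the calculus of absolutely continuous functions, which is developed first:
  differentiability almost everywhere (by a Vitali covering argument), the fundamental theorem of
  calculus, and absolute continuity of \<open>g\<close>.
\<close>

section \<open>Absolute continuity and differentiability almost everywhere\<close>

text \<open>
  The condition on a single pair \<open>(\<epsilon>, \<delta>)\<close> is kept as a predicate, so that one \<open>\<delta>\<close> can be applied to
  families over index sets of different types.
\<close>

definition ac_bound :: "real set \<Rightarrow> (real \<Rightarrow> real) \<Rightarrow> real \<Rightarrow> real \<Rightarrow> bool" where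
  "ac_bound S f \<epsilon> \<delta> \<longleftrightarrow>
     (\<forall>n l r.
        (\<forall>i<n. l i \<le> r i \<and> {l i..r i} \<subseteq> S) \<longrightarrow>
        disjoint_family_on (\<lambda>i::nat. {l i<..<r i}) {..<n} \<longrightarrow>
        (\<Sum>i<n. r i - l i) < \<delta> \<longrightarrow>
        (\<Sum>i<n. \<bar>f (r i) - f (l i)\<bar>) < \<epsilon>)"

lemma absolutely_continuous_on_iff_ac_bound:
  "absolutely_continuous_on S f \<longleftrightarrow> (\<forall>\<epsilon>>0. \<exists>\<delta>>0. ac_bound S f \<epsilon> \<delta>)"
  unfolding absolutely_continuous_on_def ac_bound_def ..

lemma ac_boundD:
  fixes l r :: "'i \<Rightarrow> real"
  assumes "ac_bound S f \<epsilon> \<delta>" and I: "finite I"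
    and lr: "\<And>i. i \<in> I \<Longrightarrow> l i \<le> r i \<and> {l i..r i} \<subseteq> S"
    and disj: "disjoint_family_on (\<lambda>i. {l i<..<r i}) I"
    and less: "(\<Sum>i\<in>I. r i - l i) < \<delta>"
  shows "(\<Sum>i\<in>I. \<bar>f (r i) - f (l i)\<bar>) < \<epsilon>"
proof -
  obtain h where h: "bij_betw h {..<card I} I"
    using ex_bij_betw_nat_finite[OF I] by (auto simp: atLeast0LessThan)
  have hI: "h i \<in> I" if "i < card I" for i
    using h that by (auto simp: bij_betw_def)
  have "(\<Sum>i<card I. \<bar>f (r (h i)) - f (l (h i))\<bar>) < \<epsilon>"
  proof (rule assms(1)[unfolded ac_bound_def, rule_format, of "card I" "\<lambda>i. l (h i)" "\<lambda>i. r (h i)"])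
    show "disjoint_family_on (\<lambda>i. {l (h i)<..<r (h i)}) {..<card I}"
      using disj h unfolding disjoint_family_on_def bij_betw_def inj_on_def
      by (metis hI lessThan_iff)
    show "(\<Sum>i<card I. r (h i) - l (h i)) < \<delta>"
      using less sum.reindex_bij_betw[OF h, of "\<lambda>i. r i - l i"] by simp
  qed (use lr hI in auto)
  then show ?thesis
    using sum.reindex_bij_betw[OF h, of "\<lambda>i. \<bar>f (r i) - f (l i)\<bar>"] by simp
qed

definition increment :: "(real \<Rightarrow> real) \<Rightarrow> real set \<Rightarrow> real" where
  "increment f K = f (Sup K) - f (Inf K)"

lemma increment_Icc: "c \<le> e \<Longrightarrow> increment f {c..e} = f e - f c"
  by (simp add: increment_def)

lemma division_of_realE:
  fixes K :: "real set"
  assumes "p division_of S" "K \<in> p"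
  obtains c e where "c \<le> e" "K = {c..e}"
proof -
  obtain c e where "K = cbox c e" "K \<noteq> {}"
    using division_ofD[OF assms(1)] assms(2) by metis
  then show thesis using that[of c e] by auto
qed

lemma content_eq_increment:
  fixes K :: "real set"
  assumes "p division_of S" "K \<in> p"
  shows "measure lebesgue K = increment (\<lambda>x. x) K"
  using division_of_realE[OF assms] by (metis increment_Icc content_real measure_completion sets_lborel borel_closed closed_atLeastAtMost)

lemma ac_bound_division:
  assumes "ac_bound S f \<epsilon> \<delta>" and p: "p division_of \<Union>p" and "\<Union>p \<subseteq> S"
    and less: "(\<Sum>K\<in>p. increment (\<lambda>x. x) K) < \<delta>"
  shows "(\<Sum>K\<in>p. \<bar>increment f K\<bar>) < \<epsilon>"
  unfolding increment_def
proof (rule ac_boundD[OF assms(1), of p Inf Sup])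
  show "finite p" using p by auto
  show "Inf K \<le> Sup K \<and> {Inf K..Sup K} \<subseteq> S" if "K \<in> p" for K
    using division_of_realE[OF p that] \<open>\<Union>p \<subseteq> S\<close> that by (metis Sup_upper cInf_atLeastAtMost cSup_atLeastAtMost order_trans)
  show "disjoint_family_on (\<lambda>K. {Inf K<..<Sup K}) p"
    unfolding disjoint_family_on_def
  proof (intro ballI impI)
    fix K L assume KL: "K \<in> p" "L \<in> p" "K \<noteq> L"
    have *: "{Inf K<..<Sup K} = interior K" if "K \<in> p" for K
      using division_of_realE[OF p that] by (metis cInf_atLeastAtMost cSup_atLeastAtMost interior_atLeastAtMost_real)
    show "{Inf K<..<Sup K} \<inter> {Inf L<..<Sup L} = {}"
      using division_ofD(5)[OF p KL] * KL by simp
  qed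
  show "(\<Sum>K\<in>p. Sup K - Inf K) < \<delta>" using less by (simp add: increment_def)
qed

lemma sum_increment_division:
  fixes f :: "real \<Rightarrow> real"
  assumes "a \<le> b" and q: "q division_of {a..b}"
  shows "(\<Sum>K\<in>q. increment f K) = f b - f a"
proof -
  have K: "\<exists>c e. c \<le> e \<and> K = {c..e}" if "K \<in> q" for K
    using division_of_realE[OF q that] by metis
  have "(\<lambda>K. (Inf K, K)) ` q tagged_division_of {a..b}"
  proof (rule tagged_division_ofI)
    show "finite ((\<lambda>K. (Inf K, K)) ` q)" using q by auto
    show "x \<in> K" "K \<subseteq> {a..b}" "\<exists>a b. K = cbox a b"
      if "(x, K) \<in> (\<lambda>K. (Inf K, K)) ` q" for x K
      using that K[of K] division_ofD[OF q] by auto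
    show "interior K \<inter> interior K2 = {}"
      if "(x, K) \<in> (\<lambda>K. (Inf K, K)) ` q" "(x2, K2) \<in> (\<lambda>K. (Inf K, K)) ` q" "(x, K) \<noteq> (x2, K2)"
      for x K x2 K2
      using that division_ofD(5)[OF q] by auto
    show "\<Union> {K. \<exists>x. (x, K) \<in> (\<lambda>K. (Inf K, K)) ` q} = {a..b}"
      using division_ofD(6)[OF q] by (auto simp: image_iff)
  qed
  from additive_tagged_division_1[OF \<open>a \<le> b\<close> this, of f]
  show ?thesis
    by (subst (asm) sum.reindex) (auto simp: inj_on_def increment_def)
qed

text \<open>
  A finite version of the Vitali covering theorem on the line. All constraints on the covering
  intervals are packed into \<open>P\<close>; demanding \<open>{c..e} \<subseteq> Q\<close> keeps every finite union within finite measure,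
  which is what allows the countable Vitali family to be cut off.
\<close>

lemma Vitali_finite_intervals:
  fixes E Q :: "real set"
  assumes E: "E \<in> lmeasurable" and Q: "Q \<in> lmeasurable" and "\<eta> > 0"
    and PQ: "\<And>c e. P c e \<Longrightarrow> {c..e} \<subseteq> Q"
    and cover: "\<And>x d. x \<in> E \<Longrightarrow> 0 < d \<Longrightarrow> \<exists>c e. c < e \<and> c \<le> x \<and> x \<le> e \<and> e - c < d \<and> P c e"
  obtains \<D> where "\<D> division_of \<Union>\<D>" "pairwise disjnt \<D>"
    "\<And>K. K \<in> \<D> \<Longrightarrow> \<exists>c e. c < e \<and> K = {c..e} \<and> P c e"
    "measure lebesgue E - \<eta> < (\<Sum>K\<in>\<D>. increment (\<lambda>x. x) K)"
    "(\<Sum>K\<in>\<D>. increment (\<lambda>x. x) K) = measure lebesgue (\<Union>\<D>)"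
    "\<Union>\<D> \<subseteq> Q"
proof -
  define K where "K = {(c,e). c < e \<and> P c e}"
  define mid where "mid = (\<lambda>(c,e). (c + e) / 2 :: real)"
  define rad where "rad = (\<lambda>(c,e). (e - c) / 2 :: real)"
  have cb: "cball (mid i) (rad i) = {fst i..snd i}" for i
    by (cases i) (auto simp: mid_def rad_def cball_eq_atLeastAtMost field_simps)
  obtain C where C: "countable C" "C \<subseteq> K"
     "pairwise (\<lambda>i j. disjnt (cball (mid i) (rad i)) (cball (mid j) (rad j))) C"
     "negligible (E - (\<Union>i \<in> C. cball (mid i) (rad i)))"
  proof (rule Vitali_covering_theorem_cballs[of K rad E mid])
    show "0 < rad i" if "i \<in> K" for i using that by (auto simp: K_def rad_def)
    show "\<exists>i. i \<in> K \<and> x \<in> cball (mid i) (rad i) \<and> rad i < d" if x: "x \<in> E" "0 < d" for x d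
    proof -
      obtain c e where "c < e" "c \<le> x" "x \<le> e" "e - c < d" "P c e" using cover[OF x] by blast
      then show ?thesis unfolding cb by (intro exI[of _ "(c,e)"]) (auto simp: K_def rad_def)
    qed
  qed
  let ?D = "(\<lambda>i. {fst i..snd i}) ` C"
  have CQ: "{fst i..snd i} \<subseteq> Q" if "i \<in> C" for i
  proof (rule PQ)
    show "P (fst i) (snd i)" using that C(2) by (cases i) (auto simp: K_def)
  qed
  have pw: "pairwise disjnt ?D"
    using C(3) unfolding cb pairwise_def by auto
  obtain \<D> where D: "\<D> \<subseteq> ?D" "finite \<D>" "measure lebesgue (\<Union>?D) - \<eta> < measure lebesgue (\<Union>\<D>)"
  proof (rule measure_countable_Union_approachable[of ?D \<eta> "measure lebesgue Q"])
    show "measure lebesgue (\<Union> D') \<le> measure lebesgue Q" if "D' \<subseteq> ?D" "finite D'" for D'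
    proof (rule measure_mono_fmeasurable[OF _ _ Q])
      show "\<Union>D' \<subseteq> Q" using that(1) CQ by blast
      show "\<Union>D' \<in> sets lebesgue" using that by (intro sets.finite_Union) auto
    qed
  qed (use C \<open>\<eta> > 0\<close> in auto)
  have lmU: "\<Union>?D \<in> lmeasurable"
    using C(1) CQ Q by (intro fmeasurableI2[OF Q]) (auto intro!: sets.countable_UN')
  have "measure lebesgue E \<le> measure lebesgue (\<Union>?D \<union> (E - \<Union>?D))"
    using C(4) lmU E by (intro measure_mono_fmeasurable) auto
  also have "\<dots> = measure lebesgue (\<Union>?D)"
    using C(4) unfolding cb by (intro measure_Un_null_set) (use lmU in \<open>auto simp: negligible_iff_null_sets\<close>)
  finally have m: "measure lebesgue E - \<eta> < measure lebesgue (\<Union>\<D>)" using D by simp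
  have form: "\<exists>c e. c < e \<and> K = {c..e} \<and> P c e" if "K \<in> \<D>" for K
  proof -
    obtain i where "i \<in> C" "K = {fst i..snd i}" using \<open>K \<in> \<D>\<close> D(1) by auto
    then show ?thesis using C(2) by (cases i) (auto simp: K_def)
  qed
  have pwD: "pairwise disjnt \<D>" using pw D(1) pairwise_subset by blast
  have div: "\<D> division_of \<Union>\<D>"
  proof (rule division_ofI)
    show "finite \<D>" by fact
    show "K \<noteq> {}" "\<exists>a b. K = cbox a b" if "K \<in> \<D>" for K
      using form[OF that] by auto
    show "interior K1 \<inter> interior K2 = {}" if "K1 \<in> \<D>" "K2 \<in> \<D>" "K1 \<noteq> K2" for K1 K2
      using pwD that interior_subset unfolding pairwise_def disjnt_def by blast
  qed auto
  have "(\<Sum>K\<in>\<D>. increment (\<lambda>x. x) K) = (\<Sum>K\<in>\<D>. measure lebesgue K)"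
    using content_eq_increment[OF div] by (intro sum.cong) auto
  also have "\<dots> = measure lebesgue (\<Union>\<D>)"
    using form pwD \<open>finite \<D>\<close>
    by (intro measure_Union'[symmetric]) (auto simp: pairwise_def disjnt_def, (metis lmeasurable_cbox box_real(2))?)
  finally have s: "(\<Sum>K\<in>\<D>. increment (\<lambda>x. x) K) = measure lebesgue (\<Union>\<D>)" .
  have "\<Union>\<D> \<subseteq> Q" using D(1) CQ by blast
  then show thesis
    using that[OF div pwD form _ s] m s by simp
qed

text \<open>
  This is the core of differentiability almost everywhere. Suppose \<open>E\<close> has measure \<open>s > 0\<close>. Cover almost all of
  it by intervals \<open>\<A>\<close> of slope at most \<open>r\<close> inside an open set not much larger than \<open>E\<close>, then cover
  almost all of \<open>E\<close> again by intervals \<open>\<B>\<close> of slope at least \<open>R\<close> inside the interiors of the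
  members of \<open>\<A>\<close>. The increment of \<open>f\<close> over \<open>\<A>\<close> is the one over \<open>\<B>\<close> plus the one over the gaps, and the
  gaps have small total length, hence a small increment by absolute continuity. So about \<open>R s\<close> is at
  most about \<open>r s\<close>, a contradiction.
\<close>

lemma negligible_oscillating_slopes:
  assumes ac: "absolutely_continuous_on {a..b} f" and E: "E \<in> lmeasurable" "E \<subseteq> {a<..<b}" and "r < R"
    and low: "\<And>x d. x \<in> E \<Longrightarrow> 0 < d \<Longrightarrow>
      \<exists>c e. c < e \<and> c \<le> x \<and> x \<le> e \<and> e - c < d \<and> f e - f c \<le> r * (e - c)"
    and high: "\<And>x d. x \<in> E \<Longrightarrow> 0 < d \<Longrightarrow>
      \<exists>c e. c < e \<and> c \<le> x \<and> x \<le> e \<and> e - c < d \<and> R * (e - c) \<le> f e - f c"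
  shows "negligible E"
proof (rule ccontr)
  assume "\<not> negligible E"
  define s where "s = measure lebesgue E"
  have "s > 0"
    using \<open>\<not> negligible E\<close> E by (simp add: s_def zero_less_measure_iff negligible_iff_measure0)
  define \<epsilon> where "\<epsilon> = (R - r) * s / 8"
  have "\<epsilon> > 0" using \<open>s > 0\<close> \<open>r < R\<close> by (simp add: \<epsilon>_def)
  then obtain \<delta> where \<delta>: "\<delta> > 0" "ac_bound {a..b} f \<epsilon> \<delta>"
    using ac unfolding absolutely_continuous_on_iff_ac_bound by blast
  \<comment> \<open>The gaps below have total length at most \<open>4 * \<eta>\<close>: the intervals \<open>\<A>\<close> have total length at most
    \<open>s + \<eta>\<close>, their interiors may miss a part of \<open>E\<close> of measure \<open>2 * \<eta>\<close>, and \<open>\<B>\<close> may miss \<open>\<eta>\<close> more.\<close>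
  define \<eta> where "\<eta> = min (\<delta> / 8) (min (s / 8) (\<epsilon> / (4 * (\<bar>r\<bar> + 1))))"
  have \<eta>: "\<eta> > 0" "\<eta> \<le> \<delta> / 8" "\<eta> \<le> s / 8" "\<bar>r\<bar> * (4 * \<eta>) \<le> \<epsilon>"
  proof -
    show "\<eta> > 0" using \<delta> \<open>s > 0\<close> \<open>\<epsilon> > 0\<close> by (auto simp: \<eta>_def)
    show "\<eta> \<le> \<delta> / 8" "\<eta> \<le> s / 8" unfolding \<eta>_def by linarith+
    have "\<eta> \<le> \<epsilon> / (4 * (\<bar>r\<bar> + 1))" by (simp add: \<eta>_def)
    then have "4 * \<eta> * (\<bar>r\<bar> + 1) \<le> \<epsilon>" by (simp add: field_simps)
    then show "\<bar>r\<bar> * (4 * \<eta>) \<le> \<epsilon>" using \<open>\<eta> > 0\<close> by (simp add: algebra_simps)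
  qed
  obtain T where T: "open T" "E \<subseteq> T" "T - E \<in> lmeasurable" "emeasure lebesgue (T - E) < ennreal \<eta>"
    using sets_lebesgue_outer_open[of E \<eta>] E \<open>\<eta> > 0\<close> by (auto simp: fmeasurableD)
  define Q where "Q = T \<inter> {a<..<b}"
  have Q: "open Q" "E \<subseteq> Q" "Q \<subseteq> {a..b}" using T E by (auto simp: Q_def)
  have Qm: "Q \<in> lmeasurable"
    using Q by (intro bounded_set_imp_lmeasurable bounded_subset[OF bounded_closed_interval]) auto
  have QE: "measure lebesgue Q \<le> s + \<eta>"
  proof -
    have "E \<union> (T - E) \<in> lmeasurable" using T(3) E(1) by (rule fmeasurable.Un[rotated])
    then have "measure lebesgue Q \<le> measure lebesgue (E \<union> (T - E))"
      using Qm by (intro measure_mono_fmeasurable) (auto simp: Q_def)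
    also have "\<dots> \<le> s + measure lebesgue (T - E)"
      unfolding s_def using T E by (intro measure_Un_le) auto
    also have "measure lebesgue (T - E) \<le> \<eta>"
      using T(3,4) \<open>\<eta> > 0\<close> by (simp add: emeasure_eq_measure2 fmeasurableD2 ennreal_less_iff)
    finally show ?thesis by simp
  qed
  obtain \<A> where A: "\<A> division_of \<Union>\<A>" "pairwise disjnt \<A>"
    "\<And>K. K \<in> \<A> \<Longrightarrow> \<exists>c e. c < e \<and> K = {c..e} \<and> ({c..e} \<subseteq> Q \<and> f e - f c \<le> r * (e - c))"
    "s - \<eta> < (\<Sum>K\<in>\<A>. increment (\<lambda>x. x) K)"
    "(\<Sum>K\<in>\<A>. increment (\<lambda>x. x) K) = measure lebesgue (\<Union>\<A>)" "\<Union>\<A> \<subseteq> Q"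
  proof (rule Vitali_finite_intervals[of E Q \<eta> "\<lambda>c e. {c..e} \<subseteq> Q \<and> f e - f c \<le> r * (e - c)"])
    fix x d :: real assume x: "x \<in> E" "0 < d"
    then obtain d' where d': "d' > 0" "ball x d' \<subseteq> Q" using Q open_contains_ball by blast
    obtain c e where ce: "c < e" "c \<le> x" "x \<le> e" "e - c < min d d'" "f e - f c \<le> r * (e - c)"
      using low[of x "min d d'"] x d' by auto
    then have "{c..e} \<subseteq> ball x d'" by (auto simp: dist_real_def)
    then show "\<exists>c e. c < e \<and> c \<le> x \<and> x \<le> e \<and> e - c < d \<and> {c..e} \<subseteq> Q \<and> f e - f c \<le> r * (e - c)"
      using ce d' by (intro exI[of _ c] exI[of _ e]) auto
  qed (use E Qm \<open>\<eta> > 0\<close> in \<open>auto simp: s_def\<close>)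
  have finA: "finite \<A>" using A(1) by auto
  have Alm: "\<Union>\<A> \<in> lmeasurable"
    using A(3) finA by (intro fmeasurable.finite_Union) (auto, (metis lmeasurable_cbox box_real(2))?)
  define U where "U = (\<Union>K\<in>\<A>. interior K)"
  define E' where "E' = E \<inter> U"
  have E'm: "E' \<in> lmeasurable"
    unfolding E'_def U_def using E by (intro fmeasurable_Int_fmeasurable) (auto intro!: borel_open sets.finite_UN finA)
  have mE': "s - 2 * \<eta> \<le> measure lebesgue E'"
  proof -
    have "\<Union>\<A> - U \<subseteq> (\<Union>K\<in>\<A>. frontier K)"
      using A(3) by (auto simp: U_def frontier_def closure_def)
    moreover have "negligible (\<Union>K\<in>\<A>. frontier K)"
      using A(1) finA by (intro negligible_Union) (auto simp: division_of_def negligible_convex_frontier)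
    ultimately have n: "negligible (\<Union>\<A> - U)" using negligible_subset by blast
    have "Q = (Q - \<Union>\<A>) \<union> \<Union>\<A>" using A(6) by auto
    have "measure lebesgue E \<le> measure lebesgue (E' \<union> ((Q - \<Union>\<A>) \<union> (\<Union>\<A> - U)))"
      using E E'm Qm Alm n Q(2)
      by (intro measure_mono_fmeasurable fmeasurable.Un) (auto simp: E'_def negligible_imp_measurable)
    also have "\<dots> \<le> measure lebesgue E' + measure lebesgue ((Q - \<Union>\<A>) \<union> (\<Union>\<A> - U))"
      using E E'm Qm Alm n by (intro measure_Un_le) (auto simp: negligible_imp_sets)
    also have "measure lebesgue ((Q - \<Union>\<A>) \<union> (\<Union>\<A> - U)) \<le> measure lebesgue (Q - \<Union>\<A>) + measure lebesgue (\<Union>\<A> - U)"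
      using E E'm Qm Alm n by (intro measure_Un_le) (auto simp: negligible_imp_sets)
    also have "measure lebesgue (\<Union>\<A> - U) = 0" using n by (rule negligible_imp_measure0)
    also have "measure lebesgue (Q - \<Union>\<A>) = measure lebesgue Q - measure lebesgue (\<Union>\<A>)"
      using Qm Alm A(6) by (intro measurable_measure_Diff) auto
    finally show ?thesis using QE A(4,5) s_def by linarith
  qed
  obtain \<B> where B: "\<B> division_of \<Union>\<B>" "pairwise disjnt \<B>"
    "\<And>J. J \<in> \<B> \<Longrightarrow> \<exists>c e. c < e \<and> J = {c..e} \<and> ((\<exists>K\<in>\<A>. {c..e} \<subseteq> interior K) \<and> R * (e - c) \<le> f e - f c)"
    "measure lebesgue E' - \<eta> < (\<Sum>K\<in>\<B>. increment (\<lambda>x. x) K)"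
    "(\<Sum>K\<in>\<B>. increment (\<lambda>x. x) K) = measure lebesgue (\<Union>\<B>)" "\<Union>\<B> \<subseteq> \<Union>\<A>"
  proof (rule Vitali_finite_intervals[of E' "\<Union>\<A>" \<eta> "\<lambda>c e. (\<exists>K\<in>\<A>. {c..e} \<subseteq> interior K) \<and> R * (e - c) \<le> f e - f c"])
    fix x d :: real assume x: "x \<in> E'" "0 < d"
    then obtain K where K: "K \<in> \<A>" "x \<in> interior K" by (auto simp: E'_def U_def)
    then obtain d' where d': "d' > 0" "ball x d' \<subseteq> interior K" using open_interior open_contains_ball by blast
    obtain c e where ce: "c < e" "c \<le> x" "x \<le> e" "e - c < min d d'" "R * (e - c) \<le> f e - f c"
      using high[of x "min d d'"] x d' by (auto simp: E'_def)
    then have "{c..e} \<subseteq> ball x d'" by (auto simp: dist_real_def)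
    then show "\<exists>c e. c < e \<and> c \<le> x \<and> x \<le> e \<and> e - c < d \<and> (\<exists>K\<in>\<A>. {c..e} \<subseteq> interior K) \<and> R * (e - c) \<le> f e - f c"
      using ce d' K by (intro exI[of _ c] exI[of _ e]) auto
  next
    show "{c..e} \<subseteq> \<Union>\<A>" if "(\<exists>K\<in>\<A>. {c..e} \<subseteq> interior K) \<and> R * (e - c) \<le> f e - f c" for c e
      using that interior_subset by blast
  qed (use E'm Alm \<open>\<eta> > 0\<close> in auto)
  have finB: "finite \<B>" using B(1) by auto
  \<comment> \<open>Completing the members of \<open>\<B>\<close> inside \<open>K\<close> to a division of \<open>K\<close> produces the gaps.\<close>
  have "\<exists>q. {J\<in>\<B>. J \<subseteq> K} \<subseteq> q \<and> q division_of K" if K: "K \<in> \<A>" for K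
  proof -
    obtain c e where "K = cbox c e" using A(3)[OF K] by auto
    moreover have "{J\<in>\<B>. J \<subseteq> K} division_of \<Union>{J\<in>\<B>. J \<subseteq> K}"
      using B(1) by (rule division_of_subset) auto
    moreover have "\<Union>{J\<in>\<B>. J \<subseteq> K} \<subseteq> K" by auto
    ultimately show ?thesis
      using partial_division_extend_interval[of "{J\<in>\<B>. J \<subseteq> K}" c e] by metis
  qed
  then obtain q where q: "\<And>K. K \<in> \<A> \<Longrightarrow> {J\<in>\<B>. J \<subseteq> K} \<subseteq> q K" "\<And>K. K \<in> \<A> \<Longrightarrow> q K division_of K"
    by metis
  have finq: "finite (q K)" if "K \<in> \<A>" for K using q(2)[OF that] by auto
  define gaps where "gaps K = q K - {J\<in>\<B>. J \<subseteq> K}" for K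
  define G where "G = (\<Union>K\<in>\<A>. gaps K)"
  have gapsub: "J \<subseteq> K" "J \<noteq> {}" "J \<in> q K" if "J \<in> gaps K" "K \<in> \<A>" for J K
    using that q(2)[OF that(2)] by (auto simp: gaps_def division_of_def)
  have Kdisj: "K \<inter> K' = {}" if "K \<in> \<A>" "K' \<in> \<A>" "K \<noteq> K'" for K K'
    using A(2) that by (auto simp: pairwise_def disjnt_def)
  have uniq: "K = K'" if "J \<subseteq> K" "J \<subseteq> K'" "J \<noteq> {}" "K \<in> \<A>" "K' \<in> \<A>" for J K K'
    using Kdisj[of K K'] that by (metis Int_greatest subset_empty)
  have Bne: "J \<noteq> {}" if "J \<in> \<B>" for J using B(3)[OF that] by auto
  have split: "(\<Sum>K\<in>\<A>. increment \<phi> K) = (\<Sum>J\<in>\<B>. increment \<phi> J) + (\<Sum>J\<in>G. increment \<phi> J)" for \<phi>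
  proof -
    have "(\<Sum>K\<in>\<A>. increment \<phi> K) = (\<Sum>K\<in>\<A>. (\<Sum>J\<in>{J\<in>\<B>. J \<subseteq> K}. increment \<phi> J) + (\<Sum>J\<in>gaps K. increment \<phi> J))"
    proof (rule sum.cong)
      fix K assume K: "K \<in> \<A>"
      obtain c e where ce: "c < e" "K = {c..e}" using A(3)[OF K] by auto
      have "increment \<phi> K = (\<Sum>J\<in>q K. increment \<phi> J)"
        using sum_increment_division[of c e "q K" \<phi>] q(2)[OF K] ce by (simp add: increment_Icc)
      also have "\<dots> = (\<Sum>J\<in>{J\<in>\<B>. J \<subseteq> K}. increment \<phi> J) + (\<Sum>J\<in>gaps K. increment \<phi> J)"
        using sum.subset_diff[OF q(1)[OF K] finq[OF K]] by (simp add: gaps_def add.commute)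
      finally show "increment \<phi> K = \<dots>" .
    qed simp
    also have "\<dots> = (\<Sum>K\<in>\<A>. \<Sum>J\<in>{J\<in>\<B>. J \<subseteq> K}. increment \<phi> J) + (\<Sum>K\<in>\<A>. \<Sum>J\<in>gaps K. increment \<phi> J)"
      by (rule sum.distrib)
    also have "(\<Sum>K\<in>\<A>. \<Sum>J\<in>{J\<in>\<B>. J \<subseteq> K}. increment \<phi> J) = (\<Sum>J\<in>(\<Union>K\<in>\<A>. {J\<in>\<B>. J \<subseteq> K}). increment \<phi> J)"
    proof (rule sum.UNION_disjoint[symmetric])
      show "\<forall>K\<in>\<A>. \<forall>K'\<in>\<A>. K \<noteq> K' \<longrightarrow> {J\<in>\<B>. J \<subseteq> K} \<inter> {J\<in>\<B>. J \<subseteq> K'} = {}"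
      proof (intro ballI impI, rule ccontr)
        fix K K' assume K: "K \<in> \<A>" "K' \<in> \<A>" "K \<noteq> K'"
          and "{J\<in>\<B>. J \<subseteq> K} \<inter> {J\<in>\<B>. J \<subseteq> K'} \<noteq> {}"
        then obtain J where "J \<in> \<B>" "J \<subseteq> K" "J \<subseteq> K'" by auto
        with uniq[of J K K'] Bne[of J] K show False by simp
      qed
    qed (use finA finB in auto)
    also have "(\<Union>K\<in>\<A>. {J\<in>\<B>. J \<subseteq> K}) = \<B>"
    proof -
      have "\<exists>K\<in>\<A>. J \<subseteq> K" if "J \<in> \<B>" for J
        using B(3)[OF that] interior_subset by (metis order_trans)
      then show ?thesis by auto
    qed
    also have "(\<Sum>K\<in>\<A>. \<Sum>J\<in>gaps K. increment \<phi> J) = (\<Sum>J\<in>G. increment \<phi> J)"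
      unfolding G_def
    proof (rule sum.UNION_disjoint[symmetric])
      show "\<forall>K\<in>\<A>. \<forall>K'\<in>\<A>. K \<noteq> K' \<longrightarrow> gaps K \<inter> gaps K' = {}"
      proof (intro ballI impI, rule ccontr)
        fix K K' assume K: "K \<in> \<A>" "K' \<in> \<A>" "K \<noteq> K'" and "gaps K \<inter> gaps K' \<noteq> {}"
        then obtain J where "J \<in> gaps K" "J \<in> gaps K'" by auto
        with uniq[of J K K'] gapsub[of J] K show False by simp
      qed
      show "\<forall>K\<in>\<A>. finite (gaps K)" using finq by (auto simp: gaps_def)
    qed (use finA in auto)
    finally show ?thesis .
  qed
  have Gdiv: "G division_of \<Union>G"
  proof (rule division_ofI)
    show "finite G" unfolding G_def using finA finq by (auto simp: gaps_def)
    fix J assume "J \<in> G"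
    then obtain K where K: "K \<in> \<A>" "J \<in> gaps K" by (auto simp: G_def)
    show "J \<noteq> {}" "\<exists>a b. J = cbox a b"
      using gapsub[OF K(2,1)] q(2)[OF K(1)] by (auto simp: division_of_def)
    fix J' assume "J' \<in> G" "J \<noteq> J'"
    then obtain K' where K': "K' \<in> \<A>" "J' \<in> gaps K'" by (auto simp: G_def)
    show "interior J \<inter> interior J' = {}"
    proof (cases "K = K'")
      case True
      then show ?thesis
        using division_ofD(5)[OF q(2)[OF K(1)] gapsub(3)[OF K(2,1)]] gapsub(3)[OF K'(2,1)] \<open>J \<noteq> J'\<close> by simp
    next
      case False
      then show ?thesis using gapsub(1)[OF K(2,1)] gapsub(1)[OF K'(2,1)] Kdisj[OF K(1) K'(1)]
          interior_mono[of J K] interior_mono[of J' K'] interior_Int[of K K'] by auto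
    qed
  qed auto
  have GS: "\<Union>G \<subseteq> {a..b}"
    using gapsub(1) A(6) Q(3) unfolding G_def by blast
  have AQ: "measure lebesgue (\<Union>\<A>) \<le> s + \<eta>"
  proof -
    have "measure lebesgue (\<Union>\<A>) \<le> measure lebesgue Q"
      using A(6) Alm Qm by (intro measure_mono_fmeasurable) auto
    with QE show ?thesis by simp
  qed
  let ?A = "\<Sum>K\<in>\<A>. increment (\<lambda>x. x) K" and ?B = "\<Sum>J\<in>\<B>. increment (\<lambda>x. x) J"
  have AB: "?A \<le> s + \<eta>" "s - 3 * \<eta> < ?B" using AQ A(5) B(4) mE' by auto
  have "(\<Sum>J\<in>G. \<bar>increment f J\<bar>) < \<epsilon>"
    using split[of "\<lambda>x. x"] AB \<eta> \<delta>(1) by (intro ac_bound_division[OF \<delta>(2) Gdiv GS]) linarith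
  then have 1: "- \<epsilon> < (\<Sum>J\<in>G. increment f J)"
    using sum_abs[of "increment f" G] by linarith
  have 2: "(\<Sum>K\<in>\<A>. increment f K) \<le> r * ?A"
    unfolding sum_distrib_left
  proof (rule sum_mono)
    show "increment f K \<le> r * increment (\<lambda>x. x) K" if "K \<in> \<A>" for K
      using A(3)[OF that] by (auto simp: increment_Icc)
  qed
  have 3: "R * ?B \<le> (\<Sum>J\<in>\<B>. increment f J)"
    unfolding sum_distrib_left
  proof (rule sum_mono)
    show "R * increment (\<lambda>x. x) K \<le> increment f K" if "K \<in> \<B>" for K
      using B(3)[OF that] by (auto simp: increment_Icc)
  qed
  have nn: "0 \<le> (\<Sum>J\<in>G. increment (\<lambda>x. x) J)"
    using content_eq_increment[OF Gdiv] by (intro sum_nonneg) (metis measure_nonneg)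
  have "(R - r) * ?B \<le> \<epsilon> + r * (?A - ?B)"
    using 1 2 3 split[of f] by (simp add: algebra_simps)
  also have "r * (?A - ?B) \<le> \<bar>r\<bar> * (4 * \<eta>)"
  proof -
    have "r * (?A - ?B) \<le> \<bar>r\<bar> * (?A - ?B)"
      using nn split[of "\<lambda>x. x"] by (intro mult_right_mono) auto
    also have "\<dots> \<le> \<bar>r\<bar> * (4 * \<eta>)" using AB by (intro mult_left_mono) auto
    finally show ?thesis .
  qed
  also have "\<epsilon> + \<bar>r\<bar> * (4 * \<eta>) \<le> 2 * \<epsilon>" using \<eta> by simp
  also have "2 * \<epsilon> = (R - r) * (s / 4)" by (simp add: \<epsilon>_def)
  finally have "?B \<le> s / 4" using \<open>r < R\<close> by simp
  with AB \<eta> \<open>s > 0\<close> show False by linarith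
qed

lemma absolutely_continuous_on_imp_continuous_on:
  assumes "absolutely_continuous_on {a..b} f"
  shows "continuous_on {a..b} f"
  unfolding continuous_on_iff
proof (intro ballI allI impI)
  fix x \<epsilon> :: real assume x: "x \<in> {a..b}" and "0 < \<epsilon>"
  then obtain \<delta> where \<delta>: "\<delta> > 0" "ac_bound {a..b} f \<epsilon> \<delta>"
    using assms unfolding absolutely_continuous_on_iff_ac_bound by blast
  have "dist (f y) (f x) < \<epsilon>" if "y \<in> {a..b}" "dist y x < \<delta>" for y
  proof -
    have "(\<Sum>i\<in>{()}. \<bar>f (max x y) - f (min x y)\<bar>) < \<epsilon>"
      using that x by (intro ac_boundD[OF \<delta>(2)]) (auto simp: disjoint_family_on_def dist_real_def)
    then show ?thesis by (auto simp: dist_real_def max_def min_def abs_minus_commute split: if_splits)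
  qed
  then show "\<exists>d>0. \<forall>x'\<in>{a..b}. dist x' x < d \<longrightarrow> dist (f x') (f x) < \<epsilon>"
    using \<delta>(1) by blast
qed

text \<open>
  Points with unbounded difference quotients. Within an interval shorter than \<open>\<delta>\<close> every finite family
  of disjoint intervals has increments summing to less than 1, so intervals of slope at least \<open>k\<close> can only
  cover a set of measure \<open>1 / k\<close>.
\<close>

lemma negligible_steep:
  assumes ac: "ac_bound {a..b} f 1 \<delta>" and E: "E \<in> lmeasurable" and "\<delta> > 0"
    and Ep: "E \<subseteq> {p..p + \<delta> / 2}"
    and steep: "\<And>k x d. x \<in> E \<Longrightarrow> 0 < d \<Longrightarrow>
      \<exists>c e. c < e \<and> c \<le> x \<and> x \<le> e \<and> e - c < d \<and> {c..e} \<subseteq> {a..b} \<and> real k * (e - c) \<le> \<bar>f e - f c\<bar>"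
  shows "negligible E"
proof (rule ccontr)
  assume "\<not> negligible E"
  define s where "s = measure lebesgue E"
  have "s > 0"
    using \<open>\<not> negligible E\<close> E by (simp add: s_def zero_less_measure_iff negligible_iff_measure0)
  obtain k :: nat where k: "2 / s < k" using reals_Archimedean2 by blast
  \<comment> \<open>A margin around \<open>E\<close> for the covering intervals; the total length \<open>3 * \<delta> / 4\<close> stays below \<open>\<delta>\<close>.\<close>
  define Q where "Q = {a..b} \<inter> {p - \<delta> / 8..p + 5 * \<delta> / 8}"
  have Q: "Q \<in> lmeasurable" unfolding Q_def by (intro fmeasurable.Int) (auto simp: lmeasurable_interval)
  obtain \<D> where D: "\<D> division_of \<Union>\<D>" "pairwise disjnt \<D>"
    "\<And>K. K \<in> \<D> \<Longrightarrow> \<exists>c e. c < e \<and> K = {c..e} \<and> ({c..e} \<subseteq> Q \<and> real k * (e - c) \<le> \<bar>f e - f c\<bar>)"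
    "measure lebesgue E - s / 2 < (\<Sum>K\<in>\<D>. increment (\<lambda>x. x) K)"
    "(\<Sum>K\<in>\<D>. increment (\<lambda>x. x) K) = measure lebesgue (\<Union>\<D>)"
    "\<Union>\<D> \<subseteq> Q"
  proof (rule Vitali_finite_intervals[of E Q "s / 2" "\<lambda>c e. {c..e} \<subseteq> Q \<and> real k * (e - c) \<le> \<bar>f e - f c\<bar>"])
    fix x d :: real assume x: "x \<in> E" "0 < d"
    then obtain c e where "c < e" "c \<le> x" "x \<le> e" "e - c < min d (\<delta> / 8)" "{c..e} \<subseteq> {a..b}" "real k * (e - c) \<le> \<bar>f e - f c\<bar>"
      using steep[of x "min d (\<delta> / 8)" k] \<open>\<delta> > 0\<close> by auto
    moreover have "p \<le> x" "x \<le> p + \<delta> / 2" using x Ep by auto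
    ultimately show "\<exists>c e. c < e \<and> c \<le> x \<and> x \<le> e \<and> e - c < d \<and> {c..e} \<subseteq> Q \<and> real k * (e - c) \<le> \<bar>f e - f c\<bar>"
      unfolding Q_def by (intro exI[of _ c] exI[of _ e]) auto
  qed (use E Q \<open>s > 0\<close> in auto)
  have "measure lebesgue (\<Union>\<D>) \<le> measure lebesgue {p - \<delta> / 8..p + 5 * \<delta> / 8}"
    using D(1,6) by (intro measure_mono_fmeasurable) (auto simp: Q_def lmeasurable_interval intro!: sets.finite_Union simp: division_of_def)
  also have "\<dots> = 3 * \<delta> / 4" using \<open>\<delta> > 0\<close> by simp
  finally have "(\<Sum>K\<in>\<D>. \<bar>increment f K\<bar>) < 1"
    using D(5,6) \<open>\<delta> > 0\<close> by (intro ac_bound_division[OF ac D(1)]) (auto simp: Q_def)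
  moreover have "real k * (\<Sum>K\<in>\<D>. increment (\<lambda>x. x) K) \<le> (\<Sum>K\<in>\<D>. \<bar>increment f K\<bar>)"
    unfolding sum_distrib_left
  proof (rule sum_mono)
    show "real k * increment (\<lambda>x. x) K \<le> \<bar>increment f K\<bar>" if "K \<in> \<D>" for K
      using D(3)[OF that] by (auto simp: increment_Icc)
  qed
  moreover have "real k * (s / 2) \<le> real k * (\<Sum>K\<in>\<D>. increment (\<lambda>x. x) K)"
    using D(4) by (intro mult_left_mono) (auto simp: s_def)
  ultimately have "real k * (s / 2) < 1" by linarith
  then show False using k \<open>s > 0\<close> by (simp add: field_simps)
qed

text \<open>
  Openness makes the exceptional sets below countable intersections of open sets, hence Borel.
\<close>

lemma open_near_slope:
  fixes f :: "real \<Rightarrow> real"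
  assumes "continuous_on {a<..<b} f" "open P"
  shows "open {x \<in> {a<..<b}. \<exists>y\<in>{a<..<b}. y \<noteq> x \<and> \<bar>y - x\<bar> < \<delta> \<and> (f y - f x) / (y - x) \<in> P}"
proof -
  have "open ({x \<in> {a<..<b}. y \<noteq> x \<and> \<bar>y - x\<bar> < \<delta> \<and> (f y - f x) / (y - x) \<in> P})" if "y \<in> {a<..<b}" for y
  proof -
    have "open (({a<..<b} - {y}) \<inter> (\<lambda>x. (f y - f x) / (y - x)) -` P)"
    proof (rule continuous_open_preimage[OF _ _ \<open>open P\<close>])
      show "continuous_on ({a<..<b} - {y}) (\<lambda>x. (f y - f x) / (y - x))"
        by (intro continuous_intros continuous_on_subset[OF assms(1), of "{a<..<b} - {y}"]) auto
    qed (auto intro!: open_Diff)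
    then have "open ((({a<..<b} - {y}) \<inter> (\<lambda>x. (f y - f x) / (y - x)) -` P) \<inter> ball y \<delta>)" by auto
    also have "\<dots> = {x \<in> {a<..<b}. y \<noteq> x \<and> \<bar>y - x\<bar> < \<delta> \<and> (f y - f x) / (y - x) \<in> P}"
      by (auto simp: dist_real_def)
    finally show ?thesis .
  qed
  then have "open (\<Union>y\<in>{a<..<b}. {x \<in> {a<..<b}. y \<noteq> x \<and> \<bar>y - x\<bar> < \<delta> \<and> (f y - f x) / (y - x) \<in> P})" by blast
  also have "\<dots> = {x \<in> {a<..<b}. \<exists>y\<in>{a<..<b}. y \<noteq> x \<and> \<bar>y - x\<bar> < \<delta> \<and> (f y - f x) / (y - x) \<in> P}" by auto
  finally show ?thesis .
qed

text \<open>
  Outside the null sets of the two preceding arguments the lower and the upper limit of the difference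
  quotient agree and are finite.
\<close>

theorem absolutely_continuous_on_imp_ae_differentiable:
  assumes ac: "absolutely_continuous_on {a..b} f"
  obtains N where "negligible N" "\<And>x. x \<in> {a<..<b} - N \<Longrightarrow> f differentiable (at x)"
proof -
  define S where "S \<delta> P = {x \<in> {a<..<b}. \<exists>y\<in>{a<..<b}. y \<noteq> x \<and> \<bar>y - x\<bar> < \<delta> \<and> (f y - f x) / (y - x) \<in> P}"
    for \<delta> :: real and P
  define A where "A P = (\<Inter>n. S (1 / Suc n) P)" for P
  have cont: "continuous_on {a<..<b} f"
    using absolutely_continuous_on_imp_continuous_on[OF ac] by (rule continuous_on_subset) auto
  have Ab: "A P \<in> sets borel" if "open P" for P
    unfolding A_def S_def using open_near_slope[OF cont that] by (intro sets.countable_INT) (auto intro!: borel_open)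
  have Asub: "A P \<subseteq> {a<..<b}" for P by (auto simp: A_def S_def)
  have lm: "E \<in> lmeasurable" if "E \<in> sets borel" "E \<subseteq> {a<..<b}" for E
  proof (rule bounded_set_imp_lmeasurable)
    show "bounded E"
      using that(2) by (intro bounded_subset[OF compact_imp_bounded[OF compact_Icc, of a b]]) auto
  qed (use that(1) in auto)
  have AD: "\<exists>y\<in>{a<..<b}. y \<noteq> x \<and> \<bar>y - x\<bar> < d \<and> (f y - f x) / (y - x) \<in> P" if "x \<in> A P" "d > 0" for x d P
  proof -
    obtain n where "1 / Suc n < d" using nat_approx_posE[OF \<open>d > 0\<close>] by blast
    moreover have "x \<in> S (1 / Suc n) P" using that by (auto simp: A_def)
    ultimately show ?thesis unfolding S_def by fastforce
  qed
  have AI: "x \<in> A P" if "x \<in> {a<..<b}" "\<And>d. d > 0 \<Longrightarrow> \<exists>y\<in>{a<..<b}. y \<noteq> x \<and> \<bar>y - x\<bar> < d \<and> (f y - f x) / (y - x) \<in> P" for x P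
    using that by (auto simp: A_def S_def)
  have osc: "negligible (A {..<r} \<inter> A {R<..})" if "r < R" for r R
  proof (rule negligible_oscillating_slopes[OF ac _ _ that])
    show "A {..<r} \<inter> A {R<..} \<in> lmeasurable" "A {..<r} \<inter> A {R<..} \<subseteq> {a<..<b}"
      using Asub Ab by (auto intro!: lm)
    fix x d :: real assume x: "x \<in> A {..<r} \<inter> A {R<..}" "0 < d"
    obtain y where y: "y \<noteq> x" "\<bar>y - x\<bar> < d" "(f y - f x) / (y - x) < r" using AD[of x "{..<r}" d] x by auto
    then show "\<exists>c e. c < e \<and> c \<le> x \<and> x \<le> e \<and> e - c < d \<and> f e - f c \<le> r * (e - c)"
      by (intro exI[of _ "min x y"] exI[of _ "max x y"])
         (cases "x < y", auto simp: min_def max_def divide_less_eq algebra_simps split: if_splits)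
    obtain y where y: "y \<noteq> x" "\<bar>y - x\<bar> < d" "R < (f y - f x) / (y - x)" using AD[of x "{R<..}" d] x by auto
    then show "\<exists>c e. c < e \<and> c \<le> x \<and> x \<le> e \<and> e - c < d \<and> R * (e - c) \<le> f e - f c"
      by (intro exI[of _ "min x y"] exI[of _ "max x y"])
         (cases "x < y", auto simp: min_def max_def less_divide_eq algebra_simps split: if_splits)
  qed
  \<comment> \<open>Where the difference quotient is unbounded.\<close>
  define B where "B = (\<Inter>k::nat. A (- cball 0 (real k)))"
  have "negligible B"
  proof -
    obtain \<delta> where \<delta>: "\<delta> > 0" "ac_bound {a..b} f 1 \<delta>"
      using ac unfolding absolutely_continuous_on_iff_ac_bound by (meson zero_less_one)
    have Bb: "B \<in> sets borel" unfolding B_def by (intro sets.countable_INT) (auto intro!: Ab)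
    have "negligible (B \<inter> {p..p + \<delta> / 2})" for p
    proof (rule negligible_steep[OF \<delta>(2) _ \<delta>(1)])
      show "B \<inter> {p..p + \<delta> / 2} \<in> lmeasurable"
        using Asub Bb by (intro lm) (auto simp: B_def)
      fix k :: nat and x d :: real assume x: "x \<in> B \<inter> {p..p + \<delta> / 2}" "0 < d"
      then have "x \<in> A (- cball 0 (real k))" by (auto simp: B_def)
      then obtain y where y: "y \<in> {a<..<b}" "y \<noteq> x" "\<bar>y - x\<bar> < d" "real k < \<bar>(f y - f x) / (y - x)\<bar>"
        using AD[of x "- cball 0 (real k)" d] x by auto
      moreover have "x \<in> {a<..<b}" using \<open>x \<in> A _\<close> Asub by blast
      moreover have "real k * \<bar>y - x\<bar> \<le> \<bar>f y - f x\<bar>" using y by (auto simp: abs_divide less_divide_eq)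
      ultimately show "\<exists>c e. c < e \<and> c \<le> x \<and> x \<le> e \<and> e - c < d \<and> {c..e} \<subseteq> {a..b} \<and> real k * (e - c) \<le> \<bar>f e - f c\<bar>"
        by (intro exI[of _ "min x y"] exI[of _ "max x y"]) (auto simp: min_def max_def abs_if split: if_splits)
    qed auto
    then have "negligible (\<Union>i::int. B \<inter> {of_int i * (\<delta> / 2)..of_int i * (\<delta> / 2) + \<delta> / 2})"
      by (intro negligible_countable_Union) auto
    moreover have "B \<subseteq> (\<Union>i::int. B \<inter> {of_int i * (\<delta> / 2)..of_int i * (\<delta> / 2) + \<delta> / 2})"
    proof
      fix x assume "x \<in> B"
      have "of_int \<lfloor>x / (\<delta> / 2)\<rfloor> * (\<delta> / 2) \<le> x" "x \<le> of_int \<lfloor>x / (\<delta> / 2)\<rfloor> * (\<delta> / 2) + \<delta> / 2"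
        using floor_divide_lower[of "\<delta> / 2" x] floor_divide_upper[of "\<delta> / 2" x] \<delta>(1) by (auto simp: algebra_simps)
      then show "x \<in> (\<Union>i::int. B \<inter> {of_int i * (\<delta> / 2)..of_int i * (\<delta> / 2) + \<delta> / 2})" using \<open>x \<in> B\<close> by auto
    qed
    ultimately show ?thesis by (rule negligible_subset)
  qed
  define N where "N = B \<union> (\<Union>(r,R)\<in>{(r,R). r \<in> \<rat> \<and> R \<in> \<rat> \<and> r < R}. A {..<r} \<inter> A {R<..})"
  have "countable {(r,R). r \<in> \<rat> \<and> R \<in> \<rat> \<and> r < (R::real)}"
    by (rule countable_subset[of _ "\<rat> \<times> \<rat>"]) (auto simp: countable_rat)
  then have "negligible N"
    unfolding N_def using osc \<open>negligible B\<close> by (intro negligible_Un negligible_countable_Union countable_image) auto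
  moreover have "f differentiable (at x)" if x: "x \<in> {a<..<b} - N" for x
  proof -
    define \<sigma> where "\<sigma> y = (f y - f x) / (y - x)" for y
    have near: "eventually (\<lambda>y. \<sigma> y \<notin> P) (at x)" if "x \<notin> A P" for P
    proof -
      obtain d where d: "d > 0" "\<And>y. y \<in> {a<..<b} \<Longrightarrow> y \<noteq> x \<Longrightarrow> \<bar>y - x\<bar> < d \<Longrightarrow> \<sigma> y \<notin> P"
        using AI[of x P] \<open>x \<notin> A P\<close> x unfolding \<sigma>_def by blast
      have "eventually (\<lambda>y. y \<in> {a<..<b}) (at x)"
        using x by (intro eventually_at_in_open') auto
      moreover have "eventually (\<lambda>y. y \<noteq> x \<and> \<bar>y - x\<bar> < d) (at x)"
        using \<open>d > 0\<close> by (auto simp: eventually_at dist_real_def intro!: exI[of _ d])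
      ultimately show ?thesis by eventually_elim (use d in auto)
    qed
    define l where "l = Liminf (at x) (\<lambda>y. ereal (\<sigma> y))"
    define u where "u = Limsup (at x) (\<lambda>y. ereal (\<sigma> y))"
    have "l \<le> u" unfolding l_def u_def by (intro Liminf_le_Limsup) auto
    have "u \<le> l"
    proof (rule ccontr)
      assume "\<not> u \<le> l"
      then obtain r where r: "l < ereal (real_of_rat r)" "ereal (real_of_rat r) < u" using ereal_dense3[of l u] by (metis not_le)
      then obtain R where R: "ereal (real_of_rat r) < ereal (real_of_rat R)" "ereal (real_of_rat R) < u"
        using ereal_dense3[of "ereal (real_of_rat r)" u] by blast
      have "x \<notin> A {..<real_of_rat r} \<or> x \<notin> A {real_of_rat R<..}"
        using x R(1) by (auto simp: N_def)
      then show False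
      proof
        assume "x \<notin> A {..<real_of_rat r}"
        from near[OF this] have "eventually (\<lambda>y. ereal (real_of_rat r) \<le> ereal (\<sigma> y)) (at x)" by eventually_elim auto
        then have "ereal (real_of_rat r) \<le> l" unfolding l_def by (rule Liminf_bounded)
        with r show False by simp
      next
        assume "x \<notin> A {real_of_rat R<..}"
        from near[OF this] have "eventually (\<lambda>y. ereal (\<sigma> y) \<le> ereal (real_of_rat R)) (at x)" by eventually_elim auto
        then have "u \<le> ereal (real_of_rat R)" unfolding u_def by (rule Limsup_bounded)
        with R show False by simp
      qed
    qed
    with \<open>l \<le> u\<close> have "l = u" by simp
    obtain k where "x \<notin> A (- cball 0 (real k))" using x by (auto simp: N_def B_def)
    from near[OF this] have ev: "eventually (\<lambda>y. \<bar>\<sigma> y\<bar> \<le> real k) (at x)" by eventually_elim auto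
    have "ereal (- real k) \<le> l" unfolding l_def by (rule Liminf_bounded) (use ev in eventually_elim, auto)
    moreover have "u \<le> ereal (real k)" unfolding u_def by (rule Limsup_bounded) (use ev in eventually_elim, auto)
    ultimately obtain L where L: "l = ereal L" using \<open>l = u\<close> by (cases l) auto
    have "((\<lambda>y. ereal (\<sigma> y)) \<longlongrightarrow> ereal L) (at x)"
      using \<open>l = u\<close> L unfolding l_def u_def by (intro Liminf_eq_Limsup) auto
    then have "(\<sigma> \<longlongrightarrow> L) (at x)" by simp
    then have "(f has_real_derivative L) (at x)"
      unfolding has_field_derivative_iff \<sigma>_def .
    then show ?thesis using real_differentiable_def by blast
  qed
  ultimately show thesis by (rule that)
qed

section \<open>The fundamental theorem of calculus for absolutely continuous functions\<close>

text \<open>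
  The fundamental theorem of calculus comes directly from the gauge definition of the integral.
  At a point of differentiability the gauge makes the increment close to \<open>f' x\<close> times the length. The
  null set \<open>N\<close> is covered by an open set of measure below \<open>\<delta>\<close>, which serves as the gauge on \<open>N\<close>; the
  increments over intervals tagged in \<open>N\<close> are then small by absolute continuity.
\<close>

theorem absolutely_continuous_on_has_integral:
  assumes ac: "absolutely_continuous_on {a..b} f" and "a \<le> b" and N: "negligible N"
    and deriv: "\<And>x. x \<in> {a..b} - N \<Longrightarrow> (f has_real_derivative f' x) (at x within {a..b})"
  shows "(f' has_integral (f b - f a)) {a..b}"
proof (rule has_integral_spike[OF N])
  define h where "h x = (if x \<in> N then 0 else f' x)" for x
  show "f' x = h x" if "x \<in> {a..b} - N" for x using that by (simp add: h_def)
  show "(h has_integral (f b - f a)) {a..b}"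
    unfolding has_integral_real
  proof (intro allI impI)
    fix e :: real assume "e > 0"
    then obtain \<delta> where \<delta>: "\<delta> > 0" "ac_bound {a..b} f (e / 2) \<delta>"
      using ac unfolding absolutely_continuous_on_iff_ac_bound by (meson half_gt_zero)
    obtain T where T: "open T" "N \<subseteq> T" "T - N \<in> lmeasurable" "emeasure lebesgue (T - N) < ennreal \<delta>"
      using sets_lebesgue_outer_open[of N \<delta>] negligible_imp_sets[OF N] \<delta>(1) by auto
    have Tm: "T \<in> lmeasurable" "measure lebesgue T < \<delta>"
    proof -
      have "T = N \<union> (T - N)" using T by auto
      moreover have "N \<union> (T - N) \<in> lmeasurable"
        using T(3) negligible_imp_measurable[OF N] by (rule fmeasurable.Un[rotated])
      ultimately show "T \<in> lmeasurable" by simp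
      have "measure lebesgue T \<le> measure lebesgue N + measure lebesgue (T - N)"
        using \<open>T = N \<union> (T - N)\<close> T(3) N by (metis fmeasurableD measure_Un_le negligible_imp_sets)
      also have "\<dots> < \<delta>"
        using T(3,4) \<open>\<delta> > 0\<close> negligible_imp_measure0[OF N]
        by (simp add: emeasure_eq_measure2 fmeasurableD2 ennreal_less_iff)
      finally show "measure lebesgue T < \<delta>" .
    qed
    define e1 where "e1 = e / (2 * (b - a + 1))"
    have "e1 > 0" using \<open>e > 0\<close> \<open>a \<le> b\<close> by (simp add: e1_def)
    have "\<exists>d>0. \<forall>y\<in>{a..b}. \<bar>y - x\<bar> < d \<longrightarrow> \<bar>f y - f x - f' x * (y - x)\<bar> \<le> e1 * \<bar>y - x\<bar>"
      if x: "x \<in> {a..b} - N" for x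
    proof -
      have "(f has_derivative (*) (f' x)) (at x within {a..b})"
        using deriv[OF x] by (simp add: has_field_derivative_def)
      then show ?thesis
        using \<open>e1 > 0\<close> unfolding has_derivative_within_alt by (auto simp: real_norm_def)
    qed
    then obtain d where d: "\<And>x. x \<in> {a..b} - N \<Longrightarrow> d x > 0"
      "\<And>x y. x \<in> {a..b} - N \<Longrightarrow> y \<in> {a..b} \<Longrightarrow> \<bar>y - x\<bar> < d x \<Longrightarrow> \<bar>f y - f x - f' x * (y - x)\<bar> \<le> e1 * \<bar>y - x\<bar>"
      by metis
    define \<gamma> where "\<gamma> x = (if x \<in> N then T else if x \<in> {a..b} then ball x (d x) else ball x 1)" for x
    have G: "gauge \<gamma>"
      unfolding gauge_def \<gamma>_def using T d(1) by auto
    have H: "norm ((\<Sum>(x, k)\<in>\<D>. measure lborel k *\<^sub>R h x) - (f b - f a)) < e"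
      if \<D>: "\<D> tagged_division_of {a..b}" "\<gamma> fine \<D>" for \<D>
    proof -
      have fin: "finite \<D>" using \<D>(1) by auto
      let ?err = "\<lambda>p. measure lborel (snd p) * h (fst p) - (f (Sup (snd p)) - f (Inf (snd p)))"
      have form: "\<exists>c e. c \<le> e \<and> K = {c..e} \<and> x \<in> {c..e} \<and> {c..e} \<subseteq> {a..b} \<and> {c..e} \<subseteq> \<gamma> x" if xK: "(x, K) \<in> \<D>" for x K
      proof -
        obtain c e where "K = cbox c e" using tagged_division_ofD(4)[OF \<D>(1) xK] by blast
        then show ?thesis
          using tagged_division_ofD(2,3)[OF \<D>(1) xK] fineD[OF \<D>(2) xK] by (intro exI[of _ c] exI[of _ e]) auto
      qed
      define \<D>N where "\<D>N = {p \<in> \<D>. fst p \<in> N}"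
      have finN: "finite \<D>N" using fin by (simp add: \<D>N_def)
      have len: "Sup (snd p) - Inf (snd p) = measure lborel (snd p)" if "p \<in> \<D>" for p
        using form[of "fst p" "snd p"] that by auto
      let ?I = "\<lambda>p. {Inf (snd p)<..<Sup (snd p)}"
      have int: "?I p = interior (snd p)" if "p \<in> \<D>" for p
        using form[of "fst p" "snd p"] that by auto
      have disj: "disjoint_family_on ?I \<D>N"
        unfolding disjoint_family_on_def
      proof (intro ballI impI)
        fix p p' assume "p \<in> \<D>N" "p' \<in> \<D>N" "p \<noteq> p'"
        then show "?I p \<inter> ?I p' = {}"
          using tagged_division_ofD(5)[OF \<D>(1), of "fst p" "snd p" "fst p'" "snd p'"] int[of p] int[of p']
          by (simp add: \<D>N_def prod_eq_iff)
      qed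
      have "(\<Sum>p\<in>\<D>N. Sup (snd p) - Inf (snd p)) = (\<Sum>p\<in>\<D>N. measure lebesgue (?I p))"
      proof (rule sum.cong)
        fix p assume "p \<in> \<D>N"
        then show "Sup (snd p) - Inf (snd p) = measure lebesgue (?I p)"
          using form[of "fst p" "snd p"] by (auto simp: \<D>N_def)
      qed simp
      also have "\<dots> = measure lebesgue (\<Union>p\<in>\<D>N. ?I p)"
      proof (rule measure_finite_Union[symmetric, OF finN _ disj])
        show "emeasure lebesgue (?I p) \<noteq> \<infinity>" for p :: "real \<times> real set"
          using fmeasurableD2[OF lmeasurable_box[of "Inf (snd p)" "Sup (snd p)"]] by simp
      qed auto
      also have "\<dots> \<le> measure lebesgue T"
      proof (intro measure_mono_fmeasurable Tm)
        show "(\<Union>p\<in>\<D>N. ?I p) \<subseteq> T"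
        proof (rule UN_least)
          fix p assume "p \<in> \<D>N"
          then show "?I p \<subseteq> T"
            using form[of "fst p" "snd p"] by (auto simp: \<D>N_def \<gamma>_def)
        qed
      qed (use finN in auto)
      finally have "(\<Sum>p\<in>\<D>N. Sup (snd p) - Inf (snd p)) < \<delta>" using Tm(2) by simp
      then have "(\<Sum>p\<in>\<D>N. \<bar>f (Sup (snd p)) - f (Inf (snd p))\<bar>) < e / 2"
      proof (rule ac_boundD[OF \<delta>(2) finN _ disj, rotated])
        fix p assume "p \<in> \<D>N"
        then show "Inf (snd p) \<le> Sup (snd p) \<and> {Inf (snd p)..Sup (snd p)} \<subseteq> {a..b}"
          using form[of "fst p" "snd p"] by (auto simp: \<D>N_def)
      qed
      moreover have "(\<Sum>p\<in>\<D> - \<D>N. \<bar>?err p\<bar>)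
          \<le> (\<Sum>p\<in>\<D> - \<D>N. e1 * measure lborel (snd p))"
      proof (rule sum_mono)
        fix p assume p: "p \<in> \<D> - \<D>N"
        define x where "x = fst p"
        obtain c e where ce: "c \<le> e" "snd p = {c..e}" "x \<in> {c..e}" "{c..e} \<subseteq> {a..b}" "{c..e} \<subseteq> \<gamma> x"
          using form[of "fst p" "snd p"] p by (auto simp: x_def)
        have x: "x \<in> {a..b} - N" using p ce by (auto simp: \<D>N_def x_def)
        then have b: "{c..e} \<subseteq> ball x (d x)" using ce(5) by (simp add: \<gamma>_def)
        have ce': "c \<in> {a..b}" "e \<in> {a..b}" "\<bar>c - x\<bar> < d x" "\<bar>e - x\<bar> < d x"
          using ce(1,4) b by (auto simp: dist_real_def subset_iff abs_minus_commute)
        have 1: "\<bar>f c - f x - f' x * (c - x)\<bar> \<le> e1 * (x - c)"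
          using d(2)[OF x ce'(1,3)] ce(3) by auto
        have 2: "\<bar>f e - f x - f' x * (e - x)\<bar> \<le> e1 * (e - x)"
          using d(2)[OF x ce'(2,4)] ce(3) by auto
        have "measure lborel {c..e} * h x - (f e - f c) = (f c - f x - f' x * (c - x)) - (f e - f x - f' x * (e - x))"
          using ce(1) x by (simp add: h_def algebra_simps)
        then have "\<bar>measure lborel {c..e} * h x - (f e - f c)\<bar> \<le> e1 * (x - c) + e1 * (e - x)"
          using 1 2 by linarith
        then show "\<bar>?err p\<bar> \<le> e1 * measure lborel (snd p)"
          using ce(1,2) by (simp add: x_def algebra_simps)
      qed
      moreover have "(\<Sum>p\<in>\<D> - \<D>N. e1 * measure lborel (snd p)) \<le> e1 * (b - a)"
      proof -
        have "(\<Sum>p\<in>\<D> - \<D>N. e1 * measure lborel (snd p)) \<le> (\<Sum>p\<in>\<D>. e1 * measure lborel (snd p))"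
          using fin \<open>e1 > 0\<close> by (intro sum_mono2) auto
        also have "\<dots> = e1 * (\<Sum>p\<in>\<D>. Sup (snd p) - Inf (snd p))"
          using len by (simp add: sum_distrib_left)
        also have "(\<Sum>p\<in>\<D>. Sup (snd p) - Inf (snd p)) = b - a"
          using additive_tagged_division_1[OF \<open>a \<le> b\<close> \<D>(1), of "\<lambda>x. x"] by (simp add: case_prod_beta)
        finally show ?thesis .
      qed
      moreover have "e1 * (b - a) < e / 2"
        using \<open>e > 0\<close> \<open>a \<le> b\<close> by (simp add: e1_def field_simps)
      moreover have "(\<Sum>(x, k)\<in>\<D>. measure lborel k *\<^sub>R h x) - (f b - f a)
          = (\<Sum>p\<in>\<D>. ?err p)"
        using additive_tagged_division_1[OF \<open>a \<le> b\<close> \<D>(1), of f] by (simp add: case_prod_beta sum_subtractf)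
      moreover have "\<bar>\<Sum>p\<in>\<D>. ?err p\<bar>
          \<le> (\<Sum>p\<in>\<D>. \<bar>?err p\<bar>)"
        by (rule sum_abs)
      moreover have "(\<Sum>p\<in>\<D>. \<bar>?err p\<bar>)
          = (\<Sum>p\<in>\<D> - \<D>N. \<bar>?err p\<bar>)
          + (\<Sum>p\<in>\<D>N. \<bar>?err p\<bar>)"
        by (rule sum.subset_diff) (auto simp: \<D>N_def fin)
      moreover have "(\<Sum>p\<in>\<D>N. \<bar>?err p\<bar>)
          = (\<Sum>p\<in>\<D>N. \<bar>f (Sup (snd p)) - f (Inf (snd p))\<bar>)"
        by (rule sum.cong) (auto simp: \<D>N_def h_def)
      ultimately show ?thesis unfolding real_norm_def by linarith
    qed
    show "\<exists>\<gamma>. gauge \<gamma> \<and> (\<forall>\<D>. \<D> tagged_division_of {a..b} \<and> \<gamma> fine \<D> \<longrightarrow>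
        norm ((\<Sum>(x, k)\<in>\<D>. measure lborel k *\<^sub>R h x) - (f b - f a)) < e)"
      by (rule exI[of _ \<gamma>], rule conjI[OF G], intro allI impI, elim conjE, rule H)
  qed
qed

lemma absolutely_continuous_on_subinterval:
  assumes "absolutely_continuous_on {a..b} f" "{c..d} \<subseteq> {a..b}"
  shows "absolutely_continuous_on {c..d} f"
proof -
  have "ac_bound {c..d} f \<epsilon> \<delta>" if "ac_bound {a..b} f \<epsilon> \<delta>" for \<epsilon> \<delta>
    using that assms(2) unfolding ac_bound_def by (meson order_trans)
  then show ?thesis using assms(1) unfolding absolutely_continuous_on_iff_ac_bound by meson
qed

text \<open>
  On an interval shorter than the \<open>\<delta>\<close> belonging to \<open>\<epsilon> = 1\<close> the variation of \<open>f\<close>, and so of the integral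
  of \<open>f'\<close>, is at most 1; finitely many such intervals make up \<open>{a..b}\<close>.
\<close>

theorem absolutely_continuous_on_absolutely_integrable:
  assumes ac: "absolutely_continuous_on {a..b} f" and "a \<le> b" and N: "negligible N"
    and deriv: "\<And>x. x \<in> {a..b} - N \<Longrightarrow> (f has_real_derivative f' x) (at x within {a..b})"
  shows "f' absolutely_integrable_on {a..b}"
proof -
  obtain \<delta> where \<delta>: "\<delta> > 0" "ac_bound {a..b} f 1 \<delta>"
    using ac unfolding absolutely_continuous_on_iff_ac_bound by (meson zero_less_one)
  have sub: "(f' has_integral (f d - f c)) {c..d}" if "c \<le> d" "{c..d} \<subseteq> {a..b}" for c d
  proof (rule absolutely_continuous_on_has_integral[OF absolutely_continuous_on_subinterval[OF ac that(2)] that(1) N])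
    show "(f has_real_derivative f' x) (at x within {c..d})" if "x \<in> {c..d} - N" for x
      using deriv[of x] that \<open>{c..d} \<subseteq> {a..b}\<close> by (blast intro: has_field_derivative_subset)
  qed
  have short: "f' absolutely_integrable_on {c..d}" if cd: "c \<le> d" "{c..d} \<subseteq> {a..b}" "d - c < \<delta>" for c d
    unfolding box_real(2)[symmetric]
  proof (rule bounded_variation_absolutely_integrable_interval[where B = 1])
    show "f' integrable_on cbox c d" using sub[OF cd(1,2)] by auto
    fix D assume "D division_of cbox c d"
    then have D: "D division_of {c..d}" by simp
    have U: "\<Union>D = {c..d}" using D by (rule division_ofD)
    have "(\<Sum>K\<in>D. norm (integral K f')) = (\<Sum>K\<in>D. \<bar>increment f K\<bar>)"
    proof (rule sum.cong)
      fix K assume K: "K \<in> D"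
      obtain c' d' where K': "c' \<le> d'" "K = {c'..d'}" by (rule division_of_realE[OF D K])
      moreover have "{c'..d'} \<subseteq> {a..b}" using U K K' cd(2) by (metis Sup_upper order_trans)
      ultimately show "norm (integral K f') = \<bar>increment f K\<bar>"
        using sub[of c' d'] by (simp add: increment_Icc integral_unique)
    qed simp
    also have "\<dots> < 1"
      using D U cd sum_increment_division[OF cd(1) D, of "\<lambda>x. x"] by (intro ac_bound_division[OF \<delta>(2)]) auto
    finally show "(\<Sum>K\<in>D. norm (integral K f')) \<le> 1" by simp
  qed
  have "f' absolutely_integrable_on {a..d}" if "a \<le> d" "d \<le> b" "d - a < real (Suc n) * (\<delta> / 2)" for n d
    using that
  proof (induction n arbitrary: d)
    case 0
    then show ?case using \<delta>(1) by (intro short) auto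
  next
    case (Suc n)
    show ?case
    proof (cases "d - a < real (Suc n) * (\<delta> / 2)")
      case True
      then show ?thesis using Suc by auto
    next
      case False
      define c where "c = max a (d - \<delta> / 2)"
      have c: "a \<le> c" "c \<le> d" "d - c < \<delta>" "c - a < real (Suc n) * (\<delta> / 2)"
      proof -
        have "0 < real (Suc n) * (\<delta> / 2)" using \<delta>(1) by simp
        then show "c - a < real (Suc n) * (\<delta> / 2)"
          using Suc.prems(3) by (auto simp: c_def max_def algebra_simps)
      qed (use Suc.prems \<delta>(1) in \<open>auto simp: c_def\<close>)
      have "f' absolutely_integrable_on {a..c} \<union> {c..d}"
        using c Suc.prems by (intro absolutely_integrable_Un Suc.IH short) auto
      also have "{a..c} \<union> {c..d} = {a..d}" using c by auto
      finally show ?thesis .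
    qed
  qed
  moreover obtain n where "(b - a) / (\<delta> / 2) < real n" using reals_Archimedean2 by blast
  then have "b - a < real (Suc n) * (\<delta> / 2)" using \<delta>(1) by (simp add: field_simps)
  ultimately show ?thesis using \<open>a \<le> b\<close> by blast
qed

lemma AE_derivative_negligible:
  assumes "AE x in lborel. x \<in> {a<..<b} \<longrightarrow> (f has_real_derivative f' x) (at x)"
  obtains N where "negligible N" "\<And>x. x \<in> {a..b} - N \<Longrightarrow> (f has_real_derivative f' x) (at x within {a..b})"
proof -
  obtain M where M: "\<And>x. x \<in> space lborel - M \<Longrightarrow> x \<in> {a<..<b} \<longrightarrow> (f has_real_derivative f' x) (at x)"
    "M \<in> null_sets lborel"
    using AE_E3[OF assms] by metis
  have "negligible M"
    using M(2) by (simp add: negligible_iff_null_sets null_sets_completionI)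
  then have "negligible (M \<union> {a, b})" by simp
  moreover have "(f has_real_derivative f' x) (at x within {a..b})" if "x \<in> {a..b} - (M \<union> {a, b})" for x
  proof -
    have "x \<in> {a<..<b}" "x \<notin> M" using that by auto
    then have "(f has_real_derivative f' x) (at x)" using M(1) by auto
    then show ?thesis by (rule has_field_derivative_at_within)
  qed
  ultimately show thesis by (rule that)
qed

context
  fixes f f' :: "real \<Rightarrow> real" and a b :: real
  assumes ac: "absolutely_continuous_on {a..b} f"
    and borel: "f' \<in> borel_measurable borel"
    and deriv: "AE x in lborel. x \<in> {a<..<b} \<longrightarrow> (f has_real_derivative f' x) (at x)"
begin

lemma integrals_of_ac_derivative:
  assumes "a \<le> c" "c \<le> d" "d \<le> b"
  shows "(f' has_integral (f d - f c)) {c..d}" "set_integrable lborel {c..d} f'"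
proof -
  obtain N where N: "negligible N" "\<And>x. x \<in> {a..b} - N \<Longrightarrow> (f has_real_derivative f' x) (at x within {a..b})"
    using AE_derivative_negligible[OF deriv] by metis
  have sub: "{c..d} \<subseteq> {a..b}" using assms by auto
  have N': "(f has_real_derivative f' x) (at x within {c..d})" if "x \<in> {c..d} - N" for x
    using N(2)[of x] that sub by (blast intro: has_field_derivative_subset)
  note ac' = absolutely_continuous_on_subinterval[OF ac sub]
  show "(f' has_integral (f d - f c)) {c..d}"
    using absolutely_continuous_on_has_integral[OF ac' \<open>c \<le> d\<close> N(1) N'] .
  have "f' absolutely_integrable_on {c..d}"
    using absolutely_continuous_on_absolutely_integrable[OF ac' \<open>c \<le> d\<close> N(1) N'] .
  then show "set_integrable lborel {c..d} f'"
    unfolding set_integrable_def using borel by (subst (asm) integrable_completion) auto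
qed

lemma nn_integral_ac_derivative_finite: "(\<integral>\<^sup>+x\<in>{a..b}. ennreal \<bar>f' x\<bar> \<partial>lborel) < \<infinity>"
proof (cases "a \<le> b")
  case True
  have "(\<integral>\<^sup>+x. ennreal (norm (indicator {a..b} x *\<^sub>R f' x)) \<partial>lborel) < \<infinity>"
    using integrals_of_ac_derivative(2)[of a b] True unfolding set_integrable_def integrable_iff_bounded by auto
  also have "(\<integral>\<^sup>+x. ennreal (norm (indicator {a..b} x *\<^sub>R f' x)) \<partial>lborel) = (\<integral>\<^sup>+x\<in>{a..b}. ennreal \<bar>f' x\<bar> \<partial>lborel)"
    by (intro nn_integral_cong) (auto simp: indicator_def)
  finally show ?thesis .
qed simp

lemma increment_le_nn_integral_ac_derivative:
  assumes "a \<le> c" "c \<le> d" "d \<le> b"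
  shows "ennreal \<bar>f d - f c\<bar> \<le> (\<integral>\<^sup>+x\<in>{c<..<d}. ennreal \<bar>f' x\<bar> \<partial>lborel)"
proof -
  note I = integrals_of_ac_derivative[OF assms]
  have "(LINT x:{c..d}|lborel. f' x) = f d - f c"
    using set_borel_integral_eq_integral(2)[OF I(2)] integral_unique[OF I(1)] by simp
  then have "ennreal \<bar>f d - f c\<bar> = ennreal (norm (LINT x|lborel. indicator {c..d} x *\<^sub>R f' x))"
    by (simp add: set_lebesgue_integral_def)
  also have "\<dots> \<le> (\<integral>\<^sup>+x. norm (indicator {c..d} x *\<^sub>R f' x) \<partial>lborel)"
    using I(2) unfolding set_integrable_def by (rule integral_norm_bound_ennreal)
  also have "\<dots> = (\<integral>\<^sup>+x\<in>{c<..<d}. ennreal \<bar>f' x\<bar> \<partial>lborel)"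
  proof (rule nn_integral_cong_AE)
    have "AE x in lborel. x \<noteq> c \<and> x \<noteq> d" by (intro AE_conjI AE_lborel_singleton)
    then show "AE x in lborel. ennreal (norm (indicator {c..d} x *\<^sub>R f' x)) = ennreal \<bar>f' x\<bar> * indicator {c<..<d} x"
      by eventually_elim (auto simp: indicator_def)
  qed
  finally show ?thesis .
qed

lemma nn_integral_nonneg_ac_derivative:
  assumes "a \<le> c" "c \<le> d" "d \<le> b" "\<And>x. 0 \<le> f' x"
  shows "(\<integral>\<^sup>+x\<in>{c..d}. ennreal (f' x) \<partial>lborel) = ennreal (f d - f c)"
  using nn_integral_has_integral_lebesgue[of "{c..d}" f', OF _ integrals_of_ac_derivative(1)[OF assms(1-3)]] assms(4)
  by (simp add: mult.commute nn_integral_set_ennreal)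

end

section \<open>The monotone rearrangement\<close>

lemma last_point_below:
  fixes u :: "real \<Rightarrow> real"
  assumes cont: "continuous_on {p..k} u" and "p \<le> k" "u p \<le> s" "s \<le> u k"
  obtains c where "c \<in> {p..k}" "u c = s" "\<And>x. x \<in> {c<..k} \<Longrightarrow> s < u x"
proof -
  let ?L = "{x \<in> {p..k}. u x \<le> s}"
  have "closed ?L"
    using cont by (intro continuous_on_closed_Collect_le) (auto intro: continuous_intros)
  moreover have "bounded ?L" by (rule bounded_subset[OF compact_imp_bounded[OF compact_Icc, of p k]]) auto
  ultimately have "compact ?L" by (simp add: compact_eq_bounded_closed)
  moreover have "p \<in> ?L" using assms by auto
  ultimately obtain c where c: "c \<in> ?L" "\<And>y. y \<in> ?L \<Longrightarrow> y \<le> c"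
    using compact_attains_sup[of ?L] by blast
  have "\<exists>x. c \<le> x \<and> x \<le> k \<and> u x = s"
    using c(1) assms(4) by (intro IVT') (auto intro: continuous_on_subset[OF cont])
  then obtain x where x: "c \<le> x" "x \<le> k" "u x = s" by blast
  then have "x \<le> c" using c by auto
  then have "u c = s" using x by auto
  moreover have "s < u x" if "x \<in> {c<..k}" for x
    using c(2)[of x] c(1) that by force
  ultimately show thesis using c(1) that by auto
qed

lemma first_point_above:
  fixes u :: "real \<Rightarrow> real"
  assumes cont: "continuous_on {c..k} u" and "c \<le> k" "u c \<le> t" "t \<le> u k"
  obtains d where "d \<in> {c..k}" "u d = t" "\<And>x. x \<in> {c..<d} \<Longrightarrow> u x < t"
proof -
  have "continuous_on {-k..-c} (\<lambda>x. - u (- x))"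
    by (intro continuous_intros continuous_on_compose2[OF cont]) auto
  then obtain d where d: "d \<in> {-k..-c}" "- u (- d) = - t" "\<And>x. x \<in> {d<..-c} \<Longrightarrow> - t < - u (- x)"
    using last_point_below[of "-k" "-c" "\<lambda>x. - u (- x)" "- t"] assms by auto
  show thesis
  proof (rule that[of "- d"])
    show "u x < t" if "x \<in> {c..<- d}" for x using d(3)[of "- x"] that by auto
  qed (use d in auto)
qed

text \<open>
  The flanks of a hump of \<open>u\<close> with a top at \<open>k\<close>: walking from \<open>k\<close> to the left, \<open>c\<close> is the first point
  where \<open>u\<close> is down to \<open>s\<close>, and \<open>d\<close> is the first point after \<open>c\<close> where \<open>u\<close> is up to \<open>t\<close>.
\<close>

lemma left_flank:
  fixes u :: "real \<Rightarrow> real"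
  assumes cont: "continuous_on {p..k} u" and "p \<le> k" "u p \<le> s" "s < t" "t \<le> u k"
  obtains c d where "p \<le> c" "c < d" "d \<le> k" "u c = s" "u d = t"
    "\<And>x. x \<in> {c<..k} \<Longrightarrow> s < u x" "\<And>x. x \<in> {c..<d} \<Longrightarrow> u x < t"
proof -
  obtain c where c: "c \<in> {p..k}" "u c = s" "\<And>x. x \<in> {c<..k} \<Longrightarrow> s < u x"
    using last_point_below[OF cont, of s] assms by auto
  obtain d where d: "d \<in> {c..k}" "u d = t" "\<And>x. x \<in> {c..<d} \<Longrightarrow> u x < t"
    using first_point_above[of c k u t] c assms continuous_on_subset[OF cont, of "{c..k}"] by auto
  have "c \<noteq> d" using c d \<open>s < t\<close> by auto
  with c d show thesis by (intro that[of c d]) auto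
qed

lemma right_flank:
  fixes u :: "real \<Rightarrow> real"
  assumes cont: "continuous_on {k..q} u" and "k \<le> q" "u q \<le> s" "s < t" "t \<le> u k"
  obtains d e where "k \<le> d" "d < e" "e \<le> q" "u d = t" "u e = s"
    "\<And>x. x \<in> {k..<e} \<Longrightarrow> s < u x" "\<And>x. x \<in> {d<..e} \<Longrightarrow> u x < t"
proof -
  have "continuous_on {-q..-k} (\<lambda>x. u (- x))"
    by (intro continuous_intros continuous_on_compose2[OF cont]) auto
  then obtain c d where cd: "-q \<le> c" "c < d" "d \<le> -k" "u (- c) = s" "u (- d) = t"
    "\<And>x. x \<in> {c<..-k} \<Longrightarrow> s < u (- x)" "\<And>x. x \<in> {c..<d} \<Longrightarrow> u (- x) < t"
    using left_flank[of "-q" "-k" "\<lambda>x. u (- x)" s t] assms by auto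
  show thesis
  proof (rule that[of "- d" "- c"])
    show "s < u x" if "x \<in> {k..<- c}" for x using cd(6)[of "- x"] that by auto
    show "u x < t" if "x \<in> {- d<..- c}" for x using cd(7)[of "- x"] that by auto
  qed (use cd in auto)
qed

lemma Icc_fmeasurable: "{a..b::real} \<in> fmeasurable lborel"
  by (auto simp: fmeasurable_def emeasure_lborel_Icc_eq)

definition superlevel :: "(real \<Rightarrow> real) \<Rightarrow> real \<Rightarrow> real set" where
  "superlevel u t = {y \<in> {-1..1}. u y > t}"

text \<open>
  The point at which the rearrangement of \<open>u\<close> passes the level \<open>t\<close>; up to jumps and flat pieces, \<open>edge u\<close> is
  the inverse function of the rearrangement.
\<close>

definition edge :: "(real \<Rightarrow> real) \<Rightarrow> real \<Rightarrow> real" where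
  "edge u t = 1 - measure lborel (superlevel u t)"

text \<open>
  Functions are taken continuous and nonnegative on the whole line; a function on \<open>[-1,1]\<close> is brought to
  this form by composing it with the projection onto \<open>[-1,1]\<close>.
\<close>

locale nonneg_profile =
  fixes u :: "real \<Rightarrow> real"
  assumes cont: "continuous_on UNIV u" and nonneg: "\<And>x. 0 \<le> u x"
begin

lemma borel_u [measurable]: "u \<in> borel_measurable borel"
  using cont by (rule borel_measurable_continuous_onI)

lemma superlevel_sets [measurable]: "superlevel u t \<in> sets borel"
  unfolding superlevel_def by measurable

lemma superlevel_fmeasurable: "superlevel u t \<in> fmeasurable lborel"
  by (rule fmeasurableI2[of "{-1..1}"]) (auto simp: superlevel_def Icc_fmeasurable)

lemma superlevel_antimono: "s \<le> t \<Longrightarrow> superlevel u t \<subseteq> superlevel u s"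
  by (auto simp: superlevel_def)

lemma edge_mono: "s \<le> t \<Longrightarrow> edge u s \<le> edge u t"
  unfolding edge_def using superlevel_antimono superlevel_fmeasurable superlevel_sets
  by (simp add: measure_mono_fmeasurable)

lemma measure_superlevel_le: "measure lborel (superlevel u t) \<le> 2"
proof -
  have "measure lborel (superlevel u t) \<le> measure lborel {-1..1::real}"
    by (rule measure_mono_fmeasurable[OF _ _ Icc_fmeasurable]) (auto simp: superlevel_def)
  then show ?thesis by simp
qed

lemma edge_bounds: "-1 \<le> edge u t" "edge u t \<le> 1"
  using measure_superlevel_le[of t] by (auto simp: edge_def)

lemma edge_borel [measurable]: "edge u \<in> borel_measurable borel"
  using edge_mono by (intro borel_measurable_mono) (auto simp: mono_def)

text \<open>
  Right continuity of \<open>edge u\<close>, in the form in which it is used: \<open>{u > t}\<close> is the increasing union of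
  the sets \<open>{u > t + 1/n}\<close>.
\<close>

lemma edge_right_continuous:
  assumes "\<And>s. t < s \<Longrightarrow> x \<le> edge u s"
  shows "x \<le> edge u t"
proof -
  have "(\<lambda>n. measure lborel (superlevel u (t + 1 / Suc n))) \<longlonglongrightarrow> measure lborel (\<Union>n. superlevel u (t + 1 / Suc n))"
  proof (rule Lim_measure_incseq)
    show "incseq (\<lambda>n. superlevel u (t + 1 / Suc n))"
      by (intro monoI superlevel_antimono) (auto simp: field_simps)
    have "emeasure lborel (\<Union>n. superlevel u (t + 1 / real (Suc n))) \<le> emeasure lborel {-1..1::real}"
      by (intro emeasure_mono) (auto simp: superlevel_def)
    then show "emeasure lborel (\<Union>n. superlevel u (t + 1 / real (Suc n))) \<noteq> \<infinity>"
      by (auto simp: top_unique)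
  qed auto
  also have "(\<Union>n. superlevel u (t + 1 / Suc n)) = superlevel u t"
  proof -
    have "\<exists>n. t + 1 / Suc n < u y" if "t < u y" for y
      using nat_approx_posE[of "u y - t"] that by (metis add.commute diff_gt_0_iff_gt less_diff_eq)
    moreover have "t < u y" if "t + 1 / Suc n < u y" for n y
    proof -
      have "0 < 1 / real (Suc n)" by simp
      with that show ?thesis by linarith
    qed
    ultimately show ?thesis unfolding superlevel_def by auto
  qed
  finally have "(\<lambda>n. edge u (t + 1 / Suc n)) \<longlonglongrightarrow> edge u t"
    unfolding edge_def by (intro tendsto_intros)
  then show ?thesis
    by (rule LIMSEQ_le_const) (use assms in auto)
qed

text \<open>
  The set whose length is \<open>rearr u x\<close>. If not empty, it is an interval that starts at 0, so its length is its supremum.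
\<close>

definition levels :: "real \<Rightarrow> real set" where
  "levels x = {t. 0 \<le> t \<and> superlevel u t \<noteq> {} \<and> edge u t \<le> x}"

lemma rearr_eq_measure_levels:
  assumes "x \<in> {-1..1}"
  shows "rearr u x = measure lborel (levels x)"
proof -
  have "indicator {0..} t *\<^sub>R indicator (rearr_set {y \<in> {-1..1}. u y > t}) x = (indicator (levels x) t :: real)" for t
    using assms unfolding levels_def rearr_set_def edge_def superlevel_def[symmetric]
    by (auto simp: indicator_def measure_completion)
  then show ?thesis
    unfolding rearr_def set_lebesgue_integral_def by simp
qed

lemma levels_down: "s \<in> levels x \<Longrightarrow> 0 \<le> t \<Longrightarrow> t \<le> s \<Longrightarrow> t \<in> levels x"
  unfolding levels_def using superlevel_antimono[of t s] edge_mono[of t s] by auto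

lemma levels_bounded:
  assumes "\<And>y. y \<in> {-1..1} \<Longrightarrow> u y \<le> M"
  shows "levels x \<subseteq> {0..M}"
proof
  fix t assume "t \<in> levels x"
  then obtain y where "y \<in> {-1..1}" "t < u y" "0 \<le> t" by (auto simp: levels_def superlevel_def)
  then show "t \<in> {0..M}" using assms[of y] by auto
qed

lemma u_bounded: obtains M where "\<And>y. y \<in> {-1..1} \<Longrightarrow> u y \<le> M"
proof -
  have "compact (u ` {-1..1})" by (intro compact_continuous_image continuous_on_subset[OF cont]) auto
  then show thesis using compact_attains_sup[of "u ` {-1..1}"] that by force
qed

lemma levels_borel [measurable]: "levels x \<in> sets borel"
proof (rule real_interval_borel_measurable)
  show "is_interval (levels x)"
    unfolding is_interval_1
  proof (intro ballI allI impI)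
    fix r s t assume "r \<in> levels x" "s \<in> levels x" "r \<le> t \<and> t \<le> s"
    moreover from this have "0 \<le> t" by (auto simp: levels_def)
    ultimately show "t \<in> levels x" using levels_down[of s x t] by auto
  qed
qed

lemma le_rearr: assumes "x \<in> {-1..1}" "t \<in> levels x" shows "t \<le> rearr u x"
proof -
  have t: "0 \<le> t" using assms by (simp add: levels_def)
  obtain M where M: "\<And>y. y \<in> {-1..1} \<Longrightarrow> u y \<le> M" using u_bounded by metis
  have "t = measure lborel {0..t}" using t by simp
  also have "\<dots> \<le> measure lborel (levels x)"
  proof (rule measure_mono_fmeasurable)
    show "{0..t} \<subseteq> levels x" using levels_down[OF assms(2)] by auto
    show "levels x \<in> fmeasurable lborel"
    proof (rule fmeasurableI2[OF Icc_fmeasurable])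
      show "levels x \<subseteq> {0..M}" by (rule levels_bounded) (rule M)
    qed simp
  qed auto
  finally show ?thesis using rearr_eq_measure_levels[OF assms(1)] by simp
qed

lemma rearr_le: assumes "x \<in> {-1..1}" "0 \<le> t" "t \<notin> levels x" shows "rearr u x \<le> t"
proof -
  have "levels x \<subseteq> {0..t}"
  proof
    fix s assume "s \<in> levels x"
    then have "0 \<le> s" "\<not> t \<le> s" using levels_down[of s x t] assms by (auto simp: levels_def)
    then show "s \<in> {0..t}" by simp
  qed
  then have "measure lborel (levels x) \<le> measure lborel {0..t}"
    by (intro measure_mono_fmeasurable) (auto simp: Icc_fmeasurable)
  then show ?thesis using rearr_eq_measure_levels[OF assms(1)] assms by simp
qed

lemma edge_le_of_less_rearr:
  assumes "x \<in> {-1..1}" "t < rearr u x"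
  shows "edge u t \<le> x"
proof (cases "0 \<le> t")
  case True
  then show ?thesis using rearr_le[OF assms(1) True] assms(2) by (force simp: levels_def)
next
  case False
  then have "t < u y" for y using nonneg[of y] by linarith
  then have "superlevel u t = {-1..1}" by (auto simp: superlevel_def)
  then show ?thesis using assms by (simp add: edge_def)
qed

lemma rearr_nonneg: "x \<in> {-1..1} \<Longrightarrow> 0 \<le> rearr u x"
  by (simp add: rearr_eq_measure_levels)

lemma le_edge_of_rearr_le:
  assumes "x \<in> {-1..1}" "rearr u x \<le> t"
  shows "x \<le> edge u t"
proof (rule edge_right_continuous)
  fix s assume "t < s"
  then have "0 \<le> s" "s \<notin> levels x" using rearr_nonneg[OF assms(1)] le_rearr[OF assms(1), of s] assms(2) by auto
  then have "superlevel u s = {} \<or> x < edge u s" by (auto simp: levels_def)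
  then show "x \<le> edge u s" using assms(1) by (auto simp: edge_def)
qed

lemma rearr_mono: assumes "x \<in> {-1..1}" "y \<in> {-1..1}" "x \<le> y" shows "rearr u x \<le> rearr u y"
proof (rule ccontr)
  assume "\<not> rearr u x \<le> rearr u y"
  then obtain t where t: "rearr u y < t" "t < rearr u x" using dense[of "rearr u y" "rearr u x"] by auto
  have "t \<in> levels x"
  proof (rule ccontr)
    assume "t \<notin> levels x"
    moreover have "0 \<le> t" using t rearr_nonneg[OF assms(2)] by linarith
    ultimately have "rearr u x \<le> t" using rearr_le[OF assms(1)] by blast
    with t show False by linarith
  qed
  then have "t \<in> levels y" using assms(3) by (auto simp: levels_def)
  from le_rearr[OF assms(2) this] t show False by linarith
qed

lemma rearr_le_bound:
  assumes "\<And>y. y \<in> {-1..1} \<Longrightarrow> u y \<le> M" "x \<in> {-1..1}"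
  shows "rearr u x \<le> M"
proof (rule rearr_le[OF assms(2)])
  show "0 \<le> M" using nonneg[of 0] assms(1)[of 0] by simp
  have "superlevel u M = {}" using assms(1) by (auto simp: superlevel_def not_less)
  then show "M \<notin> levels x" by (simp add: levels_def)
qed

lemma rearr_ge_bound:
  assumes "\<And>y. y \<in> {-1..1} \<Longrightarrow> m \<le> u y" "x \<in> {-1..1}"
  shows "m \<le> rearr u x"
proof (rule dense_le)
  fix t assume "t < m"
  show "t \<le> rearr u x"
  proof (cases "0 \<le> t")
    case True
    have "t < u y" if "y \<in> {-1..1}" for y using assms(1)[OF that] \<open>t < m\<close> by linarith
    then have "superlevel u t = {-1..1}" by (auto simp: superlevel_def)
    then have "t \<in> levels x" using True assms(2) by (auto simp: levels_def edge_def)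
    then show ?thesis using le_rearr[OF assms(2)] by simp
  qed (use rearr_nonneg[OF assms(2)] in auto)
qed

lemma rearr_attained:
  assumes "x \<in> {-1..1}" obtains y where "y \<in> {-1..1}" "u y = rearr u x"
proof -
  have c: "compact (u ` {-1..1})" by (intro compact_continuous_image continuous_on_subset[OF cont]) auto
  obtain ya where ya: "ya \<in> {-1..1}" "\<And>y. y \<in> {-1..1} \<Longrightarrow> u y \<le> u ya"
    using compact_attains_sup[OF c] by auto
  obtain yb where yb: "yb \<in> {-1..1}" "\<And>y. y \<in> {-1..1} \<Longrightarrow> u yb \<le> u y"
    using compact_attains_inf[OF c] by auto
  have "connected (u ` {-1..1})" by (intro connected_continuous_image continuous_on_subset[OF cont]) auto
  from connectedD_interval[OF this imageI[OF yb(1)] imageI[OF ya(1)], of "rearr u x"]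
  have "rearr u x \<in> u ` {-1..1}"
    using rearr_le_bound[OF ya(2) assms] rearr_ge_bound[OF yb(2) assms] by blast
  then show thesis using that by auto
qed

lemma crossing_interval:
  assumes "x \<in> {-1..1}" "y \<in> {-1..1}" "u x = s" "u y = t" "s < t"
  obtains c d where "c < d" "{c..d} \<subseteq> {-1..1}" "\<bar>u d - u c\<bar> = t - s" "\<And>z. z \<in> {c<..<d} \<Longrightarrow> s < u z \<and> u z < t"
proof (cases "x \<le> y")
  case True
  then obtain c d where "x \<le> c" "c < d" "d \<le> y" "u c = s" "u d = t"
    "\<And>z. z \<in> {c<..y} \<Longrightarrow> s < u z" "\<And>z. z \<in> {c..<d} \<Longrightarrow> u z < t"
    using left_flank[of x y u s t] assms continuous_on_subset[OF cont] by (metis order_refl subset_UNIV)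
  then show thesis using assms by (intro that[of c d]) auto
next
  case False
  then obtain d e where "y \<le> d" "d < e" "e \<le> x" "u d = t" "u e = s"
    "\<And>z. z \<in> {y..<e} \<Longrightarrow> s < u z" "\<And>z. z \<in> {d<..e} \<Longrightarrow> u z < t"
    using right_flank[of y x u s t] assms continuous_on_subset[OF cont] by (metis linear order_refl subset_UNIV)
  then show thesis using assms by (intro that[of d e]) auto
qed

text \<open>
  Whatever the rearrangement gains on \<open>[l, r]\<close>, the function \<open>u\<close> gains or loses on some interval that
  is no longer: the part of \<open>u\<close> strictly between the two levels has total length at most \<open>r - l\<close>, and it
  contains a complete crossing. Only levels strictly below \<open>rearr u r\<close> can be compared through \<open>edge\<close>, so
  the length is bounded on compact pieces of the crossing.
\<close>

lemma crossing_shorter_than_rearr: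
  assumes lr: "l \<in> {-1..1}" "r \<in> {-1..1}" "l \<le> r"
  obtains c d where "c \<le> d" "{c..d} \<subseteq> {-1..1}" "\<bar>u d - u c\<bar> = rearr u r - rearr u l" "d - c \<le> r - l"
    "\<And>z. z \<in> {c<..<d} \<Longrightarrow> rearr u l < u z \<and> u z < rearr u r"
proof (cases "rearr u l < rearr u r")
  case False
  then have "rearr u l = rearr u r" using rearr_mono[OF lr] by simp
  then show thesis using lr by (intro that[of l l]) auto
next
  case True
  obtain x y where xy: "x \<in> {-1..1}" "u x = rearr u l" "y \<in> {-1..1}" "u y = rearr u r"
    using rearr_attained[OF lr(1)] rearr_attained[OF lr(2)] by metis
  obtain c d where cd: "c < d" "{c..d} \<subseteq> {-1..1}" "\<bar>u d - u c\<bar> = rearr u r - rearr u l"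
    "\<And>z. z \<in> {c<..<d} \<Longrightarrow> rearr u l < u z \<and> u z < rearr u r"
    using crossing_interval[OF xy(1,3,2,4) True] by metis
  have "d - c \<le> r - l"
  proof (rule dense_le)
    fix w assume "w < d - c"
    show "w \<le> r - l"
    proof (cases "0 < w")
      case True
      define w' where "w' = (d - c - w) / 2"
      have w': "0 < w'" "w' + w < d - c" using \<open>w < d - c\<close> by (simp_all add: w'_def field_simps)
      have "compact (u ` {c + w'..c + w' + w})" by (intro compact_continuous_image continuous_on_subset[OF cont]) auto
      moreover have "u ` {c + w'..c + w' + w} \<noteq> {}" using True by simp
      ultimately obtain v where "v \<in> u ` {c + w'..c + w' + w}" "\<forall>y\<in>u ` {c + w'..c + w' + w}. y \<le> v"
        using compact_attains_sup by metis
      then obtain z where z: "z \<in> {c + w'..c + w' + w}" "\<And>y. y \<in> {c + w'..c + w' + w} \<Longrightarrow> u y \<le> u z"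
        by auto
      have "rearr u l < u z" "u z < rearr u r" using cd(4)[of z] z(1) w' by auto
      have "w = measure lborel {c + w'..c + w' + w}" using True by simp
      also have "\<dots> \<le> measure lborel (superlevel u (rearr u l) - superlevel u (u z))"
      proof (rule measure_mono_fmeasurable)
        show "{c + w'..c + w' + w} \<subseteq> superlevel u (rearr u l) - superlevel u (u z)"
        proof
          fix y assume y: "y \<in> {c + w'..c + w' + w}"
          then have "y \<in> {c<..<d}" using w' by auto
          then show "y \<in> superlevel u (rearr u l) - superlevel u (u z)"
            using cd(2) cd(4)[of y] z(2)[OF y] by (auto simp: superlevel_def)
        qed
        show "superlevel u (rearr u l) - superlevel u (u z) \<in> fmeasurable lborel"
          using superlevel_fmeasurable superlevel_sets by (intro fmeasurable_Diff) auto
      qed auto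
      also have "\<dots> = measure lborel (superlevel u (rearr u l)) - measure lborel (superlevel u (u z))"
        using superlevel_fmeasurable superlevel_antimono[of "rearr u l" "u z"] \<open>rearr u l < u z\<close>
        by (intro measurable_measure_Diff) (auto simp: fmeasurableD)
      also have "\<dots> = edge u (u z) - edge u (rearr u l)" by (simp add: edge_def)
      also have "\<dots> \<le> r - l"
        using edge_le_of_less_rearr[OF lr(2) \<open>u z < rearr u r\<close>] le_edge_of_rearr_le[OF lr(1) order_refl] by simp
      finally show ?thesis .
    qed (use lr in auto)
  qed
  then show thesis using cd by (intro that[of c d]) auto
qed

text \<open>
  For disjoint intervals the crossings of the preceding lemma run through disjoint ranges of levels, so
  they are disjoint too and the condition on \<open>u\<close> applies to them.
\<close>

theorem rearr_absolutely_continuous: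
  assumes ac: "absolutely_continuous_on {-1..1} u"
  shows "absolutely_continuous_on {-1..1} (rearr u)"
  unfolding absolutely_continuous_on_iff_ac_bound
proof (intro allI impI)
  fix \<epsilon> :: real assume "\<epsilon> > 0"
  then obtain \<delta> where \<delta>: "\<delta> > 0" "ac_bound {-1..1} u \<epsilon> \<delta>"
    using ac unfolding absolutely_continuous_on_iff_ac_bound by blast
  have "ac_bound {-1..1} (rearr u) \<epsilon> \<delta>"
    unfolding ac_bound_def
  proof (intro allI impI)
    fix n :: nat and l r :: "nat \<Rightarrow> real"
    assume lr: "\<forall>i<n. l i \<le> r i \<and> {l i..r i} \<subseteq> {-1..1}"
      and disj: "disjoint_family_on (\<lambda>i. {l i<..<r i}) {..<n}" and less: "(\<Sum>i<n. r i - l i) < \<delta>"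
    have "\<exists>c d. c \<le> d \<and> {c..d} \<subseteq> {-1..1} \<and> \<bar>u d - u c\<bar> = rearr u (r i) - rearr u (l i) \<and> d - c \<le> r i - l i \<and>
        (\<forall>z\<in>{c<..<d}. rearr u (l i) < u z \<and> u z < rearr u (r i))" if "i < n" for i
    proof -
      have "l i \<in> {-1..1}" "r i \<in> {-1..1}" "l i \<le> r i" using lr that by auto
      from crossing_shorter_than_rearr[OF this] show ?thesis by metis
    qed
    then obtain c d where cd: "\<And>i. i < n \<Longrightarrow> c i \<le> d i" "\<And>i. i < n \<Longrightarrow> {c i..d i} \<subseteq> {-1..1}"
      "\<And>i. i < n \<Longrightarrow> \<bar>u (d i) - u (c i)\<bar> = rearr u (r i) - rearr u (l i)" "\<And>i. i < n \<Longrightarrow> d i - c i \<le> r i - l i"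
      "\<And>i z. i < n \<Longrightarrow> z \<in> {c i<..<d i} \<Longrightarrow> rearr u (l i) < u z \<and> u z < rearr u (r i)"
      by metis
    have "(\<Sum>i\<in>{..<n}. \<bar>u (d i) - u (c i)\<bar>) < \<epsilon>"
    proof (rule ac_boundD[OF \<delta>(2)])
      show "disjoint_family_on (\<lambda>i. {c i<..<d i}) {..<n}"
        unfolding disjoint_family_on_def
      proof (intro ballI impI, rule ccontr)
        fix i j assume ij: "i \<in> {..<n}" "j \<in> {..<n}" "i \<noteq> j" and "{c i<..<d i} \<inter> {c j<..<d j} \<noteq> {}"
        then obtain z where "z \<in> {c i<..<d i}" "z \<in> {c j<..<d j}" by blast
        then have z: "rearr u (l i) < u z" "u z < rearr u (r i)" "rearr u (l j) < u z" "u z < rearr u (r j)"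
          using cd(5)[of i z] cd(5)[of j z] ij by auto
        have b: "l i \<in> {-1..1}" "r i \<in> {-1..1}" "l j \<in> {-1..1}" "r j \<in> {-1..1}" using lr ij by auto
        have 1: "\<not> r i \<le> l j" using rearr_mono[OF b(2,3)] z by auto
        have 2: "\<not> r j \<le> l i" using rearr_mono[OF b(4,1)] z by auto
        have 3: "l i < r i" "l j < r j" using rearr_mono[OF b(2,1)] rearr_mono[OF b(4,3)] z by (auto simp: not_le[symmetric])
        have "(max (l i) (l j) + min (r i) (r j)) / 2 \<in> {l i<..<r i} \<inter> {l j<..<r j}"
          using 1 2 3 by (auto simp: max_def min_def)
        then show False using disj ij unfolding disjoint_family_on_def by blast
      qed
      have "(\<Sum>i\<in>{..<n}. d i - c i) \<le> (\<Sum>i\<in>{..<n}. r i - l i)" using cd(4) by (intro sum_mono) auto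
      then show "(\<Sum>i\<in>{..<n}. d i - c i) < \<delta>" using less by simp
    qed (use cd in auto)
    also have "(\<Sum>i\<in>{..<n}. \<bar>u (d i) - u (c i)\<bar>) = (\<Sum>i<n. \<bar>rearr u (r i) - rearr u (l i)\<bar>)"
    proof (rule sum.cong)
      fix i assume "i \<in> {..<n}"
      then show "\<bar>u (d i) - u (c i)\<bar> = \<bar>rearr u (r i) - rearr u (l i)\<bar>" using cd(3)[of i] by simp
    qed simp
    finally show "(\<Sum>i<n. \<bar>rearr u (r i) - rearr u (l i)\<bar>) < \<epsilon>" .
  qed
  then show "\<exists>\<delta>>0. ac_bound {-1..1} (rearr u) \<epsilon> \<delta>" using \<delta>(1) by blast
qed

end

section \<open>The cost of crossing a slab of levels\<close>

text \<open>
  A slab \<open>s < u \<le> t\<close> together with a weight \<open>b\<close> that depends on the position alone. The function \<open>du\<close>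
  stands for the derivative of \<open>u\<close> and enters through the estimate \<open>increment\<close>.
\<close>

locale weighted_slab = nonneg_profile u for u :: "real \<Rightarrow> real" +
  fixes du b :: "real \<Rightarrow> real" and s t :: real
  assumes du_borel [measurable]: "du \<in> borel_measurable borel"
    and increment: "\<And>c d. c \<le> d \<Longrightarrow> {c..d} \<subseteq> {-1..1} \<Longrightarrow>
      ennreal \<bar>u d - u c\<bar> \<le> (\<integral>\<^sup>+x\<in>{c<..<d}. ennreal \<bar>du x\<bar> \<partial>lborel)"
    and b_borel [measurable]: "b \<in> borel_measurable borel"
    and b_cont: "continuous_on {-1..1} b"
    and b_nonneg: "\<And>x. x \<in> {-1..1} \<Longrightarrow> 0 \<le> b x"
    and b_even: "\<And>x. x \<in> {-1..1} \<Longrightarrow> b (- x) = b x"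
    and b_triangle: "\<And>x y. -1 \<le> x \<Longrightarrow> x \<le> y \<Longrightarrow> y \<le> 1 \<Longrightarrow> b (1 - y + x) \<le> b x + b y"
    and s_less_t: "s < t"
begin

definition cost :: "real set \<Rightarrow> ennreal" where
  "cost A = (\<integral>\<^sup>+x\<in>A \<inter> {x. s < u x \<and> u x \<le> t}. ennreal (b x * \<bar>du x\<bar>) \<partial>lborel)"

lemma slab_borel [measurable]: "{x. s < u x \<and> u x \<le> t} \<in> sets borel"
  by measurable

lemma cost_mono: "A \<subseteq> B \<Longrightarrow> cost A \<le> cost B"
  unfolding cost_def by (intro nn_integral_mono) (auto simp: indicator_def)

lemma cost_Un:
  assumes [measurable]: "A \<in> sets borel" "B \<in> sets borel" and "A \<inter> B = {}"
  shows "cost A + cost B = cost (A \<union> B)"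
proof -
  have "cost A + cost B = (\<integral>\<^sup>+x. ennreal (b x * \<bar>du x\<bar>) * indicator (A \<inter> {x. s < u x \<and> u x \<le> t}) x
      + ennreal (b x * \<bar>du x\<bar>) * indicator (B \<inter> {x. s < u x \<and> u x \<le> t}) x \<partial>lborel)"
    unfolding cost_def by (intro nn_integral_add[symmetric]) auto
  also have "\<dots> = cost (A \<union> B)"
    unfolding cost_def using assms(3) by (intro nn_integral_cong) (auto simp: indicator_def)
  finally show ?thesis .
qed

text \<open>
  The point \<open>y\<close> is where \<open>b\<close> is smallest on the crossing.
\<close>

lemma crossing_cost:
  assumes "c < d" "{c..d} \<subseteq> {-1..1}" "\<bar>u d - u c\<bar> = t - s" "\<And>x. x \<in> {c<..<d} \<Longrightarrow> s < u x \<and> u x < t"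
  obtains y where "y \<in> {c..d}" "ennreal ((t - s) * b y) \<le> cost {c<..<d}"
proof -
  obtain y where y: "y \<in> {c..d}" "\<And>x. x \<in> {c..d} \<Longrightarrow> b y \<le> b x"
    using continuous_attains_inf[OF compact_Icc, of c d b] assms(1) continuous_on_subset[OF b_cont assms(2)] by auto
  have by0: "0 \<le> b y" using y assms(2) b_nonneg by auto
  have "ennreal ((t - s) * b y) = ennreal (b y) * ennreal \<bar>u d - u c\<bar>"
    using assms(3) by0 s_less_t by (simp add: ennreal_mult[symmetric] mult.commute)
  also have "\<dots> \<le> ennreal (b y) * (\<integral>\<^sup>+x\<in>{c<..<d}. ennreal \<bar>du x\<bar> \<partial>lborel)"
    using increment[of c d] assms by (intro mult_left_mono) auto
  also have "\<dots> = (\<integral>\<^sup>+x. ennreal (b y) * (ennreal \<bar>du x\<bar> * indicator {c<..<d} x) \<partial>lborel)"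
    by (intro nn_integral_cmult[symmetric]) auto
  also have "\<dots> \<le> cost {c<..<d}"
    unfolding cost_def
  proof (intro nn_integral_mono)
    fix x
    show "ennreal (b y) * (ennreal \<bar>du x\<bar> * indicator {c<..<d} x) \<le>
        ennreal (b x * \<bar>du x\<bar>) * indicator ({c<..<d} \<inter> {x. s < u x \<and> u x \<le> t}) x"
    proof (cases "x \<in> {c<..<d}")
      case True
      then have "b y \<le> b x" using y(2)[of x] by auto
      then have "ennreal (b y) * ennreal \<bar>du x\<bar> \<le> ennreal (b x * \<bar>du x\<bar>)"
        using by0 by (simp add: ennreal_mult[symmetric] mult_right_mono)
      then show ?thesis using True assms(4)[OF True] by (simp add: indicator_def)
    qed simp
  qed
  finally show thesis using y(1) that by blast
qed

definition high :: "real set" where "high = {x \<in> {-1..1}. t \<le> u x}"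

lemma high_borel [measurable]: "high \<in> sets borel"
  unfolding high_def by measurable

text \<open>
  The statement that travels along \<open>[-1,1]\<close>. It says that inside \<open>[c, d]\<close> the superlevel set can be replaced by
  a set whose length \<open>L\<close> is between those of \<open>{u \<ge> t}\<close> and \<open>{u > s}\<close>, and whose merged interval \<open>[1 - L, 1]\<close> is paid for by
  the cost of \<open>]c, d[\<close>. If \<open>u\<close> stays below \<open>t\<close> on \<open>[c, d]\<close>, then \<open>L = 0\<close> is allowed and nothing has to be paid. The upper bound uses
  the open interval so that it adds up over adjacent intervals.
\<close>

definition pays :: "real \<Rightarrow> real \<Rightarrow> bool" where
  "pays c d \<longleftrightarrow> (\<exists>L. measure lborel (high \<inter> {c..d}) \<le> L \<and> L \<le> measure lborel (superlevel u s \<inter> {c<..<d}) \<and>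
     (L = 0 \<and> high \<inter> {c..d} = {} \<or> ennreal ((t - s) * b (1 - L)) \<le> cost {c<..<d}))"

lemma pays_trivial: "high \<inter> {c..d} = {} \<Longrightarrow> pays c d"
  unfolding pays_def by (intro exI[of _ 0]) auto

lemma subset_Icc_fmeasurable: "A \<in> sets borel \<Longrightarrow> A \<subseteq> {-1..1::real} \<Longrightarrow> A \<in> fmeasurable lborel"
  by (rule fmeasurableI2[OF Icc_fmeasurable]) auto

lemma superlevel_Int_le: 
  assumes [measurable]: "A \<in> sets borel"
  shows "measure lborel (superlevel u s \<inter> A) \<le> 2"
proof -
  have "measure lborel (superlevel u s \<inter> A) \<le> measure lborel (superlevel u s)"
    by (intro measure_mono_fmeasurable superlevel_fmeasurable) auto
  then show ?thesis using measure_superlevel_le[of s] by simp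
qed

text \<open>
  Merging two sets of lengths \<open>L1\<close> and \<open>L2\<close>: the triangle condition for the points \<open>L1 - 1 \<le> 1 - L2\<close>
  together with evenness.
\<close>

lemma pays_join:
  assumes "pays c e" "pays e d" "c \<le> e" "e \<le> d"
  shows "pays c d"
proof -
  obtain L1 where L1: "measure lborel (high \<inter> {c..e}) \<le> L1" "L1 \<le> measure lborel (superlevel u s \<inter> {c<..<e})"
    "L1 = 0 \<and> high \<inter> {c..e} = {} \<or> ennreal ((t - s) * b (1 - L1)) \<le> cost {c<..<e}"
    using assms(1) unfolding pays_def by blast
  obtain L2 where L2: "measure lborel (high \<inter> {e..d}) \<le> L2" "L2 \<le> measure lborel (superlevel u s \<inter> {e<..<d})"
    "L2 = 0 \<and> high \<inter> {e..d} = {} \<or> ennreal ((t - s) * b (1 - L2)) \<le> cost {e<..<d}"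
    using assms(2) unfolding pays_def by blast
  have hsplit: "high \<inter> {c..d} = (high \<inter> {c..e}) \<union> (high \<inter> {e..d})" using assms by auto
  have "measure lborel (high \<inter> {c..d}) \<le> measure lborel (high \<inter> {c..e}) + measure lborel (high \<inter> {e..d})"
    unfolding hsplit by (intro measure_Un_le) auto
  then have lo: "measure lborel (high \<inter> {c..d}) \<le> L1 + L2" using L1(1) L2(1) by linarith
  have "measure lborel (superlevel u s \<inter> {c<..<e}) + measure lborel (superlevel u s \<inter> {e<..<d})
      = measure lborel ((superlevel u s \<inter> {c<..<e}) \<union> (superlevel u s \<inter> {e<..<d}))"
  proof (rule measure_Union[symmetric])
    show "emeasure lborel (superlevel u s \<inter> {c<..<e}) \<noteq> \<infinity>" "emeasure lborel (superlevel u s \<inter> {e<..<d}) \<noteq> \<infinity>"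
      unfolding infinity_ennreal_def by (intro fmeasurableD2 subset_Icc_fmeasurable; auto simp: superlevel_def)+
  qed auto
  also have "\<dots> \<le> measure lborel (superlevel u s \<inter> {c<..<d})"
    using assms by (intro measure_mono_fmeasurable subset_Icc_fmeasurable) (auto simp: superlevel_def)
  finally have hi: "L1 + L2 \<le> measure lborel (superlevel u s \<inter> {c<..<d})" using L1(2) L2(2) by linarith
  have cost: "cost {c<..<e} + cost {e<..<d} \<le> cost {c<..<d}"
  proof -
    have "cost {c<..<e} + cost {e<..<d} = cost ({c<..<e} \<union> {e<..<d})" by (intro cost_Un) auto
    also have "\<dots> \<le> cost {c<..<d}" using assms by (intro cost_mono) auto
    finally show ?thesis .
  qed
  have c1: "cost {c<..<e} \<le> cost {c<..<d}" "cost {e<..<d} \<le> cost {c<..<d}"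
    using assms by (auto intro!: cost_mono)
  show ?thesis
  proof (cases "L1 = 0 \<and> high \<inter> {c..e} = {}")
    case True
    then have "high \<inter> {c..d} = high \<inter> {e..d}" using hsplit by simp
    then show ?thesis
      unfolding pays_def using True L2(3) lo hi c1(2) by (intro exI[of _ "L1 + L2"]) (auto intro: order_trans)
  next
    case F1: False
    show ?thesis
    proof (cases "L2 = 0 \<and> high \<inter> {e..d} = {}")
      case True
      then have "high \<inter> {c..d} = high \<inter> {c..e}" using hsplit by simp
      then show ?thesis
        unfolding pays_def using True L1(3) lo hi c1(1) by (intro exI[of _ "L1 + L2"]) (auto intro: order_trans)
    next
      case F2: False
      have "0 \<le> L1" "0 \<le> L2"
        using L1(1) L2(1) measure_nonneg[of lborel "high \<inter> {c..e}"] measure_nonneg[of lborel "high \<inter> {e..d}"]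
        by linarith+
      moreover have "L1 + L2 \<le> 2" using hi superlevel_Int_le[of "{c<..<d}"] by simp
      ultimately have L: "0 \<le> L1" "0 \<le> L2" "L1 + L2 \<le> 2" by auto
      have "b (1 - (1 - L2) + (L1 - 1)) \<le> b (L1 - 1) + b (1 - L2)"
        using L by (intro b_triangle) auto
      moreover have "b (L1 - 1) = b (1 - L1)" using b_even[of "1 - L1"] L by simp
      moreover have "b (L1 + L2 - 1) = b (1 - (L1 + L2))" using b_even[of "1 - (L1 + L2)"] L by (simp add: algebra_simps)
      ultimately have "b (1 - (L1 + L2)) \<le> b (1 - L1) + b (1 - L2)" by (simp add: algebra_simps)
      then have "(t - s) * b (1 - (L1 + L2)) \<le> (t - s) * (b (1 - L1) + b (1 - L2))"
        using s_less_t by (intro mult_left_mono) auto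
      then have "ennreal ((t - s) * b (1 - (L1 + L2))) \<le> ennreal ((t - s) * b (1 - L1) + (t - s) * b (1 - L2))"
        by (intro ennreal_leI) (simp add: algebra_simps)
      also have "\<dots> = ennreal ((t - s) * b (1 - L1)) + ennreal ((t - s) * b (1 - L2))"
        using s_less_t L b_nonneg[of "1 - L1"] b_nonneg[of "1 - L2"] by (intro ennreal_plus mult_nonneg_nonneg) auto
      also have "\<dots> \<le> cost {c<..<e} + cost {e<..<d}"
        using F1 F2 L1(3) L2(3) by (intro add_mono) auto
      also have "\<dots> \<le> cost {c<..<d}" by (rule cost)
      finally show ?thesis unfolding pays_def using lo hi by (intro exI[of _ "L1 + L2"]) auto
    qed
  qed
qed

lemma cont': "continuous_on A u" using cont continuous_on_subset by blast

text \<open>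
  The triangle condition for the two end points \<open>y\<close>, \<open>z\<close> chosen on the flanks of the hump around \<open>k\<close>.
\<close>

lemma pays_hump:
  assumes "-1 \<le> p" "p \<le> k" "k \<le> q" "q \<le> 1" "u p \<le> s" "u q \<le> s" "t \<le> u k"
  obtains c e where "p \<le> c" "c < k" "k < e" "e \<le> q" "u c = s" "u e = s" "pays c e"
proof -
  obtain c d where cd: "p \<le> c" "c < d" "d \<le> k" "u c = s" "u d = t"
    "\<And>x. x \<in> {c<..k} \<Longrightarrow> s < u x" "\<And>x. x \<in> {c..<d} \<Longrightarrow> u x < t"
    using left_flank[OF cont' \<open>p \<le> k\<close> \<open>u p \<le> s\<close> s_less_t \<open>t \<le> u k\<close>] by metis
  obtain d' e where de: "k \<le> d'" "d' < e" "e \<le> q" "u d' = t" "u e = s"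
    "\<And>x. x \<in> {k..<e} \<Longrightarrow> s < u x" "\<And>x. x \<in> {d'<..e} \<Longrightarrow> u x < t"
    using right_flank[OF cont' \<open>k \<le> q\<close> \<open>u q \<le> s\<close> s_less_t \<open>t \<le> u k\<close>] by metis
  obtain y where y: "y \<in> {c..d}" "ennreal ((t - s) * b y) \<le> cost {c<..<d}"
    by (rule crossing_cost[of c d]) (use cd assms s_less_t in \<open>auto\<close>)
  obtain z where z: "z \<in> {d'..e}" "ennreal ((t - s) * b z) \<le> cost {d'<..<e}"
    by (rule crossing_cost[of d' e]) (use de assms s_less_t in \<open>auto\<close>)
  have yz: "-1 \<le> y" "y \<le> z" "z \<le> 1" using y z cd de assms by auto
  have "measure lborel (high \<inter> {c..e}) \<le> z - y"
  proof -
    have "high \<inter> {c..e} \<subseteq> {y..z}"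
    proof
      fix x assume x: "x \<in> high \<inter> {c..e}"
      then have "\<not> x \<in> {c..<d}" "\<not> x \<in> {d'<..e}" using cd(7)[of x] de(7)[of x] by (auto simp: high_def)
      then show "x \<in> {y..z}" using x y z by auto
    qed
    then have "measure lborel (high \<inter> {c..e}) \<le> measure lborel {y..z}"
      by (intro measure_mono_fmeasurable Icc_fmeasurable) auto
    then show ?thesis using yz by simp
  qed
  moreover have "z - y \<le> measure lborel (superlevel u s \<inter> {c<..<e})"
  proof -
    have "superlevel u s \<inter> {c<..<e} = {c<..<e}"
    proof -
      have "s < u x" if "x \<in> {c<..<e}" for x using cd(6)[of x] de(6)[of x] that by (cases "x \<le> k") auto
      then show ?thesis using cd de assms by (auto simp: superlevel_def)
    qed
    then show ?thesis using y z cd de by simp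
  qed
  moreover have "ennreal ((t - s) * b (1 - (z - y))) \<le> cost {c<..<e}"
  proof -
    have "b (1 - (z - y)) \<le> b y + b z" using b_triangle[OF yz] by (simp add: algebra_simps)
    then have "(t - s) * b (1 - (z - y)) \<le> (t - s) * (b y + b z)" using s_less_t by (intro mult_left_mono) auto
    then have "ennreal ((t - s) * b (1 - (z - y))) \<le> ennreal ((t - s) * b y + (t - s) * b z)"
      by (intro ennreal_leI) (simp add: algebra_simps)
    also have "\<dots> = ennreal ((t - s) * b y) + ennreal ((t - s) * b z)"
      using s_less_t yz b_nonneg[of y] b_nonneg[of z] by (intro ennreal_plus mult_nonneg_nonneg) auto
    also have "\<dots> \<le> cost {c<..<d} + cost {d'<..<e}" using y z by (intro add_mono)
    also have "\<dots> = cost ({c<..<d} \<union> {d'<..<e})" using cd de by (intro cost_Un) auto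
    also have "\<dots> \<le> cost {c<..<e}" using cd de by (intro cost_mono) auto
    finally show ?thesis .
  qed
  ultimately have "pays c e" unfolding pays_def by blast
  then show thesis using cd de by (intro that[of c e]) auto
qed

text \<open>
  A hump that reaches the left end of \<open>[-1,1]\<close> has one flank only. It is enough, because the interval
  \<open>[-1, z]\<close> has length \<open>z + 1\<close> and \<open>b (1 - (z + 1)) = b (- z) = b z\<close>.
\<close>

lemma pays_left_end:
  assumes q: "q \<in> {-1..1}" "u q \<le> s" and above: "\<And>x. x \<in> {-1..<q} \<Longrightarrow> s < u x"
  shows "pays (-1) q"
proof (cases "high \<inter> {-1..q} = {}")
  case True
  then show ?thesis by (rule pays_trivial)
next
  case False
  then obtain k where "k \<in> high \<inter> {-1..q}" by blast
  then have k: "k \<in> {-1..q}" "t \<le> u k" by (auto simp: high_def)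
  obtain d e where de: "k \<le> d" "d < e" "e \<le> q" "u d = t" "u e = s"
    "\<And>x. x \<in> {k..<e} \<Longrightarrow> s < u x" "\<And>x. x \<in> {d<..e} \<Longrightarrow> u x < t"
    using right_flank[OF cont' _ \<open>u q \<le> s\<close> s_less_t \<open>t \<le> u k\<close>] k by auto
  have "e = q"
  proof (rule ccontr)
    assume "e \<noteq> q"
    then have "e \<in> {-1..<q}" using de k by auto
    from above[OF this] show False using de(5) by simp
  qed
  obtain z where z: "z \<in> {d..e}" "ennreal ((t - s) * b z) \<le> cost {d<..<e}"
    by (rule crossing_cost[of d e]) (use de k q s_less_t in \<open>auto\<close>)
  have "measure lborel (high \<inter> {-1..q}) \<le> z + 1"
  proof -
    have "high \<inter> {-1..q} \<subseteq> {-1..z}"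
    proof
      fix x assume x: "x \<in> high \<inter> {-1..q}"
      then have "\<not> x \<in> {d<..e}" using de(7)[of x] by (auto simp: high_def)
      then show "x \<in> {-1..z}" using x z \<open>e = q\<close> by auto
    qed
    then have "measure lborel (high \<inter> {-1..q}) \<le> measure lborel {-1..z}"
      by (intro measure_mono_fmeasurable Icc_fmeasurable) auto
    then show ?thesis using z k de by simp
  qed
  moreover have "z + 1 \<le> measure lborel (superlevel u s \<inter> {-1<..<q})"
  proof -
    have "superlevel u s \<inter> {-1<..<q} = {-1<..<q}" using above q by (auto simp: superlevel_def)
    then show ?thesis using z \<open>e = q\<close> q by simp
  qed
  moreover have "ennreal ((t - s) * b (1 - (z + 1))) \<le> cost {-1<..<q}"
  proof -
    have "b (1 - (z + 1)) = b z" using b_even[of z] z k de q by simp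
    then have "ennreal ((t - s) * b (1 - (z + 1))) \<le> cost {d<..<e}" using z(2) by simp
    also have "\<dots> \<le> cost {-1<..<q}" using de k by (intro cost_mono) auto
    finally show ?thesis .
  qed
  ultimately show ?thesis unfolding pays_def by blast
qed

lemma pays_right_end:
  assumes p: "p \<in> {-1..1}" "u p \<le> s" and above: "\<And>x. x \<in> {p<..1} \<Longrightarrow> s < u x"
  shows "pays p 1"
proof (cases "high \<inter> {p..1} = {}")
  case True
  then show ?thesis by (rule pays_trivial)
next
  case False
  then obtain k where "k \<in> high \<inter> {p..1}" by blast
  then have k: "k \<in> {p..1}" "t \<le> u k" by (auto simp: high_def)
  obtain c d where cd: "p \<le> c" "c < d" "d \<le> k" "u c = s" "u d = t"
    "\<And>x. x \<in> {c<..k} \<Longrightarrow> s < u x" "\<And>x. x \<in> {c..<d} \<Longrightarrow> u x < t"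
    using left_flank[OF cont' _ \<open>u p \<le> s\<close> s_less_t \<open>t \<le> u k\<close>] k by auto
  have "c = p"
  proof (rule ccontr)
    assume "c \<noteq> p"
    then have "c \<in> {p<..1}" using cd k by auto
    from above[OF this] show False using cd(4) by simp
  qed
  obtain y where y: "y \<in> {c..d}" "ennreal ((t - s) * b y) \<le> cost {c<..<d}"
    by (rule crossing_cost[of c d]) (use cd k p s_less_t in \<open>auto\<close>)
  have "measure lborel (high \<inter> {p..1}) \<le> 1 - y"
  proof -
    have "high \<inter> {p..1} \<subseteq> {y..1}"
    proof
      fix x assume x: "x \<in> high \<inter> {p..1}"
      then have "\<not> x \<in> {c..<d}" using cd(7)[of x] by (auto simp: high_def)
      then show "x \<in> {y..1}" using x y \<open>c = p\<close> by auto
    qed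
    then have "measure lborel (high \<inter> {p..1}) \<le> measure lborel {y..1}"
      by (intro measure_mono_fmeasurable Icc_fmeasurable) auto
    then show ?thesis using y k cd by simp
  qed
  moreover have "1 - y \<le> measure lborel (superlevel u s \<inter> {p<..<1})"
  proof -
    have "superlevel u s \<inter> {p<..<1} = {p<..<1}" using above p by (auto simp: superlevel_def)
    then show ?thesis using y \<open>c = p\<close> p by simp
  qed
  moreover have "ennreal ((t - s) * b (1 - (1 - y))) \<le> cost {p<..<1}"
  proof -
    have "ennreal ((t - s) * b (1 - (1 - y))) \<le> cost {c<..<d}" using y(2) by simp
    also have "\<dots> \<le> cost {p<..<1}" using cd k by (intro cost_mono) auto
    finally show ?thesis .
  qed
  ultimately show ?thesis unfolding pays_def by blast
qed

text \<open>
  By uniform continuity a hump from \<open>s\<close> up to \<open>t\<close> has at least a fixed width \<open>\<delta>\<close>. Cutting it out leaves two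
  shorter intervals, so induction on the length in units of \<open>\<delta>\<close> applies.
\<close>

lemma pays_between_low_points:
  assumes "-1 \<le> p" "p \<le> q" "q \<le> 1" "u p \<le> s" "u q \<le> s"
  shows "pays p q"
proof -
  \<comment> \<open>A rise from \<open>s\<close> to \<open>t\<close> takes a distance of at least \<open>\<delta>\<close>.\<close>
  have "uniformly_continuous_on {-1..1} u" by (intro compact_uniformly_continuous cont') auto
  then obtain \<delta> where \<delta>: "\<delta> > 0" "\<And>x y. x \<in> {-1..1} \<Longrightarrow> y \<in> {-1..1} \<Longrightarrow> dist y x < \<delta> \<Longrightarrow> dist (u y) (u x) < t - s"
    unfolding uniformly_continuous_on_def using s_less_t by (metis diff_gt_0_iff_gt)
  have "pays p q" if "-1 \<le> p" "p \<le> q" "q \<le> 1" "u p \<le> s" "u q \<le> s" "q - p < real n * \<delta>" for n p q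
    using that
  proof (induction n arbitrary: p q)
    case 0
    then show ?case by simp
  next
    case (Suc n)
    show ?case
    proof (cases "high \<inter> {p..q} = {}")
      case True
      then show ?thesis by (rule pays_trivial)
    next
      case False
      then obtain k where "k \<in> high \<inter> {p..q}" by blast
      then have k: "k \<in> {p..q}" "t \<le> u k" by (auto simp: high_def)
      obtain c e where ce: "p \<le> c" "c < k" "k < e" "e \<le> q" "u c = s" "u e = s" "pays c e"
        using pays_hump[of p k q] k Suc.prems by auto
      have "\<delta> \<le> k - c"
      proof (rule ccontr)
        assume "\<not> \<delta> \<le> k - c"
        then have "dist (u k) (u c) < t - s" using ce k Suc.prems by (intro \<delta>(2)) (auto simp: dist_real_def)
        then show False using ce(5) k(2) by (auto simp: dist_real_def)
      qed
      then have len: "c - p < real n * \<delta>" "q - e < real n * \<delta>"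
        using ce Suc.prems(6) by (auto simp: algebra_simps)
      have "pays p c" using Suc.IH[of p c] Suc.prems ce len by auto
      moreover have "pays e q" using Suc.IH[of e q] Suc.prems ce len by auto
      ultimately show ?thesis using ce pays_join[of p c e] pays_join[of p e q] by auto
    qed
  qed
  moreover obtain n :: nat where "(q - p) / \<delta> < n" using reals_Archimedean2 by blast
  then have "q - p < real n * \<delta>" using \<delta>(1) by (simp add: field_simps)
  ultimately show ?thesis using assms by blast
qed

text \<open>
  The point \<open>1 - L\<close> obtained for the whole interval lies between \<open>edge u s\<close> and \<open>edge u t\<close>, where \<open>b\<close>
  is at least \<open>\<beta>\<close>.
\<close>

theorem slab_lower_bound:
  assumes y0: "y0 \<in> {-1..1}" "u y0 \<le> s" and k0: "k0 \<in> {-1..1}" "t \<le> u k0"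
    and \<beta>: "\<And>y. edge u s \<le> y \<Longrightarrow> y \<le> edge u t \<Longrightarrow> \<beta> \<le> b y"
  shows "ennreal ((t - s) * \<beta>) \<le> (\<integral>\<^sup>+x\<in>{x \<in> {-1..1}. s < u x \<and> u x \<le> t}. ennreal (b x * \<bar>du x\<bar>) \<partial>lborel)"
proof -
  let ?L = "{x \<in> {-1..1}. u x \<le> s}"
  have "closed ?L" by (intro continuous_on_closed_Collect_le cont' continuous_on_const) auto
  moreover have "bounded ?L" by (rule bounded_subset[OF compact_imp_bounded[OF compact_Icc, of "-1" 1]]) auto
  ultimately have comp: "compact ?L" by (simp add: compact_eq_bounded_closed)
  have ne: "?L \<noteq> {}" using y0 by auto
  obtain p where p: "p \<in> ?L" "\<And>y. y \<in> ?L \<Longrightarrow> p \<le> y" using compact_attains_inf[OF comp ne] by blast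
  obtain q where q: "q \<in> ?L" "\<And>y. y \<in> ?L \<Longrightarrow> y \<le> q" using compact_attains_sup[OF comp ne] by blast
  have "p \<le> q" using p q by blast
  have "pays (-1) p"
  proof (rule pays_left_end)
    show "s < u x" if "x \<in> {-1..<p}" for x using p(2)[of x] p(1) that by force
  qed (use p in auto)
  moreover have "pays p q" using p(1) q(1) \<open>p \<le> q\<close> by (intro pays_between_low_points) auto
  moreover have "pays q 1"
  proof (rule pays_right_end)
    show "s < u x" if "x \<in> {q<..1}" for x using q(2)[of x] q(1) that by force
  qed (use q in auto)
  ultimately have "pays (-1) 1"
    using pays_join[of "-1" p q] pays_join[of "-1" q 1] p(1) q(1) \<open>p \<le> q\<close> by auto
  then obtain L where L: "measure lborel (high \<inter> {-1..1}) \<le> L" "L \<le> measure lborel (superlevel u s \<inter> {-1<..<1})"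
    "L = 0 \<and> high \<inter> {-1..1} = {} \<or> ennreal ((t - s) * b (1 - L)) \<le> cost {-1<..<1}"
    unfolding pays_def by blast
  have "k0 \<in> high \<inter> {-1..1}" using k0 by (auto simp: high_def)
  then have c: "ennreal ((t - s) * b (1 - L)) \<le> cost {-1<..<1}" using L(3) by auto
  have "measure lborel (superlevel u t) \<le> measure lborel (high \<inter> {-1..1})"
    by (intro measure_mono_fmeasurable subset_Icc_fmeasurable) (auto simp: superlevel_def high_def)
  then have "1 - L \<le> edge u t" using L(1) by (simp add: edge_def)
  moreover have "measure lborel (superlevel u s \<inter> {-1<..<1}) \<le> measure lborel (superlevel u s)"
    by (intro measure_mono_fmeasurable superlevel_fmeasurable) auto
  then have "edge u s \<le> 1 - L" using L(2) by (simp add: edge_def)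
  ultimately have "\<beta> \<le> b (1 - L)" by (intro \<beta>)
  then have "ennreal ((t - s) * \<beta>) \<le> ennreal ((t - s) * b (1 - L))"
    using s_less_t by (intro ennreal_leI mult_left_mono) auto
  also note c
  also have "cost {-1<..<1} \<le> (\<integral>\<^sup>+x\<in>{x \<in> {-1..1}. s < u x \<and> u x \<le> t}. ennreal (b x * \<bar>du x\<bar>) \<partial>lborel)"
    unfolding cost_def by (intro nn_integral_mono) (auto simp: indicator_def)
  finally show ?thesis .
qed

end

section \<open>Comparison of the weighted level measures\<close>

definition dyadic_cell :: "nat \<Rightarrow> int \<Rightarrow> real set" where
  "dyadic_cell n k = {(of_int k - 1) / 2 ^ n<..of_int k / 2 ^ n}"

lemma dyadic_cell_mem: "x \<in> dyadic_cell n k \<longleftrightarrow> k = \<lceil>x * 2 ^ n\<rceil>"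
  unfolding dyadic_cell_def by (auto simp: field_simps ceiling_eq_iff intro!: ceiling_unique[symmetric]) linarith+

lemma dyadic_cell_refine:
  fixes x :: real
  shows "dyadic_cell (Suc n) \<lceil>x * 2 ^ Suc n\<rceil> \<subseteq> dyadic_cell n \<lceil>x * 2 ^ n\<rceil>"
proof -
  define y where "y = x * 2 ^ n"
  have eq: "x * 2 ^ Suc n = 2 * y" by (simp add: y_def)
  have "2 * of_int \<lceil>y\<rceil> - 1 \<le> (of_int \<lceil>2 * y\<rceil> :: real)" "(of_int \<lceil>2 * y\<rceil> :: real) \<le> 2 * of_int \<lceil>y\<rceil>"
  proof -
    have "\<lceil>2 * y\<rceil> \<le> 2 * \<lceil>y\<rceil>" by (simp add: ceiling_le_iff)
    moreover have "2 * \<lceil>y\<rceil> - 1 \<le> \<lceil>2 * y\<rceil>" by linarith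
    ultimately show "2 * of_int \<lceil>y\<rceil> - 1 \<le> (of_int \<lceil>2 * y\<rceil> :: real)" "(of_int \<lceil>2 * y\<rceil> :: real) \<le> 2 * of_int \<lceil>y\<rceil>"
      by linarith+
  qed
  then show ?thesis
    unfolding eq y_def[symmetric] dyadic_cell_def by (auto simp: field_simps)
qed

text \<open>
  An open set is the increasing union of the unions of those dyadic cells of size \<open>2^-n\<close> that it contains, so
  the inequality passes from short intervals to open sets. Outer regularity of the finite measure \<open>Q\<close>
  extends it to Borel sets.
\<close>

lemma emeasure_le_of_short_intervals:
  fixes P Q :: "real measure"
  assumes [measurable_cong, simp]: "sets P = sets borel" "sets Q = sets borel"
    and fin: "emeasure Q UNIV \<noteq> \<infinity>" and "\<eta> > 0"
    and short: "\<And>s t. s < t \<Longrightarrow> t - s \<le> \<eta> \<Longrightarrow> emeasure P {s<..t} \<le> emeasure Q {s<..t}"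
    and B: "B \<in> sets borel"
  shows "emeasure P B \<le> emeasure Q B"
proof -
  have "emeasure P U \<le> emeasure Q U" if "open U" for U
  proof -
    obtain n0 where n0: "(1/2::real) ^ n0 < \<eta>" using real_arch_pow_inv[of \<eta> "1/2"] \<open>\<eta> > 0\<close> by auto
    define K where "K n = {k. dyadic_cell n k \<subseteq> U}" for n
    define V where "V n = (\<Union>k\<in>K (n + n0). dyadic_cell (n + n0) k)" for n
    have Vm [measurable]: "V n \<in> sets borel" for n
      unfolding V_def by (intro sets.countable_UN') (auto simp: dyadic_cell_def)
    have VI: "x \<in> V n \<longleftrightarrow> dyadic_cell (n + n0) \<lceil>x * 2 ^ (n + n0)\<rceil> \<subseteq> U" for x n
      unfolding V_def K_def by (auto simp: dyadic_cell_mem)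
    have inc: "incseq V"
    proof (rule incseq_SucI, rule subsetI)
      fix n x assume "x \<in> V n"
      then show "x \<in> V (Suc n)" unfolding VI using dyadic_cell_refine[of "n + n0" x] by auto
    qed
    have UV: "(\<Union>n. V n) = U"
    proof (intro equalityI subsetI)
      fix x assume "x \<in> (\<Union>n. V n)"
      then obtain n where "dyadic_cell (n + n0) \<lceil>x * 2 ^ (n + n0)\<rceil> \<subseteq> U" by (auto simp: VI)
      moreover have "x \<in> dyadic_cell (n + n0) \<lceil>x * 2 ^ (n + n0)\<rceil>" by (simp add: dyadic_cell_mem)
      ultimately show "x \<in> U" by blast
    next
      fix x assume "x \<in> U"
      then obtain e where e: "e > 0" "ball x e \<subseteq> U" using \<open>open U\<close> open_contains_ball by blast
      obtain n where n: "(1/2::real) ^ n < e" using real_arch_pow_inv[of e "1/2"] \<open>e > 0\<close> by auto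
      have "(1/2::real) ^ (n + n0) \<le> (1/2) ^ n" by (rule power_decreasing) auto
      with n have "1 / 2 ^ (n + n0) < e" by (simp add: power_one_over)
      have "dyadic_cell (n + n0) \<lceil>x * 2 ^ (n + n0)\<rceil> \<subseteq> ball x e"
      proof
        fix y assume y: "y \<in> dyadic_cell (n + n0) \<lceil>x * 2 ^ (n + n0)\<rceil>"
        define c where "c = (of_int \<lceil>x * 2 ^ (n + n0)\<rceil> :: real) / 2 ^ (n + n0)"
        have "x \<in> dyadic_cell (n + n0) \<lceil>x * 2 ^ (n + n0)\<rceil>" by (simp add: dyadic_cell_mem)
        with y have "c - 1 / 2 ^ (n + n0) < x" "x \<le> c" "c - 1 / 2 ^ (n + n0) < y" "y \<le> c"
          by (auto simp: dyadic_cell_def c_def diff_divide_distrib)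
        with \<open>1 / 2 ^ (n + n0) < e\<close> show "y \<in> ball x e" unfolding mem_ball dist_real_def by linarith
      qed
      then have "x \<in> V n" using e unfolding VI by blast
      then show "x \<in> (\<Union>n. V n)" by blast
    qed
    have PQ: "emeasure P (V n) \<le> emeasure Q (V n)" for n
    proof -
      have disj: "disjoint_family_on (dyadic_cell (n + n0)) (K (n + n0))"
        unfolding disjoint_family_on_def by (auto simp: dyadic_cell_mem)
      have cnt: "countable (K (n + n0))" by simp
      have "emeasure P (V n) = (\<integral>\<^sup>+k. emeasure P (dyadic_cell (n + n0) k) \<partial>count_space (K (n + n0)))"
        unfolding V_def by (rule emeasure_UN_countable[OF _ cnt disj]) (auto simp: dyadic_cell_def)
      also have "\<dots> \<le> (\<integral>\<^sup>+k. emeasure Q (dyadic_cell (n + n0) k) \<partial>count_space (K (n + n0)))"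
      proof (rule nn_integral_mono)
        fix k
        have "(1/2::real) ^ (n + n0) \<le> (1/2) ^ n0" by (rule power_decreasing) auto
        with n0 have "1 / 2 ^ (n + n0) \<le> \<eta>" by (simp add: power_one_over)
        then show "emeasure P (dyadic_cell (n + n0) k) \<le> emeasure Q (dyadic_cell (n + n0) k)"
          unfolding dyadic_cell_def by (intro short) (auto simp: divide_strict_right_mono diff_divide_distrib)
      qed
      also have "\<dots> = emeasure Q (V n)"
        unfolding V_def by (rule emeasure_UN_countable[symmetric, OF _ cnt disj]) (auto simp: dyadic_cell_def)
      finally show ?thesis .
    qed
    have "emeasure P U = (SUP n. emeasure P (V n))"
      unfolding UV[symmetric] by (rule SUP_emeasure_incseq[symmetric]) (use inc in auto)
    also have "\<dots> \<le> (SUP n. emeasure Q (V n))" by (rule SUP_mono') (rule PQ)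
    also have "\<dots> = emeasure Q U"
      unfolding UV[symmetric] by (rule SUP_emeasure_incseq) (use inc in auto)
    finally show ?thesis .
  qed
  then have "emeasure P B \<le> emeasure Q U" if "B \<subseteq> U" "open U" for U
    using emeasure_mono[of B U P] that by (auto intro: order_trans)
  moreover have "space Q = UNIV" using sets_eq_imp_space_eq[of Q borel] by simp
  then have "emeasure Q B = (INF U \<in> {U. B \<subseteq> U \<and> open U}. emeasure Q U)"
    using fin B by (intro outer_regular) auto
  ultimately show ?thesis by (auto intro: INF_greatest)
qed

text \<open>
  A modulus of continuity with a linear term instead of a threshold. Error terms \<open>C * dist p q\<close> can be
  summed over many slabs, since the distances that occur are themselves increments of monotone
  functions.
\<close>

lemma modulus_with_slope:
  fixes f :: "'a::metric_space \<Rightarrow> real"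
  assumes "continuous_on K f" "compact K" "\<epsilon> > 0"
  obtains C where "C \<ge> 0" "\<And>p q. p \<in> K \<Longrightarrow> q \<in> K \<Longrightarrow> \<bar>f p - f q\<bar> \<le> \<epsilon> + C * dist p q"
proof -
  have "uniformly_continuous_on K f" using assms by (intro compact_uniformly_continuous)
  then obtain \<delta> where \<delta>: "\<delta> > 0" "\<And>p q. p \<in> K \<Longrightarrow> q \<in> K \<Longrightarrow> dist q p < \<delta> \<Longrightarrow> dist (f q) (f p) < \<epsilon>"
    unfolding uniformly_continuous_on_def using \<open>\<epsilon> > 0\<close> by metis
  have "bounded (f ` K)" using assms by (intro compact_imp_bounded compact_continuous_image)
  then obtain A where A: "\<And>p. p \<in> K \<Longrightarrow> \<bar>f p\<bar> \<le> A" by (auto simp: bounded_iff)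
  define C where "C = 2 * \<bar>A\<bar> / \<delta>"
  show thesis
  proof (rule that[of C])
    show "C \<ge> 0" using \<delta>(1) by (simp add: C_def)
    fix p q assume pq: "p \<in> K" "q \<in> K"
    show "\<bar>f p - f q\<bar> \<le> \<epsilon> + C * dist p q"
    proof (cases "dist p q < \<delta>")
      case True
      have "0 \<le> C * dist p q" using \<open>C \<ge> 0\<close> by simp
      then show ?thesis using \<delta>(2)[OF pq(2,1) True] unfolding dist_real_def by linarith
    next
      case False
      have "\<bar>f p - f q\<bar> \<le> 2 * \<bar>A\<bar>" using A[OF pq(1)] A[OF pq(2)] by linarith
      also have "\<dots> = C * \<delta>" using \<delta>(1) by (simp add: C_def)
      also have "\<dots> \<le> C * dist p q" using False \<open>C \<ge> 0\<close> by (intro mult_left_mono) auto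
      finally show ?thesis using \<open>\<epsilon> > 0\<close> by linarith
    qed
  qed
qed

definition clamp1 :: "real \<Rightarrow> real" where "clamp1 x = max (-1) (min 1 x)"

lemma clamp1_in: "clamp1 x \<in> {-1..1}" by (auto simp: clamp1_def)

lemma clamp1_id: "x \<in> {-1..1} \<Longrightarrow> clamp1 x = x" by (auto simp: clamp1_def)

lemma clamp1_mono: "x \<le> y \<Longrightarrow> clamp1 x \<le> clamp1 y" by (auto simp: clamp1_def)

lemma clamp1_continuous: "continuous_on A clamp1"
  unfolding clamp1_def by (intro continuous_intros)

text \<open>
  The functions \<open>du\<close> and \<open>D\<close> are Borel representatives of the derivatives of \<open>u\<close> and of its
  rearrangement, and the weight satisfies the two conditions of the theorem.
\<close>

locale weighted_rearrangement = nonneg_profile u for u :: "real \<Rightarrow> real" +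
  fixes du D :: "real \<Rightarrow> real" and a :: "real \<Rightarrow> real \<Rightarrow> real"
  assumes ac: "absolutely_continuous_on {-1..1} u"
    and du_borel [measurable]: "du \<in> borel_measurable borel"
    and du: "AE x in lborel. x \<in> {-1<..<1} \<longrightarrow> (u has_real_derivative du x) (at x)"
    and D_borel [measurable]: "D \<in> borel_measurable borel"
    and D_nonneg: "\<And>x. 0 \<le> D x"
    and D: "AE x in lborel. x \<in> {-1<..<1} \<longrightarrow> (rearr u has_real_derivative D x) (at x)"
    and a_cont: "continuous_on UNIV (\<lambda>(x, v). a x v)"
    and a_nonneg: "\<And>x v. 0 \<le> a x v"
    and a_triangle: "\<And>s t v. -1 \<le> s \<Longrightarrow> s \<le> t \<Longrightarrow> t \<le> 1 \<Longrightarrow> a (1 - t + s) v \<le> a s v + a t v"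
    and a_even: "\<And>x v. x \<in> {-1..1} \<Longrightarrow> a (- x) v = a x v"
begin

definition g :: "real \<Rightarrow> real" where "g x = rearr u (clamp1 x)"

lemma g_eq: "x \<in> {-1..1} \<Longrightarrow> g x = rearr u x"
  by (simp add: g_def clamp1_id)

lemma g_mono: "x \<le> y \<Longrightarrow> g x \<le> g y"
  unfolding g_def by (intro rearr_mono clamp1_in clamp1_mono)

lemma g_borel [measurable]: "g \<in> borel_measurable borel"
  using g_mono by (intro borel_measurable_mono) (auto simp: mono_def)

lemma g_continuous: "continuous_on {-1..1} g"
  using absolutely_continuous_on_imp_continuous_on[OF rearr_absolutely_continuous[OF ac]]
  by (rule continuous_on_eq) (simp add: g_eq)

lemma a_borel [measurable]:
  assumes [measurable]: "f \<in> borel_measurable M" "h \<in> borel_measurable M"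
  shows "(\<lambda>x. a (f x) (h x)) \<in> borel_measurable M"
proof -
  have "(\<lambda>p. case p of (x, v) \<Rightarrow> a x v) \<in> borel_measurable (borel \<Otimes>\<^sub>M borel)"
    unfolding borel_prod using a_cont by (rule borel_measurable_continuous_onI)
  from measurable_compose[OF measurable_Pair[OF assms] this] show ?thesis by simp
qed

lemma total_variation_finite: "(\<integral>\<^sup>+x\<in>{-1..1}. ennreal \<bar>du x\<bar> \<partial>lborel) < \<infinity>"
  by (rule nn_integral_ac_derivative_finite[OF ac du_borel du])

lemma nn_integral_D:
  assumes "-1 \<le> l" "l \<le> r" "r \<le> 1"
  shows "(\<integral>\<^sup>+x\<in>{l..r}. ennreal (D x) \<partial>lborel) = ennreal (g r - g l)"
  using nn_integral_nonneg_ac_derivative[OF rearr_absolutely_continuous[OF ac] D_borel D, of l r] assms D_nonneg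
  by (simp add: g_eq)

lemma weighted_slabI:
  assumes "b \<in> borel_measurable borel" "continuous_on {-1..1} b" "\<And>x. x \<in> {-1..1} \<Longrightarrow> 0 \<le> b x"
    "\<And>x. x \<in> {-1..1} \<Longrightarrow> b (- x) = b x"
    "\<And>x y. -1 \<le> x \<Longrightarrow> x \<le> y \<Longrightarrow> y \<le> 1 \<Longrightarrow> b (1 - y + x) \<le> b x + b y" "s < t"
  shows "weighted_slab u du b s t"
proof unfold_locales
  show "ennreal \<bar>u d - u c\<bar> \<le> (\<integral>\<^sup>+x\<in>{c<..<d}. ennreal \<bar>du x\<bar> \<partial>lborel)"
    if "c \<le> d" "{c..d} \<subseteq> {-1..1}" for c d
    using increment_le_nn_integral_ac_derivative[OF ac du_borel du, of c d] that by auto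
qed (use assms in auto)

text \<open>
  On a thin slab the rearrangement runs through positions in \<open>[edge u s, edge u t]\<close>, over which \<open>g\<close> climbs by
  at most \<open>h\<close>, the height of the slab after cutting it down to the range of \<open>u\<close>. With \<open>\<beta>\<close> the minimum of the frozen weight over these positions, the left side
  is at most \<open>h (\<beta> + \<epsilon> + C (\<Delta> + h))\<close>, where \<open>\<Delta> = edge u t - edge u s\<close>, and \<open>h \<beta>\<close> is controlled by
  \<open>slab_lower_bound\<close>. The errors are absorbed as follows: those proportional to \<open>h\<close> by the bound \<open>h \<le> \<integral> |u'|\<close>
  over the slab (the same lemma for the weight 1), and the one proportional to \<open>\<Delta>\<close> by the measure of the
  slab, which is \<open>\<Delta>\<close>. This explains the two terms with \<open>\<epsilon>\<close> on the right: both are integrals over the slab,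
  so they stay finite when slabs are added up.
\<close>

lemma slab_comparison:
  assumes "\<epsilon> > 0"
  obtains \<eta> where "\<eta> > 0" "\<And>s t. s < t \<Longrightarrow> t - s \<le> \<eta> \<Longrightarrow>
    (\<integral>\<^sup>+x\<in>{x \<in> {-1..1}. s < g x \<and> g x \<le> t}. ennreal (a x (g x) * D x) \<partial>lborel)
    \<le> (\<integral>\<^sup>+x\<in>{x \<in> {-1..1}. s < u x \<and> u x \<le> t}. ennreal ((a x (u x) + 4 * \<epsilon>) * \<bar>du x\<bar> + \<epsilon>) \<partial>lborel)"
proof -
  have cu: "compact (u ` {-1..1})" by (intro compact_continuous_image continuous_on_subset[OF cont]) auto
  obtain yM where yM: "yM \<in> {-1..1}" "\<And>y. y \<in> {-1..1} \<Longrightarrow> u y \<le> u yM"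
    using compact_attains_sup[OF cu] by auto
  obtain ym where ym: "ym \<in> {-1..1}" "\<And>y. y \<in> {-1..1} \<Longrightarrow> u ym \<le> u y"
    using compact_attains_inf[OF cu] by auto
  define m M where "m = u ym" and "M = u yM"
  have g_bounds: "m \<le> g x" "g x \<le> M" for x
    unfolding g_def m_def M_def
    by (rule rearr_ge_bound[OF ym(2) clamp1_in]) (assumption, rule rearr_le_bound[OF yM(2) clamp1_in])
  obtain C where C: "C \<ge> 0" "\<And>p q. p \<in> {-1..1} \<times> {m..M} \<Longrightarrow> q \<in> {-1..1} \<times> {m..M} \<Longrightarrow>
      \<bar>(\<lambda>(x, v). a x v) p - (\<lambda>(x, v). a x v) q\<bar> \<le> \<epsilon> + C * dist p q"
    using modulus_with_slope[of "{-1..1} \<times> {m..M}" "\<lambda>(x, v). a x v" \<epsilon>] \<open>\<epsilon> > 0\<close> continuous_on_subset[OF a_cont]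
    by (metis compact_Icc compact_Times subset_UNIV)
  have mod: "a x v \<le> a y w + \<epsilon> + C * (\<bar>x - y\<bar> + \<bar>v - w\<bar>)"
    if "x \<in> {-1..1}" "y \<in> {-1..1}" "v \<in> {m..M}" "w \<in> {m..M}" for x y v w
  proof -
    have "dist (x, v) (y, w) \<le> \<bar>x - y\<bar> + \<bar>v - w\<bar>"
      using sqrt_sum_squares_le_sum_abs[of "x - y" "v - w"] by (simp add: dist_prod_def dist_real_def)
    then have "C * dist (x, v) (y, w) \<le> C * (\<bar>x - y\<bar> + \<bar>v - w\<bar>)" using C(1) by (rule mult_left_mono)
    moreover have "\<bar>a x v - a y w\<bar> \<le> \<epsilon> + C * dist (x, v) (y, w)"
      using C(2)[of "(x, v)" "(y, w)"] that by auto
    ultimately show ?thesis by linarith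
  qed
  \<comment> \<open>With this choice \<open>C * h \<le> \<epsilon>\<close> for every slab height \<open>h \<le> \<eta>\<close>.\<close>
  define \<eta> where "\<eta> = \<epsilon> / (C + 1)"
  have \<eta>: "\<eta> > 0" "C * \<eta> \<le> \<epsilon>" using C(1) \<open>\<epsilon> > 0\<close> by (auto simp: \<eta>_def field_simps)
  show thesis
  proof (rule that[OF \<eta>(1)])
    fix s t :: real assume st: "s < t" "t - s \<le> \<eta>"
    define W where "W = {x \<in> {-1..1}. s < g x \<and> g x \<le> t}"
    define J where "J = {x \<in> {-1..1}. s < u x \<and> u x \<le> t}"
    have Jm [measurable]: "J \<in> sets borel" and Wm [measurable]: "W \<in> sets borel"
      unfolding J_def W_def by measurable
    show "(\<integral>\<^sup>+x\<in>W. ennreal (a x (g x) * D x) \<partial>lborel)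
      \<le> (\<integral>\<^sup>+x\<in>J. ennreal ((a x (u x) + 4 * \<epsilon>) * \<bar>du x\<bar> + \<epsilon>) \<partial>lborel)"
    proof (cases "W = {}")
      case True
      then show ?thesis by simp
    next
      case False
      \<comment> \<open>Levels outside the range of \<open>u\<close> are cut off, because \<open>slab_lower_bound\<close> needs both levels to be attained.\<close>
      define s' t' where "s' = max s m" and "t' = min t M"
      define h where "h = t' - s'"
      have W_range: "g x \<in> {s'..t'}" if "x \<in> W" for x
        using that g_bounds[of x] by (auto simp: W_def s'_def t'_def)
      then have h0: "0 \<le> h" using False by (force simp: h_def)
      have hst: "h \<le> \<eta>" using st by (auto simp: h_def s'_def t'_def)
      have mM: "s' \<in> {m..M}" "t' \<in> {m..M}" using h0 g_bounds by (auto simp: h_def s'_def t'_def intro: order_trans)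
      define \<Delta> where "\<Delta> = edge u t - edge u s"
      have \<Delta>0: "0 \<le> \<Delta>" using edge_mono[of s t] st by (simp add: \<Delta>_def)
      have s'b: "continuous_on A (\<lambda>x. a x s')" for A
        using continuous_on_compose2[OF a_cont, of A "\<lambda>x. (x, s')"]
        by (simp add: continuous_on_Pair continuous_on_id continuous_on_const)
      have "{edge u s..edge u t} \<noteq> {}" using \<Delta>0 by (simp add: \<Delta>_def)
      then obtain y0 where y0: "y0 \<in> {edge u s..edge u t}" "\<And>y. y \<in> {edge u s..edge u t} \<Longrightarrow> a y0 s' \<le> a y s'"
        using continuous_attains_inf[OF compact_Icc _ s'b] by blast
      define \<beta> where "\<beta> = a y0 s'"
      have \<beta>0: "0 \<le> \<beta>" by (simp add: \<beta>_def a_nonneg)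
      have y0S: "y0 \<in> {-1..1}" using y0(1) edge_bounds[of s] edge_bounds[of t] by auto
      \<comment> \<open>The slab of the rearrangement need not be closed, but it lies in a compact interval \<open>{l..r}\<close> on which \<open>g\<close>
        stays within the same levels.\<close>
      have D_le: "(\<integral>\<^sup>+x\<in>W. ennreal (D x) \<partial>lborel) \<le> ennreal h"
      proof -
        let ?W = "{-1..1} \<inter> g -` {s..t}"
        have "closed ?W" by (intro continuous_closed_preimage g_continuous) auto
        moreover have "bounded ?W" by (rule bounded_subset[OF compact_imp_bounded[OF compact_Icc, of "-1" 1]]) auto
        ultimately have comp: "compact ?W" by (simp add: compact_eq_bounded_closed)
        have WW: "W \<subseteq> ?W" by (auto simp: W_def)
        with False have ne: "?W \<noteq> {}" by blast
        obtain l where l: "l \<in> ?W" "\<And>y. y \<in> ?W \<Longrightarrow> l \<le> y" using compact_attains_inf[OF comp ne] by blast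
        obtain r where r: "r \<in> ?W" "\<And>y. y \<in> ?W \<Longrightarrow> y \<le> r" using compact_attains_sup[OF comp ne] by blast
        have "l \<le> r" using l r by blast
        have "W \<subseteq> {l..r}"
        proof
          fix x assume "x \<in> W"
          then have "x \<in> ?W" using WW by blast
          then show "x \<in> {l..r}" using l(2)[of x] r(2)[of x] by simp
        qed
        then have "(\<integral>\<^sup>+x\<in>W. ennreal (D x) \<partial>lborel) \<le> (\<integral>\<^sup>+x\<in>{l..r}. ennreal (D x) \<partial>lborel)"
          by (rule nn_set_integral_set_mono)
        also have "\<dots> = ennreal (g r - g l)" using l r \<open>l \<le> r\<close> by (intro nn_integral_D) auto
        also have "\<dots> \<le> ennreal h"
          using l(1) r(1) g_bounds[of l] g_bounds[of r] by (intro ennreal_leI) (auto simp: h_def s'_def t'_def)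
        finally show ?thesis .
      qed
      define K where "K = \<beta> + \<epsilon> + C * (\<Delta> + h)"
      let ?A = "\<lambda>x. ennreal (a x (u x) * \<bar>du x\<bar>)"
      have K0: "0 \<le> K" using \<beta>0 \<open>\<epsilon> > 0\<close> C(1) \<Delta>0 h0 by (simp add: K_def)
      have aK: "a x (g x) \<le> K" if "x \<in> W" for x
      proof -
        have xS: "x \<in> {-1..1}" "s < rearr u x" "rearr u x \<le> t" using that g_eq[of x] by (auto simp: W_def)
        have "edge u s \<le> x" "x \<le> edge u t"
          using edge_le_of_less_rearr[OF xS(1,2)] le_edge_of_rearr_le[OF xS(1,3)] by auto
        then have 1: "\<bar>x - y0\<bar> \<le> \<Delta>" using y0(1) by (auto simp: \<Delta>_def)
        have 2: "\<bar>g x - s'\<bar> \<le> h" using W_range[OF that] by (auto simp: h_def)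
        have "a x (g x) \<le> a y0 s' + \<epsilon> + C * (\<bar>x - y0\<bar> + \<bar>g x - s'\<bar>)"
          using xS(1) y0S g_bounds mM by (intro mod) auto
        also have "C * (\<bar>x - y0\<bar> + \<bar>g x - s'\<bar>) \<le> C * (\<Delta> + h)" using 1 2 C(1) by (intro mult_left_mono) auto
        finally show ?thesis by (simp add: K_def \<beta>_def)
      qed
      have Kh: "K * h \<le> h * \<beta> + 2 * \<epsilon> * h + \<epsilon> * \<Delta>"
      proof -
        have Ch: "C * h \<le> \<epsilon>" using mult_left_mono[OF hst C(1)] \<eta>(2) by simp
        have "K * h = h * \<beta> + \<epsilon> * h + (C * h) * \<Delta> + (C * h) * h" by (simp add: K_def algebra_simps)
        also have "\<dots> \<le> h * \<beta> + \<epsilon> * h + \<epsilon> * \<Delta> + \<epsilon> * h"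
          using Ch \<Delta>0 h0 by (intro add_mono mult_right_mono order_refl) auto
        finally show ?thesis by simp
      qed
      have "(\<integral>\<^sup>+x\<in>W. ennreal (a x (g x) * D x) \<partial>lborel) \<le> (\<integral>\<^sup>+x. ennreal K * (ennreal (D x) * indicator W x) \<partial>lborel)"
      proof (intro nn_integral_mono)
        fix x show "ennreal (a x (g x) * D x) * indicator W x \<le> ennreal K * (ennreal (D x) * indicator W x)"
          using aK[of x] D_nonneg[of x] K0
          by (auto simp: indicator_def ennreal_mult[symmetric] intro!: ennreal_leI mult_right_mono)
      qed
      also have "\<dots> = ennreal K * (\<integral>\<^sup>+x\<in>W. ennreal (D x) \<partial>lborel)"
        by (rule nn_integral_cmult) auto
      also have "\<dots> \<le> ennreal K * ennreal h" using D_le by (intro mult_left_mono) auto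
      also have "\<dots> = ennreal (K * h)" using K0 h0 by (simp add: ennreal_mult)
      also have "\<dots> \<le> ennreal (h * \<beta> + 2 * \<epsilon> * h + \<epsilon> * \<Delta>)"
        using Kh by (rule ennreal_leI)
      also have "ennreal (h * \<beta> + 2 * \<epsilon> * h + \<epsilon> * \<Delta>) = ennreal (h * \<beta>) + ennreal (2 * \<epsilon>) * ennreal h + ennreal \<epsilon> * ennreal \<Delta>"
        using h0 \<beta>0 \<Delta>0 \<open>\<epsilon> > 0\<close> by (simp add: ennreal_mult)
      finally have upper: "(\<integral>\<^sup>+x\<in>W. ennreal (a x (g x) * D x) \<partial>lborel)
        \<le> ennreal (h * \<beta>) + ennreal (2 * \<epsilon>) * ennreal h + ennreal \<epsilon> * ennreal \<Delta>" .
      define I0 where "I0 = (\<integral>\<^sup>+x\<in>J. ennreal \<bar>du x\<bar> \<partial>lborel)"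
      define I1 where "I1 = (\<integral>\<^sup>+x\<in>J. ?A x \<partial>lborel)"
      define J' where "J' = {x \<in> {-1..1}. s' < u x \<and> u x \<le> t'}"
      have J'J: "J' \<subseteq> J" by (auto simp: J'_def J_def s'_def t'_def)
      have low: "ym \<in> {-1..1}" "u ym \<le> s'" and high: "yM \<in> {-1..1}" "t' \<le> u yM"
        using ym yM by (auto simp: s'_def t'_def m_def M_def)
      have h_le: "ennreal h \<le> I0"
      proof (cases "s' < t'")
        case True
        interpret one: weighted_slab u du "\<lambda>_. 1" s' t' by (rule weighted_slabI) (use True in auto)
        have "ennreal ((t' - s') * 1) \<le> (\<integral>\<^sup>+x\<in>J'. ennreal (1 * \<bar>du x\<bar>) \<partial>lborel)"
          unfolding J'_def by (rule one.slab_lower_bound[OF low high]) auto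
        also have "\<dots> \<le> I0"
          unfolding I0_def using J'J by (intro nn_integral_mono) (auto simp: indicator_def)
        finally show ?thesis by (simp add: h_def)
      qed (auto simp: h_def ennreal_neg)
      have h\<beta>_le: "ennreal (h * \<beta>) \<le> I1 + ennreal (2 * \<epsilon>) * I0"
      proof (cases "s' < t'")
        case True
        interpret w: weighted_slab u du "\<lambda>x. a x s'" s' t'
        proof (rule weighted_slabI)
          show "continuous_on {-1..1} (\<lambda>x. a x s')" by (rule s'b)
        qed (use True a_nonneg a_even a_triangle in auto)
        have "ennreal ((t' - s') * \<beta>) \<le> (\<integral>\<^sup>+x\<in>J'. ennreal (a x s' * \<bar>du x\<bar>) \<partial>lborel)"
          unfolding J'_def
        proof (rule w.slab_lower_bound[OF low high])
          show "\<beta> \<le> a y s'" if "edge u s' \<le> y" "y \<le> edge u t'" for y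
          proof -
            have "edge u s \<le> edge u s'" "edge u t' \<le> edge u t"
              by (auto intro!: edge_mono simp: s'_def t'_def)
            then show ?thesis unfolding \<beta>_def using that by (intro y0(2)) auto
          qed
        qed
        also have "\<dots> \<le> (\<integral>\<^sup>+x. ?A x * indicator J x + ennreal (2 * \<epsilon>) * (ennreal \<bar>du x\<bar> * indicator J x) \<partial>lborel)"
        proof (intro nn_integral_mono)
          fix x
          show "ennreal (a x s' * \<bar>du x\<bar>) * indicator J' x \<le>
            ?A x * indicator J x + ennreal (2 * \<epsilon>) * (ennreal \<bar>du x\<bar> * indicator J x)"
          proof (cases "x \<in> J'")
            case True
            then have xJ: "x \<in> J" using J'J by auto
            have x: "x \<in> {-1..1}" "u x \<in> {s'..t'}" using True by (auto simp: J'_def)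
            have "a x s' \<le> a x (u x) + \<epsilon> + C * (\<bar>x - x\<bar> + \<bar>s' - u x\<bar>)"
              using x mM by (intro mod) auto
            also have "C * (\<bar>x - x\<bar> + \<bar>s' - u x\<bar>) \<le> C * \<eta>"
              using C(1) x hst by (intro mult_left_mono) (auto simp: h_def)
            also note \<eta>(2)
            finally have "a x s' * \<bar>du x\<bar> \<le> (a x (u x) + 2 * \<epsilon>) * \<bar>du x\<bar>"
              by (intro mult_right_mono) auto
            then have "ennreal (a x s' * \<bar>du x\<bar>) \<le> ennreal (a x (u x) * \<bar>du x\<bar> + 2 * \<epsilon> * \<bar>du x\<bar>)"
              by (intro ennreal_leI) (simp add: algebra_simps)
            also have "\<dots> = ?A x + ennreal (2 * \<epsilon>) * ennreal \<bar>du x\<bar>"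
              using \<open>\<epsilon> > 0\<close> a_nonneg[of x "u x"] by (simp add: ennreal_mult)
            finally show ?thesis using True xJ by (simp add: indicator_def)
          qed simp
        qed
        also have "\<dots> = I1 + ennreal (2 * \<epsilon>) * I0"
          unfolding I0_def I1_def
          by (subst nn_integral_add) (auto simp: nn_integral_cmult)
        finally show ?thesis by (simp add: h_def)
      next
        case False
        then have "h = 0" using h0 by (simp add: h_def)
        then show ?thesis by simp
      qed
      have \<Delta>_eq: "ennreal \<Delta> = emeasure lborel J"
      proof -
        have "J = superlevel u s - superlevel u t" by (auto simp: J_def superlevel_def)
        then have "measure lborel J = measure lborel (superlevel u s) - measure lborel (superlevel u t)"
          using superlevel_fmeasurable superlevel_antimono[of s t] st
          by (simp add: measurable_measure_Diff fmeasurableD)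
        then have "measure lborel J = \<Delta>" by (simp add: \<Delta>_def edge_def)
        moreover have "J \<in> fmeasurable lborel"
        proof (rule fmeasurableI2[OF Icc_fmeasurable[of "-1" 1]])
          show "J \<subseteq> {-1..1}" by (auto simp: J_def)
        qed simp
        ultimately show ?thesis by (simp add: emeasure_eq_measure2)
      qed
      have "(\<integral>\<^sup>+x\<in>J. ennreal ((a x (u x) + 4 * \<epsilon>) * \<bar>du x\<bar> + \<epsilon>) \<partial>lborel)
        = (\<integral>\<^sup>+x. (?A x * indicator J x + ennreal (4 * \<epsilon>) * (ennreal \<bar>du x\<bar> * indicator J x))
            + ennreal \<epsilon> * indicator J x \<partial>lborel)"
      proof (intro nn_integral_cong)
        fix x
        have "ennreal ((a x (u x) + 4 * \<epsilon>) * \<bar>du x\<bar> + \<epsilon>) = ennreal (a x (u x) * \<bar>du x\<bar> + 4 * \<epsilon> * \<bar>du x\<bar> + \<epsilon>)"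
          by (simp add: algebra_simps)
        also have "\<dots> = ?A x + ennreal (4 * \<epsilon>) * ennreal \<bar>du x\<bar> + ennreal \<epsilon>"
          using \<open>\<epsilon> > 0\<close> a_nonneg[of x "u x"] by (simp add: ennreal_mult)
        finally show "ennreal ((a x (u x) + 4 * \<epsilon>) * \<bar>du x\<bar> + \<epsilon>) * indicator J x
          = (?A x * indicator J x + ennreal (4 * \<epsilon>) * (ennreal \<bar>du x\<bar> * indicator J x))
            + ennreal \<epsilon> * indicator J x"
          by (auto simp: indicator_def)
      qed
      also have "\<dots> = (I1 + ennreal (4 * \<epsilon>) * I0) + ennreal \<epsilon> * emeasure lborel J"
        unfolding I0_def I1_def
        by (subst nn_integral_add, simp, simp, subst nn_integral_add, simp, simp) (simp add: nn_integral_cmult)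
      also have "ennreal (4 * \<epsilon>) = ennreal (2 * \<epsilon>) + ennreal (2 * \<epsilon>)"
        using \<open>\<epsilon> > 0\<close> by (simp add: ennreal_plus[symmetric] del: ennreal_plus)
      finally have total: "(\<integral>\<^sup>+x\<in>J. ennreal ((a x (u x) + 4 * \<epsilon>) * \<bar>du x\<bar> + \<epsilon>) \<partial>lborel)
        = (I1 + ennreal (2 * \<epsilon>) * I0) + ennreal (2 * \<epsilon>) * I0 + ennreal \<epsilon> * emeasure lborel J"
        by (simp add: distrib_right add.assoc)
      note upper
      also have "ennreal (h * \<beta>) + ennreal (2 * \<epsilon>) * ennreal h + ennreal \<epsilon> * ennreal \<Delta>
        \<le> (I1 + ennreal (2 * \<epsilon>) * I0) + ennreal (2 * \<epsilon>) * I0 + ennreal \<epsilon> * emeasure lborel J"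
        using h\<beta>_le h_le unfolding \<Delta>_eq by (intro add_mono mult_left_mono order_refl) auto
      finally show ?thesis unfolding total .
    qed
  qed
qed

end

lemma emeasure_pushforward:
  fixes p :: "real \<Rightarrow> ennreal" and w :: "real \<Rightarrow> real"
  assumes [measurable]: "p \<in> borel_measurable borel" "w \<in> borel_measurable borel" "B \<in> sets borel"
  shows "emeasure (distr (density lborel p) borel w) B = (\<integral>\<^sup>+x. p x * indicator (w -` B) x \<partial>lborel)"
proof -
  have "w -` B \<in> sets borel" using measurable_sets[OF assms(2,3)] by simp
  then show ?thesis by (subst emeasure_distr) (auto simp: emeasure_density)
qed

lemma nn_integral_pushforward:
  fixes p f :: "real \<Rightarrow> ennreal" and w :: "real \<Rightarrow> real"
  assumes [measurable]: "p \<in> borel_measurable borel" "w \<in> borel_measurable borel" "f \<in> borel_measurable borel"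
  shows "(\<integral>\<^sup>+v. f v \<partial>distr (density lborel p) borel w) = (\<integral>\<^sup>+x. p x * f (w x) \<partial>lborel)"
  by (subst nn_integral_distr, simp, simp, subst nn_integral_density) auto

context weighted_rearrangement
begin

text \<open>
  For each \<open>\<epsilon>\<close> both sides of \<open>slab_comparison\<close> are values of measures on the axis of levels, the images of
  weighted Lebesgue measure under \<open>g\<close> and \<open>u\<close>. They are compared on all Borel sets, hence on all integrands,
  and then \<open>\<epsilon>\<close> tends to 0.
\<close>

lemma transport_comparison:
  assumes [measurable]: "h \<in> borel_measurable borel" and h: "\<And>v. 0 \<le> h v" "\<And>v. h v \<le> H"
  shows "(\<integral>\<^sup>+x\<in>{-1..1}. ennreal (h (g x) * (a x (g x) * D x)) \<partial>lborel)
    \<le> (\<integral>\<^sup>+x\<in>{-1..1}. ennreal (h (u x) * (a x (u x) * \<bar>du x\<bar>)) \<partial>lborel)"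
proof -
  define V where "V = (\<integral>\<^sup>+x\<in>{-1..1}. ennreal \<bar>du x\<bar> \<partial>lborel)"
  have V: "V < \<infinity>" unfolding V_def by (rule total_variation_finite)
  have H0: "0 \<le> H" using h[of 0] by linarith
  let ?G = "\<integral>\<^sup>+x\<in>{-1..1}. ennreal (h (g x) * (a x (g x) * D x)) \<partial>lborel"
  let ?U = "\<integral>\<^sup>+x\<in>{-1..1}. ennreal (h (u x) * (a x (u x) * \<bar>du x\<bar>)) \<partial>lborel"
  have approx: "?G
    \<le> ?U + ennreal \<epsilon> * (ennreal H * (4 * V + 2))"
    if "\<epsilon> > 0" for \<epsilon>
  proof -
    define p where "p x = ennreal (a x (g x) * D x) * indicator {-1..1} x" for x
    define r where "r x = ennreal ((a x (u x) + 4 * \<epsilon>) * \<bar>du x\<bar> + \<epsilon>) * indicator {-1..1} x" for x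
    have [measurable]: "p \<in> borel_measurable borel" "r \<in> borel_measurable borel"
      unfolding p_def r_def by measurable
    define P where "P = distr (density lborel p) borel g"
    define Q where "Q = distr (density lborel r) borel u"
    have sets: "sets P = sets borel" "sets Q = sets borel" by (simp_all add: P_def Q_def)
    have P_em: "emeasure P B = (\<integral>\<^sup>+x. p x * indicator (g -` B) x \<partial>lborel)" if [measurable]: "B \<in> sets borel" for B
      unfolding P_def by (rule emeasure_pushforward) auto
    have Q_em: "emeasure Q B = (\<integral>\<^sup>+x. r x * indicator (u -` B) x \<partial>lborel)" if [measurable]: "B \<in> sets borel" for B
      unfolding Q_def by (rule emeasure_pushforward) auto
    obtain A where A: "A \<ge> 0" "\<And>x. x \<in> {-1..1} \<Longrightarrow> a x (u x) \<le> A"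
    proof -
      have "continuous_on {-1..1} (\<lambda>x. a x (u x))"
        using continuous_on_compose2[OF a_cont, of "{-1..1}" "\<lambda>x. (x, u x)"] continuous_on_subset[OF cont, of "{-1..1}"]
        by (simp add: continuous_on_Pair continuous_on_id)
      then obtain z where "\<forall>x\<in>{-1..1}. a x (u x) \<le> a z (u z)"
        using continuous_attains_sup[of "{-1..1}" "\<lambda>x. a x (u x)"] by auto
      then show thesis using that[of "a z (u z)"] a_nonneg by auto
    qed
    have r_split: "(\<integral>\<^sup>+x. ennreal (c1 * \<bar>du x\<bar> + c2) * indicator {-1..1} x \<partial>lborel) = ennreal c1 * V + ennreal c2 * 2"
      if "0 \<le> c1" "0 \<le> c2" for c1 c2
    proof -
      have "(\<integral>\<^sup>+x. ennreal (c1 * \<bar>du x\<bar> + c2) * indicator {-1..1} x \<partial>lborel)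
        = (\<integral>\<^sup>+x. ennreal c1 * (ennreal \<bar>du x\<bar> * indicator {-1..1} x) + ennreal c2 * indicator {-1..1::real} x \<partial>lborel)"
        using that by (intro nn_integral_cong) (auto simp: indicator_def ennreal_mult)
      also have "\<dots> = ennreal c1 * V + ennreal c2 * emeasure lborel {-1..1::real}"
        unfolding V_def by (subst nn_integral_add) (auto simp: nn_integral_cmult)
      finally show ?thesis by simp
    qed
    have fin: "emeasure Q UNIV \<noteq> \<infinity>"
    proof -
      have "emeasure Q UNIV = (\<integral>\<^sup>+x. r x * indicator (u -` UNIV) x \<partial>lborel)" by (rule Q_em) simp
      also have "\<dots> \<le> (\<integral>\<^sup>+x. ennreal ((A + 4 * \<epsilon>) * \<bar>du x\<bar> + \<epsilon>) * indicator {-1..1} x \<partial>lborel)"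
      proof (intro nn_integral_mono)
        fix x
        show "r x * indicator (u -` UNIV) x \<le> ennreal ((A + 4 * \<epsilon>) * \<bar>du x\<bar> + \<epsilon>) * indicator {-1..1} x"
        proof (cases "x \<in> {-1..1}")
          case True
          then have "(a x (u x) + 4 * \<epsilon>) * \<bar>du x\<bar> + \<epsilon> \<le> (A + 4 * \<epsilon>) * \<bar>du x\<bar> + \<epsilon>"
            using A(2) by (intro add_right_mono mult_right_mono) auto
          then show ?thesis using True by (simp add: r_def ennreal_leI)
        qed (simp add: r_def)
      qed
      also have "\<dots> < \<infinity>"
        using V A(1) \<open>\<epsilon> > 0\<close> by (subst r_split) (auto simp: ennreal_mult_less_top)
      finally show ?thesis by auto
    qed
    obtain \<eta> where "\<eta> > 0" and short: "\<And>s t. s < t \<Longrightarrow> t - s \<le> \<eta> \<Longrightarrow> emeasure P {s<..t} \<le> emeasure Q {s<..t}"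
    proof (rule slab_comparison[OF \<open>\<epsilon> > 0\<close>])
      fix \<eta> :: real
      assume "\<eta> > 0" and le: "\<And>s t. s < t \<Longrightarrow> t - s \<le> \<eta> \<Longrightarrow>
        (\<integral>\<^sup>+x\<in>{x \<in> {-1..1}. s < g x \<and> g x \<le> t}. ennreal (a x (g x) * D x) \<partial>lborel)
        \<le> (\<integral>\<^sup>+x\<in>{x \<in> {-1..1}. s < u x \<and> u x \<le> t}. ennreal ((a x (u x) + 4 * \<epsilon>) * \<bar>du x\<bar> + \<epsilon>) \<partial>lborel)"
      show thesis
      proof (rule that[OF \<open>\<eta> > 0\<close>])
        fix s t :: real assume st: "s < t" "t - s \<le> \<eta>"
        have "emeasure P {s<..t} = (\<integral>\<^sup>+x. p x * indicator (g -` {s<..t}) x \<partial>lborel)" by (rule P_em) simp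
        also have "\<dots> = (\<integral>\<^sup>+x\<in>{x \<in> {-1..1}. s < g x \<and> g x \<le> t}. ennreal (a x (g x) * D x) \<partial>lborel)"
          by (intro nn_integral_cong) (simp add: p_def indicator_def)
        also note le[OF st]
        also have "(\<integral>\<^sup>+x\<in>{x \<in> {-1..1}. s < u x \<and> u x \<le> t}. ennreal ((a x (u x) + 4 * \<epsilon>) * \<bar>du x\<bar> + \<epsilon>) \<partial>lborel)
          = (\<integral>\<^sup>+x. r x * indicator (u -` {s<..t}) x \<partial>lborel)"
          by (intro nn_integral_cong) (simp add: r_def indicator_def)
        also have "\<dots> = emeasure Q {s<..t}" by (rule Q_em[symmetric]) simp
        finally show "emeasure P {s<..t} \<le> emeasure Q {s<..t}" .
      qed
    qed
    have PQ: "emeasure P B \<le> emeasure Q B" if "B \<in> sets borel" for B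
      by (rule emeasure_le_of_short_intervals[OF sets fin \<open>\<eta> > 0\<close> short that])
    have "emeasure P B \<le> emeasure Q B" for B
      by (cases "B \<in> sets borel") (auto simp: PQ emeasure_notin_sets sets)
    then have "P \<le> Q" using sets sets_eq_imp_space_eq[of P Q] by (simp add: le_measure_iff le_fun_def)
    have "?G = (\<integral>\<^sup>+v. ennreal (h v) \<partial>P)"
      unfolding P_def using h(1) a_nonneg D_nonneg
      by (subst nn_integral_pushforward) (auto simp: p_def ennreal_mult indicator_def mult.commute intro!: nn_integral_cong)
    also have "\<dots> \<le> (\<integral>\<^sup>+v. ennreal (h v) \<partial>Q)"
      using sets \<open>P \<le> Q\<close> by (intro nn_integral_mono_measure) auto
    also have "\<dots> = (\<integral>\<^sup>+x. ennreal (h (u x)) * r x \<partial>lborel)"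
      unfolding Q_def
      by (subst nn_integral_pushforward) (auto simp: mult.commute intro!: nn_integral_cong)
    also have "\<dots> \<le> (\<integral>\<^sup>+x. ennreal (h (u x) * (a x (u x) * \<bar>du x\<bar>)) * indicator {-1..1} x
        + ennreal (\<epsilon> * H) * (ennreal (4 * \<bar>du x\<bar> + 1) * indicator {-1..1} x) \<partial>lborel)"
    proof (intro nn_integral_mono)
      fix x
      have "h (u x) * ((a x (u x) + 4 * \<epsilon>) * \<bar>du x\<bar> + \<epsilon>) = h (u x) * (a x (u x) * \<bar>du x\<bar>) + \<epsilon> * h (u x) * (4 * \<bar>du x\<bar> + 1)"
        by (simp add: algebra_simps)
      also have "\<dots> \<le> h (u x) * (a x (u x) * \<bar>du x\<bar>) + \<epsilon> * H * (4 * \<bar>du x\<bar> + 1)"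
        using h \<open>\<epsilon> > 0\<close> by (intro add_left_mono mult_right_mono mult_left_mono) auto
      finally have "ennreal (h (u x) * ((a x (u x) + 4 * \<epsilon>) * \<bar>du x\<bar> + \<epsilon>))
        \<le> ennreal (h (u x) * (a x (u x) * \<bar>du x\<bar>) + \<epsilon> * H * (4 * \<bar>du x\<bar> + 1))"
        by (rule ennreal_leI)
      also have "\<dots> = ennreal (h (u x) * (a x (u x) * \<bar>du x\<bar>)) + ennreal (\<epsilon> * H) * ennreal (4 * \<bar>du x\<bar> + 1)"
        using h(1) a_nonneg[of x "u x"] \<open>\<epsilon> > 0\<close> H0 by (simp add: ennreal_mult del: ennreal_plus) (simp add: ennreal_mult[symmetric] ennreal_plus[symmetric] del: ennreal_plus)
      finally have "ennreal (h (u x)) * ennreal ((a x (u x) + 4 * \<epsilon>) * \<bar>du x\<bar> + \<epsilon>)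
        \<le> ennreal (h (u x) * (a x (u x) * \<bar>du x\<bar>)) + ennreal (\<epsilon> * H) * ennreal (4 * \<bar>du x\<bar> + 1)"
        using h(1) a_nonneg[of x "u x"] \<open>\<epsilon> > 0\<close> by (simp add: ennreal_mult)
      then show "ennreal (h (u x)) * r x \<le> ennreal (h (u x) * (a x (u x) * \<bar>du x\<bar>)) * indicator {-1..1} x
        + ennreal (\<epsilon> * H) * (ennreal (4 * \<bar>du x\<bar> + 1) * indicator {-1..1} x)"
        unfolding r_def by (simp add: indicator_def)
    qed
    also have "\<dots> = ?U
        + ennreal (\<epsilon> * H) * (\<integral>\<^sup>+x. ennreal (4 * \<bar>du x\<bar> + 1) * indicator {-1..1} x \<partial>lborel)"
      by (subst nn_integral_add, simp, simp) (simp add: nn_integral_cmult)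
    also have "(\<integral>\<^sup>+x. ennreal (4 * \<bar>du x\<bar> + 1) * indicator {-1..1} x \<partial>lborel) = 4 * V + 2"
      by (subst r_split) auto
    also have "ennreal (\<epsilon> * H) * (4 * V + 2) = ennreal \<epsilon> * (ennreal H * (4 * V + 2))"
      using \<open>\<epsilon> > 0\<close> H0 by (simp add: ennreal_mult mult.assoc)
    finally show ?thesis .
  qed
  obtain C where C: "ennreal H * (4 * V + 2) = ennreal C" "0 \<le> C"
  proof -
    have "ennreal H * (4 * V + 2) < top" using V by (auto simp: ennreal_mult_less_top)
    then show thesis using that[of "enn2real (ennreal H * (4 * V + 2))"] by auto
  qed
  show ?thesis
  proof (rule ennreal_le_epsilon)
    fix e :: real assume "e > 0"
    define \<epsilon> where "\<epsilon> = e / (C + 1)"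
    have \<epsilon>: "\<epsilon> > 0" "\<epsilon> * C \<le> e" using \<open>e > 0\<close> C(2) by (auto simp: \<epsilon>_def field_simps)
    have "ennreal \<epsilon> * (ennreal H * (4 * V + 2)) \<le> ennreal e"
      unfolding C(1) using \<epsilon> C(2) by (simp add: ennreal_mult[symmetric] ennreal_leI)
    with approx[OF \<epsilon>(1)] show "?G
      \<le> ?U + ennreal e"
      by (meson add_left_mono order_trans)
  qed
qed

lemma equimeasurable:
  assumes [measurable]: "f \<in> borel_measurable borel"
  shows "(\<integral>\<^sup>+x\<in>{-1..1}. f (g x) \<partial>lborel) = (\<integral>\<^sup>+x\<in>{-1..1}. f (u x) \<partial>lborel)"
proof -
  define P where "P w = distr (density lborel (indicator {-1..1})) borel w" for w :: "real \<Rightarrow> real"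
  have em: "emeasure (P w) B = emeasure lborel ({-1..1} \<inter> w -` B)"
    if [measurable]: "w \<in> borel_measurable borel" "B \<in> sets borel" for w B
  proof -
    have "emeasure (P w) B = (\<integral>\<^sup>+x. indicator {-1..1} x * indicator (w -` B) x \<partial>lborel)"
      unfolding P_def by (rule emeasure_pushforward) auto
    also have "\<dots> = (\<integral>\<^sup>+x. indicator ({-1..1} \<inter> w -` B) x \<partial>lborel)"
      by (intro nn_integral_cong) (auto simp: indicator_def)
    also have "\<dots> = emeasure lborel ({-1..1} \<inter> w -` B)"
    proof (rule nn_integral_indicator)
      have "w -` B \<in> sets borel" using measurable_sets[OF that] by simp
      then show "{-1..1} \<inter> w -` B \<in> sets lborel" by simp
    qed
    finally show ?thesis .
  qed
  have "P g = P u"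
  proof (rule measure_eqI_lessThan)
    show "sets (P g) = sets borel" "sets (P u) = sets borel" by (simp_all add: P_def)
    fix t
    have "emeasure (P g) {t<..} = emeasure lborel ({-1..1} \<inter> g -` {t<..})" by (rule em) auto
    also have "\<dots> \<le> emeasure lborel {-1..1::real}" by (rule emeasure_mono) auto
    also have "\<dots> < \<infinity>" by simp
    finally show "emeasure (P g) {t<..} < \<infinity>" .
    have e: "-1 \<le> edge u t" "edge u t \<le> 1" by (rule edge_bounds)+
    have "emeasure (P g) {t<..} = emeasure lborel ({-1..1} \<inter> g -` {t<..})" by (rule em) auto
    also have "\<dots> = emeasure lborel {edge u t..1}"
    proof (rule emeasure_eq_AE)
      have "AE x in lborel. x \<noteq> edge u t" by (rule AE_lborel_singleton)
      then show "AE x in lborel. x \<in> {-1..1} \<inter> g -` {t<..} \<longleftrightarrow> x \<in> {edge u t..1}"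
      proof eventually_elim
        case (elim x)
        have "edge u t \<le> x" if "x \<in> {-1..1}" "t < g x"
          using edge_le_of_less_rearr[OF that(1), of t] that g_eq by simp
        moreover have "t < g x" if "edge u t \<le> x" "x \<le> 1"
          using le_edge_of_rearr_le[of x t] that elim g_eq[of x] e by (cases "t < g x") auto
        ultimately show ?case using e by auto
      qed
      have "g -` {t<..} \<in> sets borel" using measurable_sets[OF g_borel, of "{t<..}"] by simp
      then show "{-1..1} \<inter> g -` {t<..} \<in> sets lborel" by simp
    qed simp
    also have "\<dots> = ennreal (measure lborel (superlevel u t))" using e by (simp add: edge_def)
    also have "\<dots> = emeasure lborel (superlevel u t)"
      using superlevel_fmeasurable by (simp add: emeasure_eq_measure2)
    also have "superlevel u t = {-1..1} \<inter> u -` {t<..}" by (auto simp: superlevel_def)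
    also have "emeasure lborel ({-1..1} \<inter> u -` {t<..}) = emeasure (P u) {t<..}" by (rule em[symmetric]) auto
    finally show "emeasure (P g) {t<..} = emeasure (P u) {t<..}" .
  qed
  moreover have "(\<integral>\<^sup>+v. f v \<partial>P w) = (\<integral>\<^sup>+x\<in>{-1..1}. f (w x) \<partial>lborel)"
    if [measurable]: "w \<in> borel_measurable borel" for w
    unfolding P_def
    by (subst nn_integral_pushforward) (auto simp: mult.commute)
  from this[OF g_borel] this[OF borel_u] calculation show ?thesis by simp
qed

end

section \<open>Supporting slopes of convex functions\<close>

text \<open>
  The right derivative of a convex function. As a limit along a sequence it depends measurably on
  parameters.
\<close>

definition right_slope :: "(real \<Rightarrow> real) \<Rightarrow> real \<Rightarrow> real" where
  "right_slope f q = lim (\<lambda>n. (f (q + 1 / real (Suc n)) - f q) * real (Suc n))"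

lemma convex_three_points:
  fixes f :: "real \<Rightarrow> real"
  assumes "convex_on {0..} f" "0 \<le> x" "x \<le> y" "y \<le> z" "x < z"
  shows "(z - x) * f y \<le> (z - y) * f x + (y - x) * f z"
proof -
  define t where "t = (y - x) / (z - x)"
  have t: "0 \<le> t" "t \<le> 1" "t * (z - x) = y - x" using assms by (auto simp: t_def)
  have y: "(1 - t) * x + t * z = y" using t(3) by (simp add: algebra_simps)
  have "f ((1 - t) *\<^sub>R x + t *\<^sub>R z) \<le> (1 - t) * f x + t * f z"
    using assms t by (intro convex_onD[OF assms(1)]) auto
  then have "f y \<le> (1 - t) * f x + t * f z" by (simp add: y)
  then have "(z - x) * f y \<le> (z - x) * ((1 - t) * f x + t * f z)" using assms by (intro mult_left_mono) auto
  also have "\<dots> = (z - x - t * (z - x)) * f x + (t * (z - x)) * f z" by (simp add: algebra_simps)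
  also have "\<dots> = (z - y) * f x + (y - x) * f z" unfolding t(3) by simp
  finally show ?thesis .
qed

text \<open>
  For a convex function the difference quotients to the right decrease to their limit; those to the
  left of \<open>q\<close> are smaller than all of them.
\<close>

lemma right_slope_supports:
  fixes f :: "real \<Rightarrow> real"
  assumes conv: "convex_on {0..} f" and mono: "mono_on {0..} f" and "0 \<le> q"
  shows "0 \<le> right_slope f q" "right_slope f q \<le> f (q + 1) - f q"
    "\<And>p. 0 \<le> p \<Longrightarrow> f q + right_slope f q * (p - q) \<le> f p"
proof -
  define d where "d n = (f (q + 1 / real (Suc n)) - f q) * real (Suc n)" for n
  have step: "(f (q + k) - f q) * m \<le> (f (q + h) - f q) * h'" if "0 < k" "k \<le> h" "k * m = 1" "h * h' = 1" "0 < h'" "0 < m" for k h m h'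
  proof -
    have "h * f (q + k) \<le> (h - k) * f q + k * f (q + h)"
      using convex_three_points[OF conv, of q "q + k" "q + h"] that \<open>0 \<le> q\<close> by (simp add: algebra_simps)
    then have "h * (f (q + k) - f q) \<le> k * (f (q + h) - f q)" by (simp add: algebra_simps)
    then have "(h' * m) * (h * (f (q + k) - f q)) \<le> (h' * m) * (k * (f (q + h) - f q))"
      using that by (intro mult_left_mono) auto
    moreover have "(h' * m) * (h * (f (q + k) - f q)) = (h * h') * ((f (q + k) - f q) * m)"
      "(h' * m) * (k * (f (q + h) - f q)) = (k * m) * ((f (q + h) - f q) * h')" by (simp_all add: algebra_simps)
    ultimately show ?thesis using that by simp
  qed
  have dec: "decseq d"
  proof (rule decseq_SucI)
    show "d (Suc n) \<le> d n" for n
      unfolding d_def by (rule step) (auto simp: field_simps)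
  qed
  have pos: "0 \<le> d n" for n
    unfolding d_def using mono_onD[OF mono, of q "q + 1 / real (Suc n)"] \<open>0 \<le> q\<close> by simp
  obtain L where L: "d \<longlonglongrightarrow> L" "\<And>n. L \<le> d n"
    using decseq_convergent[OF dec, of 0] pos by blast
  have RL: "right_slope f q = L"
    unfolding right_slope_def d_def[symmetric] using L(1) by (rule limI)
  show "0 \<le> right_slope f q" unfolding RL using L(1) pos by (intro LIMSEQ_le_const) auto
  show "right_slope f q \<le> f (q + 1) - f q" unfolding RL using L(2)[of 0] by (simp add: d_def)
  fix p :: real assume "0 \<le> p"
  consider "p = q" | "q < p" | "p < q" by linarith
  then show "f q + right_slope f q * (p - q) \<le> f p"
  proof cases
    case 2
    obtain n where n: "1 / real (Suc n) < p - q" using nat_approx_posE[of "p - q"] 2 by auto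
    have "L \<le> d n" by (rule L)
    also have "d n \<le> (f (q + (p - q)) - f q) * (1 / (p - q))"
      unfolding d_def by (rule step) (use n 2 in auto)
    finally have "L * (p - q) \<le> f p - f q" using 2 by (simp add: field_simps)
    then show ?thesis by (simp add: RL)
  next
    case 3
    have "(f q - f p) / (q - p) \<le> d n" for n
    proof -
      define k where "k = 1 / real (Suc n)"
      have k: "k > 0" "k * real (Suc n) = 1" by (auto simp: k_def)
      have "(q + k - p) * f q \<le> k * f p + (q - p) * f (q + k)"
        using convex_three_points[OF conv, of p q "q + k"] 3 k \<open>0 \<le> p\<close> by (simp add: algebra_simps)
      then have "k * (f q - f p) \<le> (q - p) * (f (q + k) - f q)" by (simp add: algebra_simps)
      then have "real (Suc n) * (k * (f q - f p)) \<le> real (Suc n) * ((q - p) * (f (q + k) - f q))"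
        by (intro mult_left_mono) auto
      moreover have "real (Suc n) * (k * (f q - f p)) = f q - f p"
        using k(2) by (metis mult.assoc mult.commute mult_1)
      ultimately have "f q - f p \<le> (q - p) * d n" by (simp only: d_def k_def mult.assoc mult.commute mult.left_commute)
      then show ?thesis using 3 by (simp add: divide_le_eq mult.commute)
    qed
    then have "(f q - f p) / (q - p) \<le> L" using L(1) by (intro LIMSEQ_le_const) auto
    then show ?thesis using 3 by (simp add: RL field_simps)
  qed simp
qed

section \<open>Comparison of the energies\<close>

text \<open>
  A Borel version of the derivative. Taking it from the left makes it vanish at the right end of every flat
  piece, which is where the level of that piece is passed.
\<close>

definition left_derivative :: "(real \<Rightarrow> real) \<Rightarrow> real \<Rightarrow> real" where
  "left_derivative f x = lim (\<lambda>n. (f x - f (x - 1 / real (Suc n))) * real (Suc n))"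

lemma left_derivative_borel [measurable]:
  assumes [measurable]: "f \<in> borel_measurable borel"
  shows "left_derivative f \<in> borel_measurable borel"
  unfolding left_derivative_def by measurable

lemma left_derivative_eq:
  assumes "(f has_real_derivative d) (at x)"
  shows "left_derivative f x = d"
  unfolding left_derivative_def
proof (rule limI)
  have "filterlim (\<lambda>n. x - 1 / real (Suc n)) (at x) sequentially"
    unfolding filterlim_at
  proof
    show "(\<lambda>n. x - 1 / real (Suc n)) \<longlonglongrightarrow> x"
      using tendsto_diff[OF tendsto_const LIMSEQ_inverse_real_of_nat, of x] by (simp add: inverse_eq_divide)
  qed (auto intro!: always_eventually)
  then have "(\<lambda>n. (f (x - 1 / real (Suc n)) - f x) / (x - 1 / real (Suc n) - x)) \<longlonglongrightarrow> d"
    using assms unfolding has_field_derivative_iff by (rule filterlim_compose[rotated])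
  moreover have "(f (x - 1 / real (Suc n)) - f x) / (x - 1 / real (Suc n) - x) = (f x - f (x - 1 / real (Suc n))) * real (Suc n)" for n
    by (simp add: field_simps)
  ultimately show "(\<lambda>n. (f x - f (x - 1 / real (Suc n))) * real (Suc n)) \<longlonglongrightarrow> d" by simp
qed

lemma left_derivative_flat:
  assumes "y < x" "\<And>z. z \<in> {y..x} \<Longrightarrow> f z = f x"
  shows "left_derivative f x = 0"
  unfolding left_derivative_def
proof (rule limI, rule tendsto_eventually)
  obtain n0 where n0: "1 / real (Suc n0) < x - y" using nat_approx_posE[of "x - y"] assms(1) by auto
  show "eventually (\<lambda>n. (f x - f (x - 1 / real (Suc n))) * real (Suc n) = 0) sequentially"
    unfolding eventually_sequentially
  proof (intro exI[of _ n0] allI impI)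
    fix n assume "n0 \<le> n"
    then have "1 / real (Suc n) \<le> 1 / real (Suc n0)" by (simp add: field_simps)
    moreover have "0 \<le> 1 / real (Suc n)" by simp
    ultimately have "x - 1 / real (Suc n) \<in> {y..x}" using n0 by auto
    from assms(2)[OF this] show "(f x - f (x - 1 / real (Suc n))) * real (Suc n) = 0" by simp
  qed
qed

locale energy_comparison = weighted_rearrangement u du D a for u du D :: "real \<Rightarrow> real" and a :: "real \<Rightarrow> real \<Rightarrow> real" +
  fixes F :: "real \<Rightarrow> real \<Rightarrow> real"
  assumes D_flat: "\<And>x y. y < x \<Longrightarrow> (\<And>z. z \<in> {y..x} \<Longrightarrow> rearr u (clamp1 z) = rearr u (clamp1 x)) \<Longrightarrow> D x = 0"
    and F_cont: "continuous_on UNIV (\<lambda>(v, p). F v p)"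
    and F_nonneg: "\<And>v p. 0 \<le> F v p"
    and F_convex: "\<And>v. convex_on {0..} (F v)"
    and F_mono: "\<And>v. mono_on {0..} (F v)"
begin

lemma F_borel [measurable]:
  assumes [measurable]: "f \<in> borel_measurable M" "h \<in> borel_measurable M"
  shows "(\<lambda>x. F (f x) (h x)) \<in> borel_measurable M"
proof -
  have "(\<lambda>p. case p of (v, p) \<Rightarrow> F v p) \<in> borel_measurable (borel \<Otimes>\<^sub>M borel)"
    unfolding borel_prod using F_cont by (rule borel_measurable_continuous_onI)
  from measurable_compose[OF measurable_Pair[OF assms] this] show ?thesis by simp
qed

text \<open>
  The quantity \<open>a(x, g) g'\<close> as a function of the level \<open>v = g x\<close>.
\<close>

definition level_slope :: "real \<Rightarrow> real" where
  "level_slope v = a (edge u v) v * D (edge u v)"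

lemma level_slope_nonneg: "0 \<le> level_slope v"
  by (simp add: level_slope_def a_nonneg D_nonneg)

lemma level_slope_borel [measurable]: "level_slope \<in> borel_measurable borel"
  unfolding level_slope_def by measurable

lemma AE_interior: "AE x in lborel. x \<in> {-1..1::real} \<longrightarrow> x \<in> {-1<..<1}"
proof -
  have "AE x in lborel. x \<noteq> -1 \<and> x \<noteq> (1::real)" by (intro AE_conjI AE_lborel_singleton)
  then show ?thesis by eventually_elim auto
qed

text \<open>
  If \<open>edge u (g x)\<close> differs from \<open>x\<close>, then \<open>g\<close> is constant from \<open>x\<close> to that point, and both sides vanish:
  the right side because \<open>g' = 0\<close> at \<open>x\<close>, the left side because \<open>D\<close> vanishes at the right end of a flat piece.
\<close>

lemma level_slope_g:
  assumes x: "x \<in> {-1<..<1}" and der: "(rearr u has_real_derivative D x) (at x)"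
  shows "level_slope (g x) = a x (g x) * D x"
proof (cases "edge u (g x) = x")
  case True
  then show ?thesis by (simp add: level_slope_def)
next
  case False
  define x' where "x' = edge u (g x)"
  have xS: "x \<in> {-1..1}" using x by auto
  have "x \<le> x'" unfolding x'_def using le_edge_of_rearr_le[OF xS] g_eq[OF xS] by simp
  then have "x < x'" using False by (simp add: x'_def)
  have "x' \<le> 1" unfolding x'_def by (rule edge_bounds)
  have flat: "g z = g x" if "z \<in> {x..<x'}" for z
  proof (rule antisym)
    have zS: "z \<in> {-1..1}" using that x \<open>x' \<le> 1\<close> by auto
    show "g z \<le> g x"
      using edge_le_of_less_rearr[OF zS, of "g x"] that g_eq[OF zS] by (cases "g x < g z") (auto simp: x'_def)
    show "g x \<le> g z" using that by (intro g_mono) auto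
  qed
  have "g x' = g x"
  proof -
    have "(g \<longlongrightarrow> g x') (at x' within {x..x'})"
    proof (rule tendsto_within_subset)
      show "(g \<longlongrightarrow> g x') (at x' within {-1..1})"
        using g_continuous x \<open>x < x'\<close> \<open>x' \<le> 1\<close> by (auto simp: continuous_on_def)
    qed (use x \<open>x' \<le> 1\<close> in auto)
    then have lim: "(g \<longlongrightarrow> g x') (at_left x')"
      using at_within_Icc_at_left[OF \<open>x < x'\<close>] by simp
    have "eventually (\<lambda>z. z \<in> {x<..<x'}) (at_left x')"
      using \<open>x < x'\<close> by (rule eventually_at_left_real)
    then have "eventually (\<lambda>z. g z = g x) (at_left x')"
      by eventually_elim (rule flat, simp)
    then have "(g \<longlongrightarrow> g x) (at_left x')" by (rule tendsto_eventually)
    with tendsto_unique[OF trivial_limit_at_left_real lim] show ?thesis by simp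
  qed
  then have "g z = g x'" if "z \<in> {x..x'}" for z using flat[of z] that by (cases "z = x'") auto
  then have "D x' = 0" unfolding g_def by (rule D_flat[OF \<open>x < x'\<close>])
  moreover have "D x = 0"
  proof -
    have lim: "((\<lambda>y. (rearr u y - rearr u x) / (y - x)) \<longlongrightarrow> D x) (at_right x)"
      using der unfolding has_field_derivative_iff by (rule tendsto_mono[rotated]) (simp add: at_le)
    have "eventually (\<lambda>y. (rearr u y - rearr u x) / (y - x) = 0) (at_right x)"
    proof -
      have "eventually (\<lambda>y. y \<in> {x<..<x'}) (at_right x)" using \<open>x < x'\<close> by (rule eventually_at_right_real)
      then show ?thesis
      proof eventually_elim
        case (elim y)
        then have "y \<in> {-1..1}" using x \<open>x' \<le> 1\<close> by auto
        then have "rearr u y = rearr u x" using flat[of y] elim g_eq[of y] g_eq[OF xS] by auto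
        then show ?case by simp
      qed
    qed
    then have "((\<lambda>y. (rearr u y - rearr u x) / (y - x)) \<longlongrightarrow> 0) (at_right x)" by (rule tendsto_eventually)
    with tendsto_unique[OF trivial_limit_at_right_real lim] show ?thesis by simp
  qed
  ultimately show ?thesis by (simp add: level_slope_def x'_def)
qed

lemma AE_level_slope_g: "AE x in lborel. x \<in> {-1..1} \<longrightarrow> level_slope (g x) = a x (g x) * D x"
  using D AE_interior by eventually_elim (auto intro: level_slope_g)

text \<open>
  Replacing large values by 0, rather than by \<open>n\<close>, keeps \<open>trunc_slope n v\<close> either equal to the true slope or
  trivial; in both cases it is at most the true slope and increases with \<open>n\<close>.
\<close>

definition trunc_slope :: "nat \<Rightarrow> real \<Rightarrow> real" where
  "trunc_slope n v = (if level_slope v \<le> real n then level_slope v else 0)"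

lemma trunc_slope_bounds: "0 \<le> trunc_slope n v" "trunc_slope n v \<le> real n" "trunc_slope n v \<le> level_slope v"
  using level_slope_nonneg by (auto simp: trunc_slope_def)

lemma trunc_slope_borel [measurable]: "trunc_slope n \<in> borel_measurable borel"
  unfolding trunc_slope_def by measurable

definition support_slope :: "nat \<Rightarrow> real \<Rightarrow> real" where
  "support_slope n v = right_slope (F v) (trunc_slope n v)"

lemma support_slope_borel [measurable]: "support_slope n \<in> borel_measurable borel"
  unfolding support_slope_def right_slope_def by measurable

lemma support_slope_supports:
  "0 \<le> support_slope n v" "support_slope n v \<le> F v (trunc_slope n v + 1) - F v (trunc_slope n v)"
  "0 \<le> p \<Longrightarrow> F v (trunc_slope n v) + support_slope n v * (p - trunc_slope n v) \<le> F v p"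
  unfolding support_slope_def by (rule right_slope_supports[OF F_convex F_mono trunc_slope_bounds(1)]; assumption?)+

text \<open>
  The supporting line of \<open>F v\<close> at \<open>trunc_slope n v\<close> with slope \<open>c = support_slope n\<close> gives, with \<open>q\<close> for the
  truncated slope, \<open>F(u, a|u'|) + c q \<ge> F(u, q) + c a|u'|\<close>, written without subtraction because all terms are integrated in
  \<open>[0,\<infinity>]\<close>. The integral \<open>K\<close> of \<open>c q\<close> is finite and at most that of \<open>c a|u'|\<close>, so it cancels.
\<close>

lemma truncated_energy:
  "(\<integral>\<^sup>+x\<in>{-1..1}. ennreal (F (g x) (trunc_slope n (g x))) \<partial>lborel)
    \<le> (\<integral>\<^sup>+x\<in>{-1..1}. ennreal (F (u x) (a x (u x) * \<bar>du x\<bar>)) \<partial>lborel)"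
proof -
  obtain M where M: "\<And>y. y \<in> {-1..1} \<Longrightarrow> u y \<le> M" using u_bounded by metis
  have uM: "u x \<in> {0..M}" if "x \<in> {-1..1}" for x using M[OF that] nonneg[of x] by simp
  have gM: "g x \<in> {0..M}" for x
    unfolding g_def using rearr_le_bound[OF M clamp1_in] rearr_nonneg[OF clamp1_in] by auto
  obtain H where H: "\<And>v. v \<in> {0..M} \<Longrightarrow> support_slope n v \<le> H" "0 \<le> H"
  proof -
    have "compact ((\<lambda>(v, p). F v p) ` ({0..M} \<times> {0..real n + 1}))"
      by (intro compact_continuous_image compact_Times continuous_on_subset[OF F_cont]) auto
    then have "bdd_above ((\<lambda>(v, p). F v p) ` ({0..M} \<times> {0..real n + 1}))"
      by (intro bounded_imp_bdd_above compact_imp_bounded)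
    then obtain H where H: "\<And>v p. v \<in> {0..M} \<Longrightarrow> p \<in> {0..real n + 1} \<Longrightarrow> F v p \<le> H"
      unfolding bdd_above_def by fastforce
    have "support_slope n v \<le> max H 0" if "v \<in> {0..M}" for v
    proof -
      have "support_slope n v \<le> F v (trunc_slope n v + 1) - F v (trunc_slope n v)" by (rule support_slope_supports)
      also have "\<dots> \<le> F v (trunc_slope n v + 1)" using F_nonneg by simp
      also have "\<dots> \<le> H" using that trunc_slope_bounds[of n v] by (intro H) auto
      finally show ?thesis by simp
    qed
    then show thesis using that[of "max H 0"] by auto
  qed
  \<comment> \<open>Bounded on the whole line, as \<open>transport_comparison\<close> demands; all values of \<open>u\<close> and \<open>g\<close> lie in \<open>{0..M}\<close>.\<close>
  define h where "h v = (if v \<in> {0..M} then support_slope n v else 0)" for v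
  have [measurable]: "h \<in> borel_measurable borel" unfolding h_def by measurable
  have h: "0 \<le> h v" "h v \<le> H" for v using H support_slope_supports(1)[of n v] by (auto simp: h_def)
  define K where "K = (\<integral>\<^sup>+x\<in>{-1..1}. ennreal (h (u x) * trunc_slope n (u x)) \<partial>lborel)"
  have "K \<le> (\<integral>\<^sup>+x\<in>{-1..1::real}. ennreal (H * real n) \<partial>lborel)"
    unfolding K_def using h H trunc_slope_bounds
    by (intro nn_integral_mono) (auto simp: indicator_def intro!: ennreal_leI mult_mono)
  also have "\<dots> < top" by (simp add: nn_integral_cmult ennreal_mult_less_top)
  finally have K: "K \<noteq> top" by simp
  let ?C = "\<integral>\<^sup>+x\<in>{-1..1}. ennreal (h (u x) * (a x (u x) * \<bar>du x\<bar>)) \<partial>lborel"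
  have "K = (\<integral>\<^sup>+x\<in>{-1..1}. ennreal (h (g x) * trunc_slope n (g x)) \<partial>lborel)"
    unfolding K_def by (rule equimeasurable[symmetric, of "\<lambda>v. ennreal (h v * trunc_slope n v)"]) measurable
  also have "\<dots> \<le> (\<integral>\<^sup>+x\<in>{-1..1}. ennreal (h (g x) * (a x (g x) * D x)) \<partial>lborel)"
  proof (rule nn_integral_mono_AE)
    show "AE x in lborel. ennreal (h (g x) * trunc_slope n (g x)) * indicator {-1..1} x
      \<le> ennreal (h (g x) * (a x (g x) * D x)) * indicator {-1..1} x"
      using AE_level_slope_g
    proof eventually_elim
      case (elim x)
      then show ?case using trunc_slope_bounds(3)[of n "g x"] h(1)[of "g x"]
        by (auto simp: indicator_def intro!: ennreal_leI mult_left_mono)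
    qed
  qed
  also have "\<dots> \<le> ?C"
    by (rule transport_comparison[OF _ h]) measurable
  finally have K_le: "K \<le> ?C" .
  let ?E = "\<integral>\<^sup>+x\<in>{-1..1}. ennreal (F (u x) (a x (u x) * \<bar>du x\<bar>)) \<partial>lborel"
  let ?G = "\<integral>\<^sup>+x\<in>{-1..1}. ennreal (F (u x) (trunc_slope n (u x))) \<partial>lborel"
  have "K + ?G \<le> ?C + ?G"
    using K_le by (rule add_right_mono)
  also have "\<dots> = (\<integral>\<^sup>+x. ennreal (h (u x) * (a x (u x) * \<bar>du x\<bar>)) * indicator {-1..1} x
      + ennreal (F (u x) (trunc_slope n (u x))) * indicator {-1..1} x \<partial>lborel)"
    by (rule nn_integral_add[symmetric]) auto
  also have "\<dots> \<le> (\<integral>\<^sup>+x. ennreal (h (u x) * trunc_slope n (u x)) * indicator {-1..1} x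
      + ennreal (F (u x) (a x (u x) * \<bar>du x\<bar>)) * indicator {-1..1} x \<partial>lborel)"
  proof (intro nn_integral_mono)
    fix x
    show "ennreal (h (u x) * (a x (u x) * \<bar>du x\<bar>)) * indicator {-1..1} x
      + ennreal (F (u x) (trunc_slope n (u x))) * indicator {-1..1} x
      \<le> ennreal (h (u x) * trunc_slope n (u x)) * indicator {-1..1} x
      + ennreal (F (u x) (a x (u x) * \<bar>du x\<bar>)) * indicator {-1..1} x"
    proof (cases "x \<in> {-1..1}")
      case True
      define p where "p = a x (u x) * \<bar>du x\<bar>"
      have p0: "0 \<le> p" by (simp add: p_def a_nonneg)
      have "F (u x) (trunc_slope n (u x)) + support_slope n (u x) * (p - trunc_slope n (u x)) \<le> F (u x) p" by (rule support_slope_supports(3)[OF p0])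
      then have "h (u x) * p + F (u x) (trunc_slope n (u x)) \<le> h (u x) * trunc_slope n (u x) + F (u x) p"
        using uM[OF True] by (simp add: h_def algebra_simps)
      then have "ennreal (h (u x) * p) + ennreal (F (u x) (trunc_slope n (u x))) \<le> ennreal (h (u x) * trunc_slope n (u x)) + ennreal (F (u x) p)"
        using h(1)[of "u x"] p0 F_nonneg trunc_slope_bounds(1)[of n "u x"]
        by (simp add: ennreal_plus[symmetric] ennreal_leI del: ennreal_plus)
      then show ?thesis using True by (simp add: p_def)
    qed simp
  qed
  also have "\<dots> = K + ?E"
    unfolding K_def by (rule nn_integral_add) auto
  finally have "?G \<le> ?E" using K by (simp add: ennreal_add_left_cancel_le)
  moreover have "(\<integral>\<^sup>+x\<in>{-1..1}. ennreal (F (g x) (trunc_slope n (g x))) \<partial>lborel) = ?G"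
    by (rule equimeasurable[of "\<lambda>v. ennreal (F v (trunc_slope n v))"]) measurable
  ultimately show ?thesis by simp
qed

theorem rearranged_energy_le:
  "(\<integral>\<^sup>+x\<in>{-1..1}. ennreal (F (g x) (a x (g x) * D x)) \<partial>lborel)
    \<le> (\<integral>\<^sup>+x\<in>{-1..1}. ennreal (F (u x) (a x (u x) * \<bar>du x\<bar>)) \<partial>lborel)"
proof -
  let ?f = "\<lambda>n x. ennreal (F (g x) (trunc_slope n (g x))) * indicator {-1..1} x"
  have "(\<integral>\<^sup>+x\<in>{-1..1}. ennreal (F (g x) (a x (g x) * D x)) \<partial>lborel) = (\<integral>\<^sup>+x\<in>{-1..1}. ennreal (F (g x) (level_slope (g x))) \<partial>lborel)"
  proof (rule nn_integral_cong_AE)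
    show "AE x in lborel. ennreal (F (g x) (a x (g x) * D x)) * indicator {-1..1} x = ennreal (F (g x) (level_slope (g x))) * indicator {-1..1} x"
      using AE_level_slope_g by eventually_elim (auto simp: indicator_def)
  qed
  also have "\<dots> \<le> (\<integral>\<^sup>+x. (SUP n. ?f n x) \<partial>lborel)"
  proof (intro nn_integral_mono)
    fix x
    obtain n :: nat where "level_slope (g x) \<le> n" using real_arch_simple by blast
    then have "ennreal (F (g x) (level_slope (g x))) * indicator {-1..1} x = ?f n x"
      by (simp add: trunc_slope_def)
    also have "\<dots> \<le> (SUP n. ?f n x)" by (rule SUP_upper) simp
    finally show "ennreal (F (g x) (level_slope (g x))) * indicator {-1..1} x \<le> (SUP n. ?f n x)" .
  qed
  also have "\<dots> = (SUP n. \<integral>\<^sup>+x. ?f n x \<partial>lborel)"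
  proof (rule nn_integral_monotone_convergence_SUP)
    show "incseq (\<lambda>n x. ?f n x)"
    proof (rule incseq_SucI, rule le_funI)
      fix n x
      have "trunc_slope n (g x) \<le> trunc_slope (Suc n) (g x)" using level_slope_nonneg[of "g x"] by (auto simp: trunc_slope_def)
      then have "F (g x) (trunc_slope n (g x)) \<le> F (g x) (trunc_slope (Suc n) (g x))"
        using trunc_slope_bounds(1) by (intro mono_onD[OF F_mono]) auto
      then show "?f n x \<le> ?f (Suc n) x"
        by (intro mult_right_mono ennreal_leI) auto
    qed
  qed measurable
  also have "\<dots> \<le> (\<integral>\<^sup>+x\<in>{-1..1}. ennreal (F (u x) (a x (u x) * \<bar>du x\<bar>)) \<partial>lborel)"
    by (rule SUP_least) (rule truncated_energy)
  finally show ?thesis .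
qed

end

text \<open>
  Both forms are needed: the energy refers to \<open>f\<close> itself, the comparison to its extension to the line.
\<close>

lemma left_derivative_AE:
  assumes ac: "absolutely_continuous_on {-1..1} f"
  shows "AE x in lborel. x \<in> {-1<..<1} \<longrightarrow>
    (f has_real_derivative left_derivative (\<lambda>x. f (clamp1 x)) x) (at x) \<and>
    ((\<lambda>x. f (clamp1 x)) has_real_derivative left_derivative (\<lambda>x. f (clamp1 x)) x) (at x)"
proof -
  obtain N where N: "negligible N" "\<And>x. x \<in> {-1<..<1} - N \<Longrightarrow> f differentiable (at x)"
    using absolutely_continuous_on_imp_ae_differentiable[OF ac] by metis
  have "AE x in lebesgue. x \<notin> N" using N(1) by (simp add: negligible_iff_null_sets AE_not_in)
  then have "AE x in lborel. x \<notin> N" by (simp add: AE_completion_iff)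
  then show ?thesis
  proof eventually_elim
    case (elim x)
    show ?case
    proof
      assume x: "x \<in> {-1<..<1}"
      then obtain d where d: "(f has_real_derivative d) (at x)"
        using N(2)[of x] elim by (auto simp: real_differentiable_def)
      have "eventually (\<lambda>y. y \<in> {-1<..<1}) (nhds x)" using x by (intro eventually_nhds_in_open) auto
      then have "eventually (\<lambda>y. f (clamp1 y) = f y) (nhds x)"
        by eventually_elim (simp add: clamp1_id)
      then have d': "((\<lambda>x. f (clamp1 x)) has_real_derivative d) (at x)"
        using d DERIV_cong_ev[of x x "\<lambda>x. f (clamp1 x)" f d d] by simp
      from left_derivative_eq[OF this] d d'
      show "(f has_real_derivative left_derivative (\<lambda>x. f (clamp1 x)) x) (at x) \<and>
        ((\<lambda>x. f (clamp1 x)) has_real_derivative left_derivative (\<lambda>x. f (clamp1 x)) x) (at x)" by simp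
    qed
  qed
qed

lemma energy_eq_lborel:
  assumes "AE x in lborel. x \<in> {-1<..<1} \<longrightarrow> (f has_real_derivative d x) (at x)"
  shows "energy F a f = (\<integral>\<^sup>+x\<in>{-1..1}. ennreal (F (f x) (a x (f x) * \<bar>d x\<bar>)) \<partial>lborel)"
proof -
  have "AE x in lborel. x \<noteq> -1 \<and> x \<noteq> (1::real)" by (intro AE_conjI AE_lborel_singleton)
  with assms have "AE x in lborel. ennreal (F (f x) (a x (f x) * \<bar>deriv f x\<bar>)) * indicator {-1..1} x
    = ennreal (F (f x) (a x (f x) * \<bar>d x\<bar>)) * indicator {-1..1} x"
    by eventually_elim (auto simp: indicator_def dest: DERIV_imp_deriv)
  then show ?thesis
    unfolding energy_def nn_integral_completion by (rule nn_integral_cong_AE)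
qed

text \<open>
  The data are extended to the whole line by composing with the projections onto \<open>[-1,1]\<close> and \<open>[0,\<infinity>[\<close>.
  This changes neither the energies nor the rearrangement, and makes all functions globally continuous or Borel.
\<close>

theorem theorem3:
  fixes F a :: "real \<Rightarrow> real \<Rightarrow> real" and u :: "real \<Rightarrow> real"
  assumes F: "F \<in> class_F"
    and u_W11: "absolutely_continuous_on {-1..1} u"
    and u_nonneg: "\<And>x. x \<in> {-1..1} \<Longrightarrow> 0 \<le> u x"
    and a_cont: "continuous_on ({-1..1} \<times> {0..}) (\<lambda>(x, v). a x v)"
    and a_nonneg: "\<And>x v. x \<in> {-1..1} \<Longrightarrow> 0 \<le> v \<Longrightarrow> 0 \<le> a x v"
    and a_triangle: "\<And>s t v. -1 \<le> s \<Longrightarrow> s \<le> t \<Longrightarrow> t \<le> 1 \<Longrightarrow> 0 \<le> v \<Longrightarrow>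
                       a s v + a t v \<ge> a (1 - t + s) v"
    and a_even: "\<And>x v. x \<in> {-1..1} \<Longrightarrow> 0 \<le> v \<Longrightarrow> a x v = a (- x) v"
    and finite_energy: "energy F a u < \<infinity>"
  shows "energy F a (rearr u) \<le> energy F a u"
proof -
  define u' where "u' x = u (clamp1 x)" for x
  define a' where "a' x v = a (clamp1 x) (max 0 v)" for x v
  define F' where "F' v p = F (max 0 v) (max 0 p)" for v p
  define du where "du = left_derivative u'"
  have u'_eq: "u' x = u x" if "x \<in> {-1..1}" for x using that by (simp add: u'_def clamp1_id)
  have rearr_eq: "rearr u' = rearr u"
  proof -
    have "{y \<in> {-1..1}. u' y > t} = {y \<in> {-1..1}. u y > t}" for t using u'_eq by auto
    then show ?thesis unfolding rearr_def by presburger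
  qed
  have ac': "absolutely_continuous_on {-1..1} u'"
  proof -
    have "ac_bound {-1..1} u' \<epsilon> \<delta>" if "ac_bound {-1..1} u \<epsilon> \<delta>" for \<epsilon> \<delta>
      unfolding ac_bound_def
    proof (intro allI impI)
      fix n :: nat and l r :: "nat \<Rightarrow> real"
      assume lr: "\<forall>i<n. l i \<le> r i \<and> {l i..r i} \<subseteq> {-1..1}"
        and "disjoint_family_on (\<lambda>i. {l i<..<r i}) {..<n}" "(\<Sum>i<n. r i - l i) < \<delta>"
      then have "(\<Sum>i<n. \<bar>u (r i) - u (l i)\<bar>) < \<epsilon>"
        using that unfolding ac_bound_def by blast
      moreover have "(\<Sum>i<n. \<bar>u' (r i) - u' (l i)\<bar>) = (\<Sum>i<n. \<bar>u (r i) - u (l i)\<bar>)"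
        using lr by (intro sum.cong) (auto simp: u'_eq)
      ultimately show "(\<Sum>i<n. \<bar>u' (r i) - u' (l i)\<bar>) < \<epsilon>" by simp
    qed
    then show ?thesis using u_W11 unfolding absolutely_continuous_on_iff_ac_bound by meson
  qed
  have cont': "continuous_on UNIV u'"
    unfolding u'_def
    by (rule continuous_on_compose2[OF absolutely_continuous_on_imp_continuous_on[OF u_W11] clamp1_continuous])
       (use clamp1_in in auto)
  interpret nonneg_profile u'
  proof
    show "0 \<le> u' x" for x using u_nonneg[OF clamp1_in[of x]] by (simp add: u'_def)
  qed (rule cont')
  define g where "g x = rearr u' (clamp1 x)" for x
  define D where "D x = max 0 (left_derivative g x)" for x
  have g_mono: "g x \<le> g y" if "x \<le> y" for x y
    unfolding g_def using that by (intro rearr_mono clamp1_in clamp1_mono)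
  have g_borel [measurable]: "g \<in> borel_measurable borel"
    using g_mono by (intro borel_measurable_mono) (auto simp: mono_def)
  have du_AE: "AE x in lborel. x \<in> {-1<..<1} \<longrightarrow> (u has_real_derivative du x) (at x)"
    "AE x in lborel. x \<in> {-1<..<1} \<longrightarrow> (u' has_real_derivative du x) (at x)"
    using left_derivative_AE[OF u_W11] unfolding du_def u'_def by (eventually_elim, blast)+
  have D_AE: "AE x in lborel. x \<in> {-1<..<1} \<longrightarrow> (rearr u' has_real_derivative D x) (at x)"
    using left_derivative_AE[OF rearr_absolutely_continuous[OF ac']]
  proof eventually_elim
    case (elim x)
    show ?case
    proof
      assume "x \<in> {-1<..<1}"
      then have d: "(rearr u' has_real_derivative left_derivative g x) (at x)"
        "(g has_real_derivative left_derivative g x) (at x)"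
        using elim unfolding g_def by auto
      have "0 \<le> left_derivative g x"
        using mono_on_imp_deriv_nonneg[of UNIV g "left_derivative g x" x] d(2) g_mono
        by (auto simp: mono_on_def)
      then show "(rearr u' has_real_derivative D x) (at x)" using d(1) by (simp add: D_def)
    qed
  qed
  have pair_cont: "continuous_on UNIV (\<lambda>p. (clamp1 (fst p), max 0 (snd p :: real)))" "continuous_on UNIV (\<lambda>p. (max 0 (fst p :: real), max 0 (snd p :: real)))"
    unfolding clamp1_def by (intro continuous_intros)+
  interpret E: energy_comparison u' du D a' F'
  proof unfold_locales
    show "absolutely_continuous_on {-1..1} u'" by (rule ac')
    show "du \<in> borel_measurable borel" unfolding du_def by measurable
    show "AE x in lborel. x \<in> {-1<..<1} \<longrightarrow> (u' has_real_derivative du x) (at x)" by (rule du_AE)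
    show "D \<in> borel_measurable borel" unfolding D_def by measurable
    show "0 \<le> D x" for x by (simp add: D_def)
    show "AE x in lborel. x \<in> {-1<..<1} \<longrightarrow> (rearr u' has_real_derivative D x) (at x)" by (rule D_AE)
    show "continuous_on UNIV (\<lambda>(x, v). a' x v)"
    proof -
      have "range (\<lambda>p. (clamp1 (fst p), max 0 (snd p :: real))) \<subseteq> {-1..1} \<times> {0..}" using clamp1_in by auto
      from continuous_on_compose2[OF a_cont pair_cont(1) this] show ?thesis by (simp add: a'_def case_prod_beta)
    qed
    show "0 \<le> a' x v" for x v using a_nonneg[OF clamp1_in] by (simp add: a'_def)
    show "a' (1 - t + s) v \<le> a' s v + a' t v" if "-1 \<le> s" "s \<le> t" "t \<le> 1" for s t v
      using a_triangle[OF that, of "max 0 v"] that by (simp add: a'_def clamp1_id)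
    show "a' (- x) v = a' x v" if "x \<in> {-1..1}" for x v
      using a_even[OF that, of "max 0 v"] that by (simp add: a'_def clamp1_id)
    show "D x = 0" if "y < x" "\<And>z. z \<in> {y..x} \<Longrightarrow> rearr u' (clamp1 z) = rearr u' (clamp1 x)" for x y
    proof -
      have "left_derivative g x = 0"
        by (rule left_derivative_flat[OF that(1)], unfold g_def, rule that(2))
      then show ?thesis by (simp add: D_def)
    qed
    show "continuous_on UNIV (\<lambda>(v, p). F' v p)"
    proof -
      have Fc: "continuous_on ({0..} \<times> {0..}) (\<lambda>(v, p). F v p)" using F by (simp add: class_F_def)
      have "range (\<lambda>p. (max 0 (fst p :: real), max 0 (snd p :: real))) \<subseteq> {0..} \<times> {0..}" by auto
      from continuous_on_compose2[OF Fc pair_cont(2) this] show ?thesis by (simp add: F'_def case_prod_beta)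
    qed
    show "0 \<le> F' v p" for v p using F by (simp add: F'_def class_F_def)
    show "convex_on {0..} (F' v)" for v
    proof -
      have conv: "convex_on {0..} (F (max 0 v))" using F by (simp add: class_F_def)
      show ?thesis
        unfolding convex_on_def
      proof (intro conjI ballI allI impI)
        fix x y k l :: real assume "x \<in> {0..}" "y \<in> {0..}" "0 \<le> k" "0 \<le> l" "k + l = 1"
        moreover from this have "0 \<le> k * x + l * y" by simp
        ultimately show "F' v (k *\<^sub>R x + l *\<^sub>R y) \<le> k * F' v x + l * F' v y"
          using conv unfolding convex_on_def by (simp add: F'_def)
      qed simp
    qed
    show "mono_on {0..} (F' v)" for v
    proof -
      have "strict_mono_on {0..} (F (max 0 v))" using F by (simp add: class_F_def)
      then show ?thesis by (auto simp: mono_on_def F'_def dest: strict_mono_on_leD)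
    qed
  qed
  have "energy F a (rearr u) = (\<integral>\<^sup>+x\<in>{-1..1}. ennreal (F (rearr u x) (a x (rearr u x) * \<bar>D x\<bar>)) \<partial>lborel)"
    by (rule energy_eq_lborel) (use D_AE rearr_eq in simp)
  also have "\<dots> = (\<integral>\<^sup>+x\<in>{-1..1}. ennreal (F' (g x) (a' x (g x) * D x)) \<partial>lborel)"
  proof (rule nn_integral_cong)
    fix x
    show "ennreal (F (rearr u x) (a x (rearr u x) * \<bar>D x\<bar>)) * indicator {-1..1} x
      = ennreal (F' (g x) (a' x (g x) * D x)) * indicator {-1..1} x"
    proof (cases "x \<in> {-1..1}")
      case True
      have "0 \<le> rearr u x" using rearr_nonneg[OF True] rearr_eq by simp
      moreover from this have "0 \<le> a x (rearr u x)" using a_nonneg[OF True] by simp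
      moreover have "0 \<le> D x" by (simp add: D_def)
      ultimately show ?thesis using True rearr_eq by (simp add: F'_def a'_def g_def clamp1_id)
    qed simp
  qed
  also have "\<dots> \<le> (\<integral>\<^sup>+x\<in>{-1..1}. ennreal (F' (u' x) (a' x (u' x) * \<bar>du x\<bar>)) \<partial>lborel)"
    unfolding g_def by (rule E.rearranged_energy_le[unfolded E.g_def])
  also have "\<dots> = (\<integral>\<^sup>+x\<in>{-1..1}. ennreal (F (u x) (a x (u x) * \<bar>du x\<bar>)) \<partial>lborel)"
  proof (rule nn_integral_cong)
    fix x
    show "ennreal (F' (u' x) (a' x (u' x) * \<bar>du x\<bar>)) * indicator {-1..1} x
      = ennreal (F (u x) (a x (u x) * \<bar>du x\<bar>)) * indicator {-1..1} x"
    proof (cases "x \<in> {-1..1}")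
      case True
      then show ?thesis using u_nonneg[OF True] a_nonneg[OF True, of "u x"] by (simp add: F'_def a'_def u'_eq clamp1_id)
    qed simp
  qed
  also have "\<dots> = energy F a u"
    by (rule energy_eq_lborel[symmetric]) (rule du_AE)
  finally show ?thesis .
qed

end
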